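(* Assume that $|u(q^\dagger)|\ge c_0$ in $\Omega$ for some constant $c_0>0$. Then for any $\epsilon\in(0,\tfrac12)$ there is a constant $C>0$ (independent of $q$) such that $$\|q-q^\dagger\|_{H^{-1-\epsilon}(\Omega)}\le C\,\|u(q)-u(q^\dagger)\|_{1,\Omega}\qquad\text{for all } q\in K.$$
   Context: $\Omega\subset\mathbb{R}^d$ ($d=2,3$) is an open bounded connected domain with $C^2$ boundary. Standing assumptions: $a\in W^{1,\infty}(\Omega)$ has a positive lower bound, $f\in L^2(\Omega)$, $g\in H^{3/2}(\partial\Omega)$. With constants $0<\underline q\le\bar q$, the admissible set is $K=\{q\in L^2(\Omega): \underline q\le q\le\bar q \text{ a.e. in }\Omega\}$. For $q\in K$, $u(q)\in H^2(\Omega)$ denotes the unique solution of $$-\nabla\cdot(a\nabla u)+q u=f\ \text{ in }\Omega,\qquad u=g\ \text{ on }\partial\Omega.$$ $q^\dagger\in K$ is the true radiativity. $\|\cdot\|_{s,\Omega}$ denotes the norm of the Sobolev space $H^s(\Omega)$ ($\|\cdot\|_{0,\Omega}$ being the $L^2(\Omega)$ norm). For $s>0$, $H^s_0(\Omega)$ is the completion of $C_c^\infty(\Omega)$ under $\|\cdot\|_{s,\Omega}$, and $H^{-s}(\Omega)$ is the dual space of $H_0^s(\Omega)$ with respect to the $L^2(\Omega)$ inner product. *)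

theory Defs
  imports "HOL-Analysis.Analysis"
begin

text \<open>
  Elements of Lebesgue and Sobolev spaces on an open set \<open>\<Omega>\<close> are represented by functions on the
  whole type; only their restriction to \<open>\<Omega>\<close> matters, and membership and norms are invariant
  under modification on a null set.
\<close>

section \<open>Classical derivatives and test functions\<close>

text \<open>
  A derivative \<open>\<partial>\<^sub>i\<^sub>1 \<dots> \<partial>\<^sub>i\<^sub>m\<close> is indexed by the list of its coordinate directions.
\<close>

definition dirs :: "nat \<Rightarrow> 'a::euclidean_space list set" where
  "dirs m = {\<alpha>. set \<alpha> \<subseteq> Basis \<and> length \<alpha> = m}"

fun partials :: "'a::euclidean_space list \<Rightarrow> ('a \<Rightarrow> real) \<Rightarrow> 'a \<Rightarrow> real" where
  "partials [] f = f"
| "partials (b # \<alpha>) f = (\<lambda>x. frechet_derivative (partials \<alpha> f) (at x) b)"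

definition C_k :: "nat \<Rightarrow> ('a::euclidean_space \<Rightarrow> real) \<Rightarrow> bool" where
  "C_k k f \<longleftrightarrow>
     (\<forall>m<k. \<forall>\<alpha>\<in>dirs m. partials \<alpha> f differentiable_on UNIV) \<and>
     (\<forall>m\<le>k. \<forall>\<alpha>\<in>dirs m. continuous_on UNIV (partials \<alpha> f))"

definition C_infinity :: "('a::euclidean_space \<Rightarrow> real) \<Rightarrow> bool" where
  "C_infinity f \<longleftrightarrow> (\<forall>k. C_k k f)"

definition grad :: "('a::euclidean_space \<Rightarrow> real) \<Rightarrow> 'a \<Rightarrow> 'a" where
  "grad f x = (\<Sum>b\<in>Basis. partials [b] f x *\<^sub>R b)"

text \<open>The space $C_c^\infty(\Omega)$.\<close>

definition test_functions :: "'a::euclidean_space set \<Rightarrow> ('a \<Rightarrow> real) set" where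
  "test_functions \<Omega> =
     {\<phi>. C_infinity \<phi> \<and> compact (closure {x. \<phi> x \<noteq> 0}) \<and> closure {x. \<phi> x \<noteq> 0} \<subseteq> \<Omega>}"

section \<open>Lebesgue spaces and weak derivatives\<close>

definition L2 :: "'a measure \<Rightarrow> ('a \<Rightarrow> real) set" where
  "L2 M = {u \<in> borel_measurable M. integrable M (\<lambda>x. (u x)\<^sup>2)}"

definition L2_norm :: "'a measure \<Rightarrow> ('a \<Rightarrow> real) \<Rightarrow> real" where
  "L2_norm M u = sqrt (\<integral>x. (u x)\<^sup>2 \<partial>M)"

definition Linf :: "'a measure \<Rightarrow> ('a \<Rightarrow> real) set" where
  "Linf M = {u \<in> borel_measurable M. \<exists>B. AE x in M. \<bar>u x\<bar> \<le> B}"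

definition locally_integrable ::
  "'a::euclidean_space set \<Rightarrow> ('a \<Rightarrow> 'b::euclidean_space) \<Rightarrow> bool" where
  "locally_integrable \<Omega> u \<longleftrightarrow> (\<forall>S. compact S \<and> S \<subseteq> \<Omega> \<longrightarrow> integrable (lebesgue_on S) u)"

definition has_weak_deriv ::
  "'a::euclidean_space set \<Rightarrow> 'a list \<Rightarrow> ('a \<Rightarrow> real) \<Rightarrow> ('a \<Rightarrow> real) \<Rightarrow> bool" where
  "has_weak_deriv \<Omega> \<alpha> u v \<longleftrightarrow>
     locally_integrable \<Omega> u \<and> locally_integrable \<Omega> v \<and>
     (\<forall>\<phi>\<in>test_functions \<Omega>.
        (\<integral>x. u x * partials \<alpha> \<phi> x \<partial>lebesgue_on \<Omega>) =
        (- 1) ^ length \<alpha> * (\<integral>x. v x * \<phi> x \<partial>lebesgue_on \<Omega>))"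

definition weak_deriv ::
  "'a::euclidean_space set \<Rightarrow> 'a list \<Rightarrow> ('a \<Rightarrow> real) \<Rightarrow> 'a \<Rightarrow> real" where
  "weak_deriv \<Omega> \<alpha> u = (SOME v. has_weak_deriv \<Omega> \<alpha> u v)"

definition weak_grad :: "'a::euclidean_space set \<Rightarrow> ('a \<Rightarrow> real) \<Rightarrow> 'a \<Rightarrow> 'a" where
  "weak_grad \<Omega> u x = (\<Sum>b\<in>Basis. weak_deriv \<Omega> [b] u x *\<^sub>R b)"

definition has_weak_div ::
  "'a::euclidean_space set \<Rightarrow> ('a \<Rightarrow> 'a) \<Rightarrow> ('a \<Rightarrow> real) \<Rightarrow> bool" where
  "has_weak_div \<Omega> F w \<longleftrightarrow>
     locally_integrable \<Omega> F \<and> locally_integrable \<Omega> w \<and>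
     (\<forall>\<phi>\<in>test_functions \<Omega>.
        (\<integral>x. F x \<bullet> grad \<phi> x \<partial>lebesgue_on \<Omega>) = - (\<integral>x. w x * \<phi> x \<partial>lebesgue_on \<Omega>))"

section \<open>Sobolev spaces\<close>

text \<open>The space $W^{k,\infty}(\Omega)$.\<close>

definition W_inf :: "nat \<Rightarrow> 'a::euclidean_space set \<Rightarrow> ('a \<Rightarrow> real) set" where
  "W_inf k \<Omega> =
     {u. \<forall>m\<le>k. \<forall>\<alpha>\<in>dirs m. \<exists>v\<in>Linf (lebesgue_on \<Omega>). has_weak_deriv \<Omega> \<alpha> u v}"

text \<open>
  The squared Gagliardo seminorm
  $\int_\Omega\int_\Omega |u(x)-u(y)|^2 / |x-y|^{d+2\sigma}\,dy\,dx$, possibly infinite.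
\<close>

definition gagliardo :: "real \<Rightarrow> 'a::euclidean_space set \<Rightarrow> ('a \<Rightarrow> real) \<Rightarrow> ennreal" where
  "gagliardo \<sigma> \<Omega> u =
     (\<integral>\<^sup>+x. (\<integral>\<^sup>+y. ennreal ((u x - u y)\<^sup>2 / norm (x - y) powr (real DIM('a) + 2 * \<sigma>))
        \<partial>lebesgue_on \<Omega>) \<partial>lebesgue_on \<Omega>)"

text \<open>
  $H^s(\Omega)$ for real $s \ge 0$ is the Sobolev--Slobodeckij space: with $s = k + \sigma$,
  $k = \lfloor s\rfloor$, the squared norm is the sum of the squared $L^2$ norms of all weak
  derivatives of order at most $k$ and, if $\sigma > 0$, of the squared Gagliardo seminorms of
  order $\sigma$ of the derivatives of order $k$.
\<close>

definition Hs_norm_sq :: "real \<Rightarrow> 'a::euclidean_space set \<Rightarrow> ('a \<Rightarrow> real) \<Rightarrow> ennreal" where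
  "Hs_norm_sq s \<Omega> u =
     (\<Sum>m\<le>nat \<lfloor>s\<rfloor>. \<Sum>\<alpha>\<in>dirs m. \<integral>\<^sup>+x. ennreal ((weak_deriv \<Omega> \<alpha> u x)\<^sup>2) \<partial>lebesgue_on \<Omega>) +
     (if frac s = 0 then 0
      else \<Sum>\<alpha>\<in>dirs (nat \<lfloor>s\<rfloor>). gagliardo (frac s) \<Omega> (weak_deriv \<Omega> \<alpha> u))"

definition Hs :: "real \<Rightarrow> 'a::euclidean_space set \<Rightarrow> ('a \<Rightarrow> real) set" where
  "Hs s \<Omega> =
     {u. (\<forall>m\<le>nat \<lfloor>s\<rfloor>. \<forall>\<alpha>\<in>dirs m. \<exists>v. has_weak_deriv \<Omega> \<alpha> u v) \<and> Hs_norm_sq s \<Omega> u < \<infinity>}"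

definition Hs_norm :: "real \<Rightarrow> 'a::euclidean_space set \<Rightarrow> ('a \<Rightarrow> real) \<Rightarrow> real" where
  "Hs_norm s \<Omega> u = sqrt (enn2real (Hs_norm_sq s \<Omega> u))"

text \<open>
  The completion of $C_c^\infty(\Omega)$ under the norm of $H^s(\Omega)$, realised as the closure
  inside the complete space $H^s(\Omega)$.
\<close>

definition Hs0 :: "real \<Rightarrow> 'a::euclidean_space set \<Rightarrow> ('a \<Rightarrow> real) set" where
  "Hs0 s \<Omega> =
     {u \<in> Hs s \<Omega>. \<exists>\<phi>::nat \<Rightarrow> 'a \<Rightarrow> real. (\<forall>n. \<phi> n \<in> test_functions \<Omega>) \<and>
        (\<lambda>n. Hs_norm s \<Omega> (\<lambda>x. u x - \<phi> n x)) \<longlonglongrightarrow> 0}"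

text \<open>
  The norm of $H^{-s}(\Omega)$, the dual of $H^s_0(\Omega)$, on functionals; it is extended-valued so
  that an unbounded functional has norm \<open>\<infinity>\<close>. A function \<open>w\<close> is an element of $H^{-s}(\Omega)$
  through the $L^2(\Omega)$ inner product.
\<close>

definition dual_norm ::
  "real \<Rightarrow> 'a::euclidean_space set \<Rightarrow> (('a \<Rightarrow> real) \<Rightarrow> real) \<Rightarrow> ennreal" where
  "dual_norm s \<Omega> l = (SUP v\<in>{v \<in> Hs0 s \<Omega>. Hs_norm s \<Omega> v \<le> 1}. ennreal \<bar>l v\<bar>)"

definition H_neg_norm :: "real \<Rightarrow> 'a::euclidean_space set \<Rightarrow> ('a \<Rightarrow> real) \<Rightarrow> ennreal" where
  "H_neg_norm s \<Omega> w = dual_norm s \<Omega> (\<lambda>v. \<integral>x. w x * v x \<partial>lebesgue_on \<Omega>)"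

section \<open>The boundary\<close>

text \<open>
  A \<open>C\<^sup>k\<close> graph chart: in the rotated coordinates \<open>(y, t) \<mapsto> z + L y + t \<nu>\<close>, with \<open>L\<close> a linear
  isometry of \<open>\<real>\<^sup>d\<^sup>-\<^sup>1\<close> (the type \<open>'b\<close>) onto the hyperplane orthogonal to the unit vector \<open>\<nu>\<close>, the
  set \<open>\<Omega>\<close> is inside the cylinder \<open>\<bar>y\<bar> < r\<close>, \<open>\<bar>t\<bar> < h\<close> the region above the graph of \<open>\<gamma>\<close>.
\<close>

definition graph_chart ::
  "nat \<Rightarrow> 'a::euclidean_space set \<Rightarrow> 'a \<Rightarrow> ('b::euclidean_space \<Rightarrow> 'a) \<Rightarrow> 'a \<Rightarrow> ('b \<Rightarrow> real) \<Rightarrow>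
    real \<Rightarrow> real \<Rightarrow> bool" where
  "graph_chart k \<Omega> z L \<nu> \<gamma> r h \<longleftrightarrow>
     linear L \<and> (\<forall>y. norm (L y) = norm y) \<and> norm \<nu> = 1 \<and> (\<forall>y. L y \<bullet> \<nu> = 0) \<and>
     C_k k \<gamma> \<and> r > 0 \<and> h > 0 \<and> (\<forall>y\<in>ball 0 r. \<bar>\<gamma> y\<bar> < h) \<and>
     (\<forall>y\<in>ball 0 r. \<forall>t\<in>{-h<..<h}. z + L y + t *\<^sub>R \<nu> \<in> \<Omega> \<longleftrightarrow> \<gamma> y < t)"

definition C_k_boundary :: "'b::euclidean_space itself \<Rightarrow> nat \<Rightarrow> 'a::euclidean_space set \<Rightarrow> bool" where
  "C_k_boundary _ k \<Omega> \<longleftrightarrow>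
     (\<forall>z\<in>frontier \<Omega>. \<exists>(L::'b \<Rightarrow> 'a) \<nu> \<gamma> r h. graph_chart k \<Omega> z L \<nu> \<gamma> r h)"

text \<open>
  $H^s(\partial\Omega)$, $0 \le s \le k$, for a bounded \<open>\<Omega>\<close> with \<open>C\<^sup>k\<close> boundary: the functions that
  belong to $H^s$ in every \<open>C\<^sup>k\<close> graph parametrisation of a piece of the boundary.
\<close>

definition Hs_boundary ::
  "'b::euclidean_space itself \<Rightarrow> nat \<Rightarrow> real \<Rightarrow> 'a::euclidean_space set \<Rightarrow> ('a \<Rightarrow> real) set" where
  "Hs_boundary _ k s \<Omega> =
     {g. \<forall>z (L::'b \<Rightarrow> 'a) \<nu> \<gamma> r h. graph_chart k \<Omega> z L \<nu> \<gamma> r h \<longrightarrow>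
           (\<lambda>y. g (z + L y + \<gamma> y *\<^sub>R \<nu>)) \<in> Hs s (ball 0 r)}"

definition hausdorff_outer :: "real \<Rightarrow> 'a::metric_space set \<Rightarrow> ennreal" where
  "hausdorff_outer s A =
     (SUP \<delta>\<in>{0<..}. INF U\<in>{U::nat \<Rightarrow> 'a set. A \<subseteq> (\<Union>i. U i) \<and>
                                (\<forall>i. bounded (U i) \<and> diameter (U i) \<le> \<delta>)}.
        \<Sum>i. ennreal (unit_ball_vol s * (diameter (U i) / 2) powr s))"

text \<open>
  Hausdorff measure of dimension \<open>s > 0\<close>, on the sets that are Caratheodory measurable for the
  outer measure.
\<close>

definition hausdorff_measure :: "real \<Rightarrow> 'a::metric_space measure" where
  "hausdorff_measure s =
     measure_of UNIV (lambda_system UNIV (Pow UNIV) (hausdorff_outer s)) (hausdorff_outer s)"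

definition surface_measure :: "'a::euclidean_space set \<Rightarrow> 'a measure" where
  "surface_measure \<Omega> = restrict_space (hausdorff_measure (real DIM('a) - 1)) (frontier \<Omega>)"

text \<open>
  The trace operator $H^1(\Omega) \to L^2(\partial\Omega)$ is the continuous extension of
  $\phi \mapsto \phi|_{\partial\Omega}$ from functions that are smooth up to the boundary.
\<close>

definition has_trace :: "'a::euclidean_space set \<Rightarrow> ('a \<Rightarrow> real) \<Rightarrow> ('a \<Rightarrow> real) \<Rightarrow> bool" where
  "has_trace \<Omega> u g \<longleftrightarrow>
     u \<in> Hs 1 \<Omega> \<and> g \<in> L2 (surface_measure \<Omega>) \<and>
     (\<exists>\<phi>::nat \<Rightarrow> 'a \<Rightarrow> real. (\<forall>n. C_infinity (\<phi> n)) \<and>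
        (\<lambda>n. Hs_norm 1 \<Omega> (\<lambda>x. u x - \<phi> n x)) \<longlonglongrightarrow> 0 \<and>
        (\<lambda>n. L2_norm (surface_measure \<Omega>) (\<lambda>x. g x - \<phi> n x)) \<longlonglongrightarrow> 0)"

section \<open>The boundary value problem\<close>

definition admissible :: "'a::euclidean_space set \<Rightarrow> real \<Rightarrow> real \<Rightarrow> ('a \<Rightarrow> real) set" where
  "admissible \<Omega> q_lo q_hi =
     {q \<in> L2 (lebesgue_on \<Omega>). AE x in lebesgue_on \<Omega>. q_lo \<le> q x \<and> q x \<le> q_hi}"

text \<open>
  \<open>u\<close> is an $H^2(\Omega)$ solution of $-\nabla\cdot(a\nabla u) + q u = f$ in \<open>\<Omega>\<close>, $u = g$ on
  $\partial\Omega$: the equation holds almost everywhere, the boundary condition in the sense of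
  traces.
\<close>

definition solves_bvp ::
  "'a::euclidean_space set \<Rightarrow> ('a \<Rightarrow> real) \<Rightarrow> ('a \<Rightarrow> real) \<Rightarrow> ('a \<Rightarrow> real) \<Rightarrow> ('a \<Rightarrow> real) \<Rightarrow>
    ('a \<Rightarrow> real) \<Rightarrow> bool" where
  "solves_bvp \<Omega> a f g q u \<longleftrightarrow>
     u \<in> Hs 2 \<Omega> \<and>
     (\<exists>w. has_weak_div \<Omega> (\<lambda>x. a x *\<^sub>R weak_grad \<Omega> u x) w \<and>
          (AE x in lebesgue_on \<Omega>. - w x + q x * u x = f x)) \<and>
     has_trace \<Omega> u g"

end

theory Submission
  imports Defs
begin

text \<open>
  Write \<open>u\<^sub>0 = u(q\<^sup>\<dagger>)\<close> and \<open>w = u(q) - u\<^sub>0\<close>. Subtracting the two equations gives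
  \<open>(q - q\<^sup>\<dagger>) u\<^sub>0 = \<nabla>\<cdot>(a\<nabla>w) - q w\<close>, and testing with \<open>\<phi>/u\<^sub>0\<close> for a test function \<open>\<phi>\<close> bounds
  \<open>\<integral>(q - q\<^sup>\<dagger>) \<phi>\<close> by the \<open>H\<^sup>1\<close> norm of \<open>w\<close> times the \<open>L\<^sup>2\<close> norms of \<open>\<phi>\<close>, \<open>\<nabla>\<phi>\<close> and \<open>\<phi> \<nabla>u\<^sub>0/u\<^sub>0\<close>.
  The last one is controlled by testing the equation of \<open>u\<^sub>0\<close> itself with \<open>\<phi>\<^sup>2/u\<^sub>0\<close>, which leaves only
  \<open>\<integral>\<bar>q\<^sup>\<dagger> u\<^sub>0 - f\<bar> \<phi>\<^sup>2/\<bar>u\<^sub>0\<bar>\<close>; this is at most a multiple of \<open>\<parallel>\<phi>\<parallel>\<^sup>2\<close> in \<open>L\<^sup>4\<close>, hence in \<open>H\<^sup>1\<close> by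
  Ladyzhenskaya's inequality in dimensions two and three. Since the \<open>H\<^sup>1\<close> norm is dominated by the
  \<open>H\<^sup>1\<^sup>+\<^sup>\<epsilon>\<close> norm, the estimate extends to \<open>H\<^sup>1\<^sup>+\<^sup>\<epsilon>\<^sub>0\<close> by density.
\<close>

section \<open>Smooth functions\<close>

text \<open>Two obstacles shape the argument. A weak divergence may be tested only with smooth
  functions of compact support, whereas \<open>\<phi>/u\<^sub>0\<close> contains a Sobolev function.
  So \<open>u\<^sub>0\<close> is mollified near the support of \<phi>; as a mollification may vanish
  even where \<open>u\<^sub>0\<close> does not, 1/t is replaced by t/(t^2 + \<eta>), and \<eta>
  tends to 0 only after the mollification radius has done so. The other obstacle is that
  \<open>\<phi> \<nabla>u\<^sub>0/u\<^sub>0\<close> has to be bounded by the H^1 norm of \<phi>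
  alone. The choice \<open>\<phi>\<^sup>2/u\<^sub>0\<close> works because differentiating
  \<open>1/u\<^sub>0\<close> produces the very quantity sought, weighted by a, with a definite sign;
  the cross term with \<nabla>\<phi> is half absorbed by Young's inequality. What remains is paired
  with a function that is only square integrable, so \<open>\<phi>\<^sup>2\<close> has to be taken
  in L^2: this is the origin of the L^4 norm. The constant is built from the bounds on a, the lower
  bound of \<open>\<bar>u\<^sub>0\<bar>\<close>, the upper bound of the admissible set and the L^2
  norm of the divergence belonging to \<open>u\<^sub>0\<close>, hence is the same for all q.\<close>

lemma partials_snoc: "partials (\<alpha> @ [b]) f = partials \<alpha> (partials [b] f)"
  by (induction \<alpha>) auto

lemma dirs_0: "dirs 0 = {[]}"
  by (auto simp: dirs_def)

lemma dirs_Suc: "dirs (Suc m) = (\<Union>b\<in>Basis. (\<lambda>\<alpha>. \<alpha> @ [b]) ` dirs m)"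
proof (intro set_eqI iffI)
  fix \<alpha> :: "'a list" assume "\<alpha> \<in> dirs (Suc m)"
  then show "\<alpha> \<in> (\<Union>b\<in>Basis. (\<lambda>\<alpha>. \<alpha> @ [b]) ` dirs m)"
    by (cases \<alpha> rule: rev_cases) (auto simp: dirs_def)
qed (auto simp: dirs_def)

lemma dirs_1: "dirs (Suc 0) = (\<lambda>b. [b]) ` Basis"
  by (auto simp: dirs_Suc dirs_0)

lemma all_dirs_Suc: "(\<forall>\<alpha>\<in>dirs (Suc m). P \<alpha>) \<longleftrightarrow> (\<forall>b\<in>Basis. \<forall>\<alpha>\<in>dirs m. P (\<alpha> @ [b]))"
  by (auto simp: dirs_Suc)

lemma C_k_0: "C_k 0 f \<longleftrightarrow> continuous_on UNIV f"
  by (simp add: C_k_def dirs_0)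

text \<open>The head of a list of directions is the outermost derivative and its last entry the
  innermost one. Peeling off the last entry turns the definition by lists into a recursion on the
  order, which carries every smoothness induction below.\<close>

lemma C_k_Suc:
  "C_k (Suc k) f \<longleftrightarrow> f differentiable_on UNIV \<and> (\<forall>b\<in>Basis. C_k k (partials [b] f))"
proof -
  have *: "(\<forall>m<Suc k. P m) \<longleftrightarrow> P 0 \<and> (\<forall>m<k. P (Suc m))"
    "(\<forall>m\<le>Suc k. P m) \<longleftrightarrow> P 0 \<and> (\<forall>m\<le>k. P (Suc m))" for P :: "nat \<Rightarrow> bool"
    by (auto simp: All_less_Suc2 All_less_Suc2[of "Suc k", unfolded less_Suc_eq_le])
  show ?thesis
    unfolding C_k_def * all_dirs_Suc partials_snoc
    by (auto simp: dirs_0 differentiable_imp_continuous_on)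
qed

lemma C_k_lower: "C_k (Suc k) f \<Longrightarrow> C_k k f"
  unfolding C_k_def by (meson less_SucI le_SucI)

lemma C_infinity_iff:
  "C_infinity f \<longleftrightarrow> f differentiable_on UNIV \<and> (\<forall>b\<in>Basis. C_infinity (partials [b] f))"
  unfolding C_infinity_def using C_k_Suc C_k_lower by blast

lemma C_infinity_differentiable: "C_infinity f \<Longrightarrow> f differentiable (at x)"
  using C_infinity_iff[of f] by (auto simp: differentiable_on_def)

lemma C_infinity_partial: "C_infinity f \<Longrightarrow> b \<in> Basis \<Longrightarrow> C_infinity (partials [b] f)"
  using C_infinity_iff[of f] by auto

lemma C_infinity_continuous: "C_infinity f \<Longrightarrow> continuous_on S f"
  using C_infinity_iff[of f] differentiable_imp_continuous_on continuous_on_subset by blast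

lemma grad_inner: "b \<in> Basis \<Longrightarrow> grad f x \<bullet> b = partials [b] f x"
  by (simp add: grad_def inner_sum_left inner_Basis if_distrib cong: if_cong)

lemma has_derivative_grad:
  assumes "f differentiable (at x)"
  shows "(f has_derivative (\<lambda>h. grad f x \<bullet> h)) (at x)"
proof -
  have d: "(f has_derivative frechet_derivative f (at x)) (at x)"
    using assms frechet_derivative_works by blast
  then interpret bounded_linear "frechet_derivative f (at x)" by (rule has_derivative_bounded_linear)
  have "frechet_derivative f (at x) h = grad f x \<bullet> h" for h
  proof -
    have "frechet_derivative f (at x) h = frechet_derivative f (at x) (\<Sum>b\<in>Basis. (h \<bullet> b) *\<^sub>R b)"
      by (simp add: euclidean_representation)
    also have "\<dots> = (\<Sum>b\<in>Basis. (h \<bullet> b) * frechet_derivative f (at x) b)"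
      by (simp add: sum scaleR)
    also have "\<dots> = grad f x \<bullet> h"
      by (simp add: grad_def inner_sum_left inner_commute[of h] mult.commute)
    finally show ?thesis .
  qed
  then have "frechet_derivative f (at x) = (\<lambda>h. grad f x \<bullet> h)" by (rule ext)
  then show ?thesis using d by simp
qed

section \<open>Closure of the smoothness classes under algebraic operations\<close>

lemma partials_eqI:
  assumes "\<And>x. (f has_derivative D x) (at x)"
  shows "partials [b] f = (\<lambda>x. D x b)"
  using frechet_derivative_at[OF assms] by (auto simp: fun_eq_iff)

lemma C_k_SucI:
  assumes "\<And>x. (f has_derivative D x) (at x)" "\<And>b. b \<in> Basis \<Longrightarrow> C_k k (\<lambda>x. D x b)"
  shows "C_k (Suc k) f"
  unfolding C_k_Suc using assms partials_eqI[OF assms(1)]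
  by (auto simp: differentiable_on_def differentiable_def)

lemma C_k_const: "C_k k (\<lambda>x. c)"
proof (induction k arbitrary: c)
  case (Suc k)
  show ?case by (rule C_k_SucI[where D="\<lambda>x h. 0"]) (auto simp: Suc)
qed (auto simp: C_k_0)

lemma has_derivative_partials:
  assumes "C_k (Suc k) f"
  shows "(f has_derivative (\<lambda>h. grad f x \<bullet> h)) (at x)"
  using assms has_derivative_grad by (auto simp: C_k_Suc differentiable_on_def)

lemma C_k_add: "C_k k f \<Longrightarrow> C_k k g \<Longrightarrow> C_k k (\<lambda>x. f x + g x)"
proof (induction k arbitrary: f g)
  case (Suc k)
  show ?case
    by (rule C_k_SucI[where D="\<lambda>x h. grad f x \<bullet> h + grad g x \<bullet> h"])
      (use Suc in \<open>auto intro!: derivative_intros has_derivative_partials simp: grad_inner C_k_Suc\<close>)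
qed (auto simp: C_k_0 intro!: continuous_intros)

lemma C_k_partial: "C_k (Suc k) f \<Longrightarrow> b \<in> Basis \<Longrightarrow> C_k k (\<lambda>x. grad f x \<bullet> b)"
  by (simp add: C_k_Suc grad_inner del: partials.simps)

lemma C_k_mult: "C_k k f \<Longrightarrow> C_k k g \<Longrightarrow> C_k k (\<lambda>x. f x * g x)"
proof (induction k arbitrary: f g)
  case (Suc k)
  show ?case
  proof (rule C_k_SucI)
    show "((\<lambda>x. f x * g x) has_derivative (\<lambda>h. f x * (grad g x \<bullet> h) + (grad f x \<bullet> h) * g x)) (at x)" for x
      by (intro has_derivative_mult has_derivative_partials[OF Suc.prems(1)] has_derivative_partials[OF Suc.prems(2)])
    show "C_k k (\<lambda>x. f x * (grad g x \<bullet> b) + (grad f x \<bullet> b) * g x)" if "b \<in> Basis" for b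
      using Suc.prems that by (intro C_k_add Suc.IH C_k_partial Suc.prems[THEN C_k_lower])
  qed
qed (auto simp: C_k_0 intro!: continuous_intros)

lemma C_k_inverse: "C_k k f \<Longrightarrow> (\<And>x. f x \<noteq> 0) \<Longrightarrow> C_k k (\<lambda>x. inverse (f x))"
proof (induction k)
  case (Suc k)
  show ?case
  proof (rule C_k_SucI)
    show "((\<lambda>x. inverse (f x)) has_derivative (\<lambda>h. - (inverse (f x) * (grad f x \<bullet> h) * inverse (f x)))) (at x)" for x
      using Deriv.has_derivative_inverse[OF Suc.prems(2) has_derivative_partials[OF Suc.prems(1)]] .
    fix b :: 'a assume b: "b \<in> Basis"
    have "C_k k (\<lambda>x. inverse (f x))" using Suc.IH[OF C_k_lower] Suc.prems by blast
    then have "C_k k (\<lambda>x. -1 * (inverse (f x) * (grad f x \<bullet> b) * inverse (f x)))"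
      using Suc.prems(1) b by (intro C_k_mult C_k_const C_k_partial)
    then show "C_k k (\<lambda>x. - (inverse (f x) * (grad f x \<bullet> b) * inverse (f x)))" by simp
  qed
qed (auto simp: C_k_0 intro!: continuous_intros)

lemma C_infinity_const: "C_infinity (\<lambda>x. c)"
  by (simp add: C_infinity_def C_k_const)

lemma C_infinity_add: "C_infinity f \<Longrightarrow> C_infinity g \<Longrightarrow> C_infinity (\<lambda>x. f x + g x)"
  by (simp add: C_infinity_def C_k_add)

lemma C_infinity_mult: "C_infinity f \<Longrightarrow> C_infinity g \<Longrightarrow> C_infinity (\<lambda>x. f x * g x)"
  by (simp add: C_infinity_def C_k_mult)

lemma C_infinity_inverse: "C_infinity f \<Longrightarrow> (\<And>x. f x \<noteq> 0) \<Longrightarrow> C_infinity (\<lambda>x. inverse (f x))"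
  by (simp add: C_infinity_def C_k_inverse)

lemma C_infinity_diff: "C_infinity f \<Longrightarrow> C_infinity g \<Longrightarrow> C_infinity (\<lambda>x. f x - g x)"
  using C_infinity_add[of f "\<lambda>x. -1 * g x"] C_infinity_mult[OF C_infinity_const[of "-1"], of g] by simp

lemma C_infinity_inner: "C_infinity (\<lambda>x. c \<bullet> x)"
  unfolding C_infinity_def
proof
  fix k
  have "C_k (Suc k) (\<lambda>x. c \<bullet> x)"
    by (rule C_k_SucI[where D="\<lambda>x h. c \<bullet> h"]) (auto intro!: derivative_eq_intros C_k_const)
  then show "C_k k (\<lambda>x. c \<bullet> x)" by (rule C_k_lower)
qed

text \<open>The smooth function \<open>exp (-1/t)\<close> extended by zero belongs to the family
  \<open>t\<^sup>-\<^sup>n exp (-1/t)\<close>, which is closed under differentiation up to linear combinations.\<close>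

definition flat_exp :: "nat \<Rightarrow> real \<Rightarrow> real" where
  "flat_exp n t = (if t > 0 then exp (- inverse t) * inverse t ^ n else 0)"

lemma flat_exp_deriv:
  "(flat_exp n has_real_derivative flat_exp (n + 2) t - real n * flat_exp (n + 1) t) (at t)"
proof -
  consider "t > 0" | "t < 0" | "t = 0" by linarith
  then show ?thesis
  proof cases
    case 1
    have "((\<lambda>t. exp (- inverse t) * inverse t ^ n) has_real_derivative
        exp (- inverse t) * (inverse t * inverse t) * inverse t ^ n +
        exp (- inverse t) * (real n * inverse t ^ (n - Suc 0) * - (inverse t * inverse t))) (at t)"
      using 1 by (auto intro!: derivative_eq_intros)
    also have "exp (- inverse t) * (inverse t * inverse t) * inverse t ^ n +
        exp (- inverse t) * (real n * inverse t ^ (n - Suc 0) * - (inverse t * inverse t)) =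
        flat_exp (n + 2) t - real n * flat_exp (n + 1) t"
      using 1 by (cases n) (simp_all add: flat_exp_def algebra_simps)
    finally have "((\<lambda>t. exp (- inverse t) * inverse t ^ n) has_real_derivative
        flat_exp (n + 2) t - real n * flat_exp (n + 1) t) (at t)" .
    then show ?thesis
      by (rule has_field_derivative_transform_within_open[where S="{0<..}"]) (use 1 in \<open>auto simp: flat_exp_def\<close>)
  next
    case 2
    have "((\<lambda>t. 0) has_real_derivative flat_exp (n + 2) t - real n * flat_exp (n + 1) t) (at t)"
      using 2 by (auto simp: flat_exp_def)
    then show ?thesis
      by (rule has_field_derivative_transform_within_open[where S="{..<0}"]) (use 2 in \<open>auto simp: flat_exp_def\<close>)
  next
    case 3
    \<comment> \<open>With s = 1/h the expression is s^(n+1) exp(-s), and the exponential beats the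
      power as s tends to infinity.\<close>
    have lim: "((\<lambda>h. exp (- inverse h) * inverse h ^ Suc n) \<longlongrightarrow> 0) (at_right (0::real))"
    proof -
      have "filterlim inverse at_top (at_right (0::real))"
        by (rule filterlim_inverse_at_top_right)
      from filterlim_compose[OF tendsto_power_div_exp_0[of "Suc n"] this]
      show ?thesis by (simp add: exp_minus divide_inverse mult.commute)
    qed
    have r: "((\<lambda>h. flat_exp n h / h) \<longlongrightarrow> 0) (at_right 0)"
      by (rule Lim_transform_eventually[OF lim])
        (auto simp: eventually_at_filter flat_exp_def field_simps)
    have l: "((\<lambda>h. flat_exp n h / h) \<longlongrightarrow> 0) (at_left 0)"
      by (rule Lim_transform_eventually[OF tendsto_const])
        (auto simp: eventually_at_filter flat_exp_def)
    show ?thesis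
      using filterlim_split_at[OF l r] 3 by (simp add: DERIV_def flat_exp_def)
  qed
qed

text \<open>The index \<open>n\<close> must stay arbitrary in the induction: one differentiation
  leads from level \<open>n\<close> to the levels \<open>n + 1\<close> and
  \<open>n + 2\<close>.\<close>

lemma C_k_flat_exp: "C_infinity g \<Longrightarrow> C_k k (\<lambda>x. flat_exp n (g x))"
proof (induction k arbitrary: n)
  case 0
  have "continuous_on UNIV (flat_exp n)"
    using flat_exp_deriv DERIV_isCont continuous_at_imp_continuous_on by blast
  then show ?case
    using C_infinity_continuous[OF 0] by (auto simp: C_k_0 intro: continuous_on_compose2)
next
  case (Suc k)
  show ?case
  proof (rule C_k_SucI)
    fix x
    have "(g has_derivative (\<lambda>h. grad g x \<bullet> h)) (at x)"
      using Suc.prems C_infinity_differentiable has_derivative_grad by blast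
    from has_derivative_compose[OF this] flat_exp_deriv[of n "g x"]
    show "((\<lambda>x. flat_exp n (g x)) has_derivative
        (\<lambda>h. (flat_exp (n + 2) (g x) + - real n * flat_exp (n + 1) (g x)) * (grad g x \<bullet> h))) (at x)"
      by (auto simp: has_field_derivative_def)
  next
    fix b :: 'a assume "b \<in> Basis"
    then show "C_k k (\<lambda>x. (flat_exp (n + 2) (g x) + - real n * flat_exp (n + 1) (g x)) * (grad g x \<bullet> b))"
      using Suc C_infinity_partial[of g b]
      by (intro C_k_mult C_k_add C_k_const Suc.IH) (auto simp: grad_inner C_infinity_def simp del: partials.simps)
  qed
qed

text \<open>The standard mollifier profile exp(-1/(r^2 - |x|^2)) inside the ball of radius r,
  extended by zero and not yet normalised.\<close>

definition bump :: "real \<Rightarrow> 'a::euclidean_space \<Rightarrow> real" where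
  "bump r x = flat_exp 0 (r\<^sup>2 - x \<bullet> x)"

lemma flat_exp_nonneg: "0 \<le> flat_exp n t"
  by (simp add: flat_exp_def)

lemma bump_nonneg: "0 \<le> bump r x"
  by (simp add: bump_def flat_exp_nonneg)

lemma bump_nonzero_iff: "0 < r \<Longrightarrow> bump r x \<noteq> 0 \<longleftrightarrow> norm x < r"
  by (simp add: bump_def flat_exp_def dot_square_norm) (metis power2_less_imp_less power_strict_mono norm_ge_zero zero_less_numeral less_imp_le)

lemma bump_minus: "bump r (- x) = bump r x"
  by (simp add: bump_def)

text \<open>The squared distance is expanded into a polynomial in the coordinate functionals, so
  that the closure rules apply; the second form follows because the profile is even.\<close>

lemma C_infinity_bump: "C_infinity (\<lambda>y. bump r (y - x))" "C_infinity (\<lambda>y. bump r (x - y))"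
proof -
  have eq: "(y - x) \<bullet> (y - x) = (\<Sum>b\<in>Basis. (b \<bullet> y) * (b \<bullet> y)) - 2 * (x \<bullet> y) + x \<bullet> x" for y
    by (simp add: inner_diff_left inner_diff_right euclidean_inner[of y y] inner_commute)
  have s: "C_infinity (\<lambda>y. \<Sum>b\<in>A. (b \<bullet> y) * (b \<bullet> y))" if "finite A" for A :: "'a set"
    using that by (induction A) (auto intro!: C_infinity_const C_infinity_add C_infinity_mult C_infinity_inner)
  have "C_infinity (\<lambda>y. r\<^sup>2 - (y - x) \<bullet> (y - x))"
    unfolding eq by (intro C_infinity_diff C_infinity_add C_infinity_mult C_infinity_const C_infinity_inner s) auto
  then show 1: "C_infinity (\<lambda>y. bump r (y - x))"
    by (auto simp: C_infinity_def bump_def intro: C_k_flat_exp simp: C_infinity_def)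
  then show "C_infinity (\<lambda>y. bump r (x - y))"
    using bump_minus[of r "x - _"] by simp
qed

section \<open>Test functions and convolution\<close>

declare partials.simps(2) [simp del]

lemma test_functions_mono: "\<phi> \<in> test_functions S \<Longrightarrow> S \<subseteq> T \<Longrightarrow> \<phi> \<in> test_functions T"
  by (auto simp: test_functions_def)

lemma test_functionsD:
  assumes "\<phi> \<in> test_functions S"
  shows "C_infinity \<phi>" "compact (closure {x. \<phi> x \<noteq> 0})" "closure {x. \<phi> x \<noteq> 0} \<subseteq> S"
    "\<And>x. \<phi> differentiable (at x)" "continuous_on A \<phi>"
  using assms C_infinity_differentiable C_infinity_continuous by (auto simp: test_functions_def)

lemma test_functionsI:
  assumes "C_infinity \<psi>" "compact K" "K \<subseteq> S" "\<And>x. x \<notin> K \<Longrightarrow> \<psi> x = 0"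
  shows "\<psi> \<in> test_functions S"
proof -
  have *: "closure {x. \<psi> x \<noteq> 0} \<subseteq> K"
    using assms by (intro closure_minimal compact_imp_closed) auto
  then have "compact (closure {x. \<psi> x \<noteq> 0})"
    using assms(2) by (metis closed_closure compact_Int_closed inf.absorb_iff2)
  then show ?thesis using assms * by (auto simp: test_functions_def)
qed

lemma partials_eq_0:
  assumes "open U" "x \<in> U" "\<And>y. y \<in> U \<Longrightarrow> \<phi> y = 0"
  shows "partials [b] \<phi> x = 0"
proof -
  have "((\<lambda>x. 0) has_derivative (\<lambda>h. 0)) (at x)" by simp
  then have "(\<phi> has_derivative (\<lambda>h. 0)) (at x)"
    by (rule has_derivative_transform_within_open[OF _ assms(1,2)]) (simp add: assms(3))
  from frechet_derivative_at[OF this] show ?thesis by (simp add: fun_eq_iff partials.simps)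
qed

lemma partials_outside_support:
  assumes "x \<notin> closure {x. \<phi> x \<noteq> 0}"
  shows "partials [b] \<phi> x = 0"
proof (rule partials_eq_0)
  show "open (- closure {x. \<phi> x \<noteq> 0})" "x \<in> - closure {x. \<phi> x \<noteq> 0}" using assms by auto
  show "\<phi> y = 0" if "y \<in> - closure {x. \<phi> x \<noteq> 0}" for y
    using that closure_subset[of "{x. \<phi> x \<noteq> 0}"] by auto
qed

lemma test_functions_partial:
  assumes "\<phi> \<in> test_functions S" "b \<in> Basis"
  shows "partials [b] \<phi> \<in> test_functions S"
  using test_functionsD[OF assms(1)] C_infinity_partial assms(2) partials_outside_support[of _ \<phi>]
  by (intro test_functionsI[where K="closure {x. \<phi> x \<noteq> 0}"]) auto

lemma test_functions_mult:
  assumes "\<phi> \<in> test_functions S" "C_infinity g"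
  shows "(\<lambda>x. \<phi> x * g x) \<in> test_functions S"
proof (rule test_functionsI[where K="closure {x. \<phi> x \<noteq> 0}"])
  show "\<phi> x * g x = 0" if "x \<notin> closure {x. \<phi> x \<noteq> 0}" for x
    using that closure_subset[of "{x. \<phi> x \<noteq> 0}"] by auto
qed (use test_functionsD[OF assms(1)] assms(2) C_infinity_mult in auto)

lemma test_functions_bounded:
  assumes "\<phi> \<in> test_functions S"
  obtains B where "B \<ge> 0" "\<And>x. \<bar>\<phi> x\<bar> \<le> B"
proof -
  let ?K = "closure {x. \<phi> x \<noteq> 0}"
  have "bounded (\<phi> ` ?K)"
    using test_functionsD[OF assms] by (intro compact_imp_bounded compact_continuous_image)
  then obtain B where B: "\<And>x. x \<in> ?K \<Longrightarrow> \<bar>\<phi> x\<bar> \<le> B" by (auto simp: bounded_iff)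
  have "\<bar>\<phi> x\<bar> \<le> max B 0" for x
    using B[of x] closure_subset[of "{x. \<phi> x \<noteq> 0}"] by (cases "\<phi> x = 0") (auto simp: le_max_iff_disj)
  then show ?thesis using that[of "max B 0"] by auto
qed

lemma norm_grad_le: "norm (grad \<phi> x) \<le> (\<Sum>b\<in>Basis. \<bar>partials [b] \<phi> x\<bar>)"
  unfolding grad_def by (rule order_trans[OF norm_sum]) simp

text \<open>The partial derivatives are again test functions and hence bounded, so the mean value
  inequality on the whole space supplies a global constant.\<close>

lemma test_functions_lipschitz:
  assumes "\<phi> \<in> test_functions S"
  obtains L where "L \<ge> 0" "\<And>x y. \<bar>\<phi> x - \<phi> y\<bar> \<le> L * norm (x - y)"
proof -
  have "\<forall>b\<in>Basis. \<exists>B. \<forall>x. B \<ge> 0 \<and> \<bar>partials [b] \<phi> x\<bar> \<le> B"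
    by (metis test_functions_bounded test_functions_partial assms)
  from bchoice[OF this] 
  obtain B where B: "\<And>b x. b \<in> Basis \<Longrightarrow> B b \<ge> 0 \<and> \<bar>partials [b] \<phi> x\<bar> \<le> B b" by blast
  have "norm (\<phi> x - \<phi> y) \<le> (\<Sum>b\<in>Basis. B b) * norm (x - y)" for x y
  proof (rule differentiable_bound[OF convex_UNIV])
    show "(\<phi> has_derivative (\<lambda>h. grad \<phi> x \<bullet> h)) (at x within UNIV)" for x
      using has_derivative_grad[OF test_functionsD(4)[OF assms]] by simp
    show "onorm (\<lambda>h. grad \<phi> x \<bullet> h) \<le> (\<Sum>b\<in>Basis. B b)" for x
    proof (rule onorm_le)
      fix h
      have "norm (grad \<phi> x) \<le> (\<Sum>b\<in>Basis. B b)"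
        by (rule order_trans[OF norm_grad_le]) (use B in \<open>auto intro: sum_mono\<close>)
      then show "norm (grad \<phi> x \<bullet> h) \<le> (\<Sum>b\<in>Basis. B b) * norm h"
        using order_trans[OF Cauchy_Schwarz_ineq2 mult_right_mono[OF _ norm_ge_zero]] by simp
    qed
  qed auto
  moreover have "(\<Sum>b\<in>Basis. B b) \<ge> 0" using B by (auto intro: sum_nonneg)
  ultimately show ?thesis using that by auto
qed

text \<open>The gradient is Lipschitz because its components are test functions. That
  \<open>L\<close> does not depend on \<open>x\<close> is the point: the remainder at
  \<open>x - y\<close> can be integrated against any integrable function of \<open>y\<close>, which
  is how convolutions are differentiated.\<close>

lemma test_functions_taylor:
  assumes "\<phi> \<in> test_functions S"
  obtains L where "L \<ge> 0" "\<And>x h. \<bar>\<phi> (x + h) - \<phi> x - grad \<phi> x \<bullet> h\<bar> \<le> L * (norm h)\<^sup>2"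
proof -
  have "\<forall>b\<in>Basis. \<exists>B. \<forall>x y. B \<ge> 0 \<and> \<bar>partials [b] \<phi> x - partials [b] \<phi> y\<bar> \<le> B * norm (x - y)"
    by (metis test_functions_lipschitz test_functions_partial assms)
  from bchoice[OF this]
  obtain B where B: "\<And>b x y. b \<in> Basis \<Longrightarrow> B b \<ge> 0 \<and> \<bar>partials [b] \<phi> x - partials [b] \<phi> y\<bar> \<le> B b * norm (x - y)"
    by blast
  define L where "L = (\<Sum>b\<in>Basis. B b)"
  have L0: "L \<ge> 0" using B by (auto simp: L_def intro: sum_nonneg)
  have lip: "norm (grad \<phi> x - grad \<phi> y) \<le> L * norm (x - y)" for x y
  proof -
    have "norm (grad \<phi> x - grad \<phi> y) \<le> (\<Sum>b\<in>Basis. \<bar>(grad \<phi> x - grad \<phi> y) \<bullet> b\<bar>)"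
      by (rule norm_le_l1)
    also have "\<dots> \<le> (\<Sum>b\<in>Basis. B b * norm (x - y))"
      using B by (intro sum_mono) (simp add: inner_diff_left grad_inner)
    finally show ?thesis by (simp add: L_def sum_distrib_right)
  qed
  have "\<bar>\<phi> (x + h) - \<phi> x - grad \<phi> x \<bullet> h\<bar> \<le> L * (norm h)\<^sup>2" for x h
  proof -
    have "norm (\<phi> (x + h) - \<phi> x - grad \<phi> x \<bullet> ((x + h) - x)) \<le> norm ((x + h) - x) * (L * norm h)"
    proof (rule differentiable_bound_linearization[where S="cball x (norm h)" and f'="\<lambda>y h. grad \<phi> y \<bullet> h"])
      show "x + t *\<^sub>R (x + h - x) \<in> cball x (norm h)" if "t \<in> {0..1}" for t
        using that by (auto simp: dist_norm mult_left_le_one_le)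
      show "(\<phi> has_derivative (\<lambda>h. grad \<phi> y \<bullet> h)) (at y within cball x (norm h))" for y
        by (rule has_derivative_at_withinI[OF has_derivative_grad[OF test_functionsD(4)[OF assms]]])
      show "onorm ((\<lambda>h. grad \<phi> y \<bullet> h) - (\<lambda>h. grad \<phi> x \<bullet> h)) \<le> L * norm h" if "y \<in> cball x (norm h)" for y
      proof (rule onorm_le)
        fix k
        have "norm (((\<lambda>h. grad \<phi> y \<bullet> h) - (\<lambda>h. grad \<phi> x \<bullet> h)) k) = \<bar>(grad \<phi> y - grad \<phi> x) \<bullet> k\<bar>"
          by (simp add: inner_diff_left)
        also have "\<dots> \<le> norm (grad \<phi> y - grad \<phi> x) * norm k" by (rule Cauchy_Schwarz_ineq2)
        also have "\<dots> \<le> (L * norm h) * norm k"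
          using lip[of y x] that L0 mult_left_mono[of "norm (y - x)" "norm h" L]
          by (intro mult_right_mono) (auto simp: dist_norm norm_minus_commute)
        finally show "norm (((\<lambda>h. grad \<phi> y \<bullet> h) - (\<lambda>h. grad \<phi> x \<bullet> h)) k) \<le> L * norm h * norm k" .
      qed
    qed auto
    then show ?thesis by (simp add: power2_eq_square mult_ac)
  qed
  then show ?thesis using that L0 by blast
qed

lemma test_functions_measurable [measurable_dest]:
  "\<phi> \<in> test_functions S \<Longrightarrow> \<phi> \<in> borel_measurable borel"
  using test_functionsD(5)[of \<phi> S UNIV] by (auto intro: borel_measurable_continuous_onI)

section \<open>Convolution of an integrable function with a test function\<close>

definition conv :: "('a::euclidean_space \<Rightarrow> real) \<Rightarrow> ('a \<Rightarrow> real) \<Rightarrow> 'a \<Rightarrow> real" where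
  "conv \<phi> h x = (\<integral>y. \<phi> (x - y) * h y \<partial>lborel)"

lemma integrable_conv:
  assumes "\<phi> \<in> test_functions S" "integrable lborel h"
  shows "integrable lborel (\<lambda>y. \<phi> (x - y) * h y)"
proof -
  obtain B where B: "\<And>x. \<bar>\<phi> x\<bar> \<le> B" using test_functions_bounded[OF assms(1)] by blast
  have [measurable]: "\<phi> \<in> borel_measurable borel" "h \<in> borel_measurable borel"
    using assms test_functions_measurable by auto
  show ?thesis
    by (rule Bochner_Integration.integrable_bound[of _ "\<lambda>y. B * \<bar>h y\<bar>"])
      (use assms(2) B order_trans[OF B abs_ge_self] in \<open>auto simp: abs_mult intro!: mult_right_mono\<close>)
qed

text \<open>Integrating the uniform Taylor remainder against |h| bounds the error of the linear
  approximation by \<open>L * H\<close> times the square of |k|, where \<open>H\<close> is the L^1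
  norm of \<open>h\<close>.\<close>

lemma has_derivative_conv:
  assumes "\<phi> \<in> test_functions S" "integrable lborel h"
  shows "(conv \<phi> h has_derivative (\<lambda>k. \<Sum>b\<in>Basis. (k \<bullet> b) * conv (partials [b] \<phi>) h x)) (at x)"
proof -
  obtain L where L: "L \<ge> 0" "\<And>x k. \<bar>\<phi> (x + k) - \<phi> x - grad \<phi> x \<bullet> k\<bar> \<le> L * (norm k)\<^sup>2"
    using test_functions_taylor[OF assms(1)] by blast
  define D where "D k = (\<Sum>b\<in>Basis. (k \<bullet> b) * conv (partials [b] \<phi>) h x)" for k
  define H where "H = (\<integral>y. \<bar>h y\<bar> \<partial>lborel)"
  have i: "integrable lborel (\<lambda>y. \<phi> (x - y) * h y)" for x
    using integrable_conv assms by blast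
  have ib: "integrable lborel (\<lambda>y. partials [b] \<phi> (x - y) * h y)" if "b \<in> Basis" for b
    using integrable_conv[OF test_functions_partial[OF assms(1) that] assms(2)] .
  have gk: "grad \<phi> z \<bullet> k = (\<Sum>b\<in>Basis. (k \<bullet> b) * partials [b] \<phi> z)" for z k
    by (simp add: grad_def inner_sum_left inner_commute[of k] mult.commute)
  have igk: "integrable lborel (\<lambda>y. (grad \<phi> (x - y) \<bullet> k) * h y)" for k
    unfolding gk sum_distrib_right mult.assoc by (intro Bochner_Integration.integrable_sum integrable_mult_right ib)
  have Dk: "D k = (\<integral>y. (grad \<phi> (x - y) \<bullet> k) * h y \<partial>lborel)" for k
    unfolding gk sum_distrib_right mult.assoc D_def conv_def
    by (subst Bochner_Integration.integral_sum) (auto intro!: integrable_mult_right ib)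
  have bd: "norm (conv \<phi> h (x + k) - conv \<phi> h x - D k) \<le> (L * H * norm k) * norm k" for k
  proof -
    have "conv \<phi> h (x + k) - conv \<phi> h x - D k = 
       (\<integral>y. \<phi> (x + k - y) * h y - \<phi> (x - y) * h y - (grad \<phi> (x - y) \<bullet> k) * h y \<partial>lborel)"
      unfolding conv_def Dk by (simp add: i igk)
    also have "norm \<dots> \<le> (\<integral>y. L * (norm k)\<^sup>2 * \<bar>h y\<bar> \<partial>lborel)"
    proof (rule Bochner_Integration.integral_norm_bound_integral)
      fix y
      have "\<phi> (x + k - y) * h y - \<phi> (x - y) * h y - (grad \<phi> (x - y) \<bullet> k) * h y =
         (\<phi> ((x - y) + k) - \<phi> (x - y) - grad \<phi> (x - y) \<bullet> k) * h y"
        by (simp add: algebra_simps)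
      then show "norm (\<phi> (x + k - y) * h y - \<phi> (x - y) * h y - (grad \<phi> (x - y) \<bullet> k) * h y)
          \<le> L * (norm k)\<^sup>2 * \<bar>h y\<bar>"
        using L(2)[of "x - y" k] by (simp add: abs_mult mult_right_mono)
    qed (use assms i igk in auto)
    also have "\<dots> = (L * H * norm k) * norm k"
      by (simp add: H_def power2_eq_square)
    finally show ?thesis .
  qed
  have "bounded_linear D"
    unfolding D_def by (intro bounded_linear_sum bounded_linear_mult_left[THEN bounded_linear_compose] bounded_linear_inner_left)
  moreover have "(\<lambda>k. norm (conv \<phi> h (x + k) - conv \<phi> h x - D k) / norm k) \<midarrow>0\<rightarrow> 0"
  proof (rule Lim_null_comparison)
    show "\<forall>\<^sub>F k in at 0. norm (norm (conv \<phi> h (x + k) - conv \<phi> h x - D k) / norm k) \<le> L * H * norm k"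
      using bd by (auto simp: eventually_at_filter divide_le_eq)
    show "(\<lambda>k. L * H * norm k) \<midarrow>0\<rightarrow> 0" by (auto intro!: tendsto_eq_intros)
  qed
  ultimately show ?thesis unfolding D_def[symmetric] by (simp add: has_derivative_at)
qed

lemma partials_conv:
  assumes "\<phi> \<in> test_functions S" "integrable lborel h" "b \<in> Basis"
  shows "partials [b] (conv \<phi> h) = conv (partials [b] \<phi>) h"
proof -
  have "(\<Sum>c\<in>Basis. (b \<bullet> c) * g c) = g b" for g :: "'a \<Rightarrow> real"
  proof -
    have "(\<Sum>c\<in>Basis. (b \<bullet> c) * g c) = (\<Sum>c\<in>Basis. if c = b then g c else 0)"
      using assms(3) by (intro sum.cong) (auto simp: inner_Basis)
    then show ?thesis using assms(3) by simp
  qed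
  then show ?thesis using partials_eqI[OF has_derivative_conv[OF assms(1,2)], of b] by simp
qed

text \<open>Every derivative falls on the test function, so the induction on the order runs over all
  \<phi> while \<open>h\<close> stays fixed.\<close>

lemma C_infinity_conv:
  assumes "\<phi> \<in> test_functions S" "integrable lborel h"
  shows "C_infinity (conv \<phi> h)"
proof -
  have "C_k k (conv \<phi> h)" for k using assms
  proof (induction k arbitrary: \<phi>)
    case 0
    then show ?case unfolding C_k_0
      by (intro continuous_at_imp_continuous_on ballI has_derivative_continuous[OF has_derivative_conv])
  next
    case (Suc k)
    show ?case unfolding C_k_Suc
    proof
      show "conv \<phi> h differentiable_on UNIV"
        unfolding differentiable_on_def differentiable_def
        using has_derivative_conv[OF Suc.prems] by auto
      show "\<forall>b\<in>Basis. C_k k (partials [b] (conv \<phi> h))"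
        using partials_conv[OF Suc.prems] Suc.IH[OF test_functions_partial[OF Suc.prems(1)] Suc.prems(2)] by simp
    qed
  qed
  then show ?thesis by (simp add: C_infinity_def)
qed

section \<open>Translation and reflection invariance of the integral\<close>

lemma nn_integral_translate:
  fixes F :: "'a::euclidean_space \<Rightarrow> ennreal"
  assumes "F \<in> borel_measurable borel"
  shows "(\<integral>\<^sup>+x. F (x + c) \<partial>lborel) = (\<integral>\<^sup>+x. F x \<partial>lborel)"
  by (subst (2) lborel_distr_plus[symmetric, of c]) (use assms in \<open>simp add: nn_integral_distr add.commute\<close>)

lemma nn_integral_reflect:
  fixes F :: "'a::euclidean_space \<Rightarrow> ennreal"
  assumes [measurable]: "F \<in> borel_measurable borel"
  shows "(\<integral>\<^sup>+x. F (c - x) \<partial>lborel) = (\<integral>\<^sup>+x. F x \<partial>lborel)"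
proof -
  have "lborel = distr lborel borel ((-) c)" using lborel_affine[of "-1" c] by (simp add: density_1)
  then have "(\<integral>\<^sup>+x. F x \<partial>lborel) = (\<integral>\<^sup>+x. F x \<partial>distr lborel borel ((-) c))" by simp
  also have "\<dots> = (\<integral>\<^sup>+x. F (c - x) \<partial>lborel)" by (simp add: nn_integral_distr)
  finally show ?thesis by simp
qed

section \<open>Density and translation continuity in the square-integrable functions\<close>

lemma two_ennreal: "0 \<le> a \<Longrightarrow> 2 * ennreal a = ennreal (2 * a)"
  by (simp add: ennreal_mult)

text \<open>From (a + b)^2 \<le> 2 a^2 + 2 b^2. A triangle inequality for squared norms, which may
  be infinite here, without any square roots.\<close>

lemma nn_sq_triangle:
  fixes f g k :: "'a \<Rightarrow> real"
  assumes [measurable]: "f \<in> borel_measurable M" "g \<in> borel_measurable M" "k \<in> borel_measurable M"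
  shows "(\<integral>\<^sup>+x. ennreal ((f x - g x)\<^sup>2) \<partial>M) \<le>
    2 * (\<integral>\<^sup>+x. ennreal ((f x - k x)\<^sup>2) \<partial>M) + 2 * (\<integral>\<^sup>+x. ennreal ((k x - g x)\<^sup>2) \<partial>M)"
proof -
  have "(f x - g x)\<^sup>2 \<le> 2 * (f x - k x)\<^sup>2 + 2 * (k x - g x)\<^sup>2" for x
    using zero_le_power2[of "(f x - k x) - (k x - g x)"] by (simp add: power2_eq_square algebra_simps)
  then have "ennreal ((f x - g x)\<^sup>2) \<le> 2 * ennreal ((f x - k x)\<^sup>2) + 2 * ennreal ((k x - g x)\<^sup>2)" for x
    by (simp add: two_ennreal ennreal_plus[symmetric] ennreal_leI del: ennreal_plus)
  then have "(\<integral>\<^sup>+x. ennreal ((f x - g x)\<^sup>2) \<partial>M) \<le>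
      (\<integral>\<^sup>+x. 2 * ennreal ((f x - k x)\<^sup>2) + 2 * ennreal ((k x - g x)\<^sup>2) \<partial>M)"
    by (rule nn_integral_mono)
  also have "\<dots> = 2 * (\<integral>\<^sup>+x. ennreal ((f x - k x)\<^sup>2) \<partial>M) + 2 * (\<integral>\<^sup>+x. ennreal ((k x - g x)\<^sup>2) \<partial>M)"
    by (simp add: nn_integral_add nn_integral_cmult)
  finally show ?thesis .
qed

lemma clamp_tendsto:
  fixes f :: "nat \<Rightarrow> real"
  assumes "f \<longlonglongrightarrow> l" "\<bar>l\<bar> \<le> B"
  shows "(\<lambda>n. max (- B) (min B (f n))) \<longlonglongrightarrow> l"
proof -
  have "(\<lambda>n. max (- B) (min B (f n))) \<longlonglongrightarrow> max (- B) (min B l)"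
    by (intro tendsto_intros assms)
  moreover have "max (- B) (min B l) = l" using assms(2) by (auto simp: max_def min_def)
  ultimately show ?thesis by simp
qed

lemma nn_integral_sq_tendsto_0:
  fixes f :: "nat \<Rightarrow> 'a \<Rightarrow> real"
  assumes [measurable]: "\<And>n. f n \<in> borel_measurable M" "w \<in> borel_measurable M"
    and "\<And>n. AE x in M. \<bar>f n x\<bar> \<le> w x" "AE x in M. (\<lambda>n. f n x) \<longlonglongrightarrow> 0"
    and "(\<integral>\<^sup>+x. ennreal ((w x)\<^sup>2) \<partial>M) < \<infinity>"
  shows "(\<lambda>n. \<integral>\<^sup>+x. ennreal ((f n x)\<^sup>2) \<partial>M) \<longlonglongrightarrow> 0"
proof -
  have "(\<lambda>n. \<integral>\<^sup>+x. ennreal ((f n x)\<^sup>2) \<partial>M) \<longlonglongrightarrow> (\<integral>\<^sup>+x. 0 \<partial>M)"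
  proof (rule nn_integral_dominated_convergence[where w="\<lambda>x. ennreal ((w x)\<^sup>2)"])
    show "AE x in M. ennreal ((f n x)\<^sup>2) \<le> ennreal ((w x)\<^sup>2)" for n
      using assms(3)[of n] by eventually_elim (auto intro!: ennreal_leI simp: abs_le_square_iff[symmetric])
    show "AE x in M. (\<lambda>n. ennreal ((f n x)\<^sup>2)) \<longlonglongrightarrow> 0"
      using assms(4)
    proof eventually_elim
      case (elim x)
      have "(\<lambda>n. ennreal ((f n x)\<^sup>2)) \<longlonglongrightarrow> ennreal (0\<^sup>2)"
        by (intro tendsto_intros elim)
      then show ?case by simp
    qed
  qed (use assms(5) in auto)
  then show ?thesis by simp
qed

text \<open>Lebesgue measurability already yields continuous functions that converge off a
  negligible set. Clamping them to the range of \<open>h\<close> and cutting them off between the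
  radii R and R + 1 gives a common square-integrable majorant and leaves the limit unchanged, since
  \<open>h\<close> vanishes where the cutoff differs from 1.\<close>

lemma continuous_L2_dense_bounded:
  fixes h :: "'a::euclidean_space \<Rightarrow> real" and e :: ennreal
  assumes [measurable]: "h \<in> borel_measurable borel"
    and B: "\<And>x. \<bar>h x\<bar> \<le> B" and R: "\<And>x. norm x > R \<Longrightarrow> h x = 0" and e: "e > 0"
  obtains g where "continuous_on UNIV g" "\<And>x. norm x > R + 1 \<Longrightarrow> g x = 0"
    "(\<integral>\<^sup>+x. ennreal ((h x - g x)\<^sup>2) \<partial>lborel) < e"
proof -
  have B0: "B \<ge> 0" using order_trans[OF abs_ge_zero B] .
  have "h \<in> borel_measurable lebesgue" using measurable_completion[of h lborel borel] by simp
  then have "h measurable_on UNIV" by (rule lebesgue_measurable_imp_measurable_on_real) auto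
  then obtain N k where N: "negligible N" and k: "\<And>n. continuous_on UNIV (k n)"
    and lim: "\<And>x. x \<notin> N \<Longrightarrow> (\<lambda>n. k n x) \<longlonglongrightarrow> h x"
    by (auto simp: measurable_on_def)
  define \<eta> :: "'a \<Rightarrow> real" where "\<eta> x = max 0 (min 1 (R + 1 - norm x))" for x
  define g where "g n x = max (- B) (min B (k n x)) * \<eta> x" for n x
  have cont: "continuous_on UNIV (g n)" for n
    unfolding g_def \<eta>_def by (intro continuous_intros k)
  have [measurable]: "g n \<in> borel_measurable borel" for n
    using cont borel_measurable_continuous_onI by blast
  have g0: "g n x = 0" if "norm x > R + 1" for n x
    using that by (simp add: g_def \<eta>_def)
  have gB: "\<bar>g n x\<bar> \<le> B" for n x
  proof -
    have "\<bar>max (- B) (min B (k n x))\<bar> \<le> B" "\<bar>\<eta> x\<bar> \<le> 1" using B0 by (auto simp: \<eta>_def)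
    then have "\<bar>max (- B) (min B (k n x))\<bar> * \<bar>\<eta> x\<bar> \<le> B * 1" using B0 by (intro mult_mono) auto
    then show ?thesis by (simp add: g_def abs_mult)
  qed
  have "(\<lambda>n. \<integral>\<^sup>+x. ennreal ((h x - g n x)\<^sup>2) \<partial>lborel) \<longlonglongrightarrow> 0"
  proof (rule nn_integral_sq_tendsto_0[where w="\<lambda>x. 2 * B * indicator (cball 0 (R + 1)) x"])
    show "AE x in lborel. \<bar>h x - g n x\<bar> \<le> 2 * B * indicator (cball 0 (R + 1)) x" for n
    proof (rule AE_I2)
      fix x
      show "\<bar>h x - g n x\<bar> \<le> 2 * B * indicator (cball 0 (R + 1)) x"
        using abs_triangle_ineq4[of "h x" "g n x"] B[of x] gB[of n x] g0[of x n] R[of x]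
        by (cases "norm x > R + 1") auto
    qed
    have "AE x in lebesgue. x \<notin> N" using N by (simp add: negligible_iff_null_sets AE_not_in)
    then have "AE x in lborel. x \<notin> N" by (simp add: AE_completion_iff)
    then show "AE x in lborel. (\<lambda>n. h x - g n x) \<longlonglongrightarrow> 0"
    proof eventually_elim
      case (elim x)
      have "(\<lambda>n. h x - g n x) \<longlonglongrightarrow> h x - h x * \<eta> x"
        unfolding g_def by (intro tendsto_intros clamp_tendsto lim elim B)
      moreover have "h x - h x * \<eta> x = 0" using R[of x] by (auto simp: \<eta>_def)
      ultimately show ?case by simp
    qed
    have "(\<integral>\<^sup>+x. ennreal ((2 * B * indicator (cball (0::'a) (R + 1)) x)\<^sup>2) \<partial>lborel) =
        (\<integral>\<^sup>+x. ennreal ((2 * B)\<^sup>2) * indicator (cball (0::'a) (R + 1)) x \<partial>lborel)"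
      by (intro nn_integral_cong) (auto simp: indicator_def)
    also have "\<dots> < \<infinity>"
      by (subst nn_integral_cmult_indicator) (auto simp: ennreal_mult_less_top emeasure_bounded_finite[OF bounded_cball, simplified])
    finally show "(\<integral>\<^sup>+x. ennreal ((2 * B * indicator (cball (0::'a) (R + 1)) x)\<^sup>2) \<partial>lborel) < \<infinity>" .
    show "(\<lambda>x. 2 * B * indicator (cball 0 (R + 1)) x) \<in> borel_measurable lborel"
      by (intro borel_measurable_times borel_measurable_const borel_measurable_indicator) auto
  qed auto
  from order_tendstoD(2)[OF this e] obtain n where "(\<integral>\<^sup>+x. ennreal ((h x - g n x)\<^sup>2) \<partial>lborel) < e"
    by (auto simp: eventually_sequentially)
  then show ?thesis using that cont g0 by blast
qed

text \<open>Truncation in value and in space reduces the claim to the bounded, compactly supported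
  case. Each of the two errors is at most e/4 and is doubled by the triangle inequality for
  squares.\<close>

lemma continuous_L2_dense:
  fixes h :: "'a::euclidean_space \<Rightarrow> real" and e :: real
  assumes [measurable]: "h \<in> borel_measurable borel"
    and h: "(\<integral>\<^sup>+x. ennreal ((h x)\<^sup>2) \<partial>lborel) < \<infinity>" and e: "e > 0"
  obtains g R where "continuous_on UNIV g" "R > 0" "\<And>x. norm x > R \<Longrightarrow> g x = 0"
    "(\<integral>\<^sup>+x. ennreal ((h x - g x)\<^sup>2) \<partial>lborel) \<le> ennreal e"
proof -
  define k where "k n x = (if \<bar>h x\<bar> \<le> real n \<and> norm x \<le> real n then h x else 0)" for n x
  have [measurable]: "k n \<in> borel_measurable borel" for n unfolding k_def by measurable
  have "(\<lambda>n. \<integral>\<^sup>+x. ennreal ((h x - k n x)\<^sup>2) \<partial>lborel) \<longlonglongrightarrow> 0"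
  proof (rule nn_integral_sq_tendsto_0[where w="\<lambda>x. \<bar>h x\<bar>"])
    show "AE x in lborel. (\<lambda>n. h x - k n x) \<longlonglongrightarrow> 0"
    proof (rule AE_I2)
      fix x
      obtain m where "max \<bar>h x\<bar> (norm x) \<le> real m" using real_arch_simple by blast
      then have "\<forall>n\<ge>m. h x - k n x = 0" by (auto simp: k_def)
      then show "(\<lambda>n. h x - k n x) \<longlonglongrightarrow> 0"
        by (intro tendsto_eventually) (auto simp: eventually_sequentially)
    qed
  qed (use h in \<open>auto simp: k_def\<close>)
  from order_tendstoD(2)[OF this, of "ennreal (e/4)"] e
  obtain n where n: "(\<integral>\<^sup>+x. ennreal ((h x - k n x)\<^sup>2) \<partial>lborel) < ennreal (e / 4)"
    by (auto simp: eventually_sequentially)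
  obtain g where g: "continuous_on UNIV g" "\<And>x. norm x > real n + 1 \<Longrightarrow> g x = 0"
    "(\<integral>\<^sup>+x. ennreal ((k n x - g x)\<^sup>2) \<partial>lborel) < ennreal (e / 4)"
    by (rule continuous_L2_dense_bounded[of "k n" "real n" "real n" "ennreal (e/4)"]) (use e in \<open>auto simp: k_def\<close>)
  have [measurable]: "g \<in> borel_measurable borel" using g(1) borel_measurable_continuous_onI by blast
  have "(\<integral>\<^sup>+x. ennreal ((h x - g x)\<^sup>2) \<partial>lborel) \<le>
      2 * (\<integral>\<^sup>+x. ennreal ((h x - k n x)\<^sup>2) \<partial>lborel) + 2 * (\<integral>\<^sup>+x. ennreal ((k n x - g x)\<^sup>2) \<partial>lborel)"
    by (rule nn_sq_triangle) auto
  also have "\<dots> \<le> 2 * ennreal (e/4) + 2 * ennreal (e/4)"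
    using n g(3) by (intro add_mono mult_left_mono) auto
  also have "\<dots> = ennreal (2 * (e/4) + 2 * (e/4))"
    using e by (simp add: two_ennreal ennreal_plus[symmetric] del: ennreal_plus)
  finally show ?thesis using that[of g "real n + 1"] g(1,2) by simp
qed

lemma continuous_compact_support_translate:
  fixes g :: "'a::euclidean_space \<Rightarrow> real"
  assumes g: "continuous_on UNIV g" "\<And>x. norm x > R \<Longrightarrow> g x = 0" and e: "e > 0"
  obtains d where "d > 0" "\<And>y. norm y < d \<Longrightarrow> (\<integral>\<^sup>+x. ennreal ((g (x - y) - g x)\<^sup>2) \<partial>lborel) \<le> ennreal e"
proof -
  \<comment> \<open>Shifts will be shorter than 1, so every difference is supported in the ball of
    radius R + 1, whose volume is \<open>V\<close>. The choice of \<eta> makes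
    \<open>\<eta>\<^sup>2 * V\<close> at most \<open>e\<close>; \<open>V + 1\<close> keeps the
    denominator positive.\<close>
  define V where "V = measure lborel (cball (0::'a) (R + 1))"
  define \<eta> where "\<eta> = sqrt (e / (V + 1))"
  have \<eta>: "\<eta> > 0" using e by (auto simp: \<eta>_def V_def add_nonneg_pos)
  have "uniformly_continuous_on (cball 0 (R + 2)) g"
    by (intro compact_uniformly_continuous continuous_on_subset[OF g(1)]) auto
  from uniformly_continuous_onE[OF this \<eta>] obtain d where d: "d > 0"
    and dd': "\<And>x x'. x \<in> cball 0 (R + 2) \<Longrightarrow> x' \<in> cball 0 (R + 2) \<Longrightarrow> dist x' x < d \<Longrightarrow> dist (g x') (g x) < \<eta>"
    by metis
  then have dd: "dist (g x') (g x) < \<eta>" if "norm x' \<le> R + 2" "norm x \<le> R + 2" "dist x' x < d" for x x'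
    using that by simp
  have "(\<integral>\<^sup>+x. ennreal ((g (x - y) - g x)\<^sup>2) \<partial>lborel) \<le> ennreal e" if y: "norm y < min d 1" for y
  proof -
    have "ennreal ((g (x - y) - g x)\<^sup>2) \<le> ennreal (\<eta>\<^sup>2) * indicator (cball 0 (R + 1)) x" for x
    proof (cases "norm x \<le> R + 1")
      case True
      then have "norm (x - y) \<le> R + 2" using norm_triangle_ineq4[of x y] y by auto
      then have "dist (g (x - y)) (g x) < \<eta>" using True y by (intro dd) (auto simp: dist_norm)
      then have "(g (x - y) - g x)\<^sup>2 \<le> \<eta>\<^sup>2"
        by (simp add: dist_real_def abs_le_square_iff[symmetric] less_imp_le)
      then show ?thesis using True by (auto intro: ennreal_leI)
    next
      case False
      then have "norm (x - y) > R" using norm_triangle_sub[of x y] y by auto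
      then show ?thesis using False g(2) by simp
    qed
    then have "(\<integral>\<^sup>+x. ennreal ((g (x - y) - g x)\<^sup>2) \<partial>lborel) \<le>
        (\<integral>\<^sup>+x. ennreal (\<eta>\<^sup>2) * indicator (cball (0::'a) (R + 1)) x \<partial>lborel)"
      by (rule nn_integral_mono)
    also have "\<dots> = ennreal (\<eta>\<^sup>2) * ennreal V"
      unfolding V_def by (subst nn_integral_cmult_indicator)
        (auto simp: emeasure_eq_ennreal_measure less_top emeasure_bounded_finite[OF bounded_cball, simplified])
    also have "\<dots> = ennreal (\<eta>\<^sup>2 * V)" by (simp add: ennreal_mult V_def)
    also have "\<dots> \<le> ennreal e"
    proof (rule ennreal_leI)
      have "V \<ge> 0" by (simp add: V_def)
      then have "\<eta>\<^sup>2 = e / (V + 1)" using e by (simp add: \<eta>_def)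
      moreover have "e / (V + 1) * V \<le> e" using \<open>V \<ge> 0\<close> e by (simp add: field_simps)
      ultimately show "\<eta>\<^sup>2 * V \<le> e" by simp
    qed
    finally show ?thesis .
  qed
  then show ?thesis using that[of "min d 1"] d by auto
qed

text \<open>The shifted error of the approximation by a continuous compactly supported function
  equals the unshifted one by translation invariance. With three errors of e/16, two of them doubled
  twice, the total is 10e/16.\<close>

lemma L2_translation_continuous:
  fixes h :: "'a::euclidean_space \<Rightarrow> real"
  assumes [measurable]: "h \<in> borel_measurable borel"
    and h: "(\<integral>\<^sup>+x. ennreal ((h x)\<^sup>2) \<partial>lborel) < \<infinity>" and e: "e > 0"
  obtains d where "d > 0" "\<And>y. norm y < d \<Longrightarrow> (\<integral>\<^sup>+x. ennreal ((h (x - y) - h x)\<^sup>2) \<partial>lborel) \<le> ennreal e"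
proof -
  obtain g R where g: "continuous_on UNIV g" "R > 0" "\<And>x. norm x > R \<Longrightarrow> g x = 0"
    and hg: "(\<integral>\<^sup>+x. ennreal ((h x - g x)\<^sup>2) \<partial>lborel) \<le> ennreal (e/16)"
    by (rule continuous_L2_dense[OF assms(1) h, of "e/16"]) (use e in auto)
  obtain d where d: "d > 0" "\<And>y. norm y < d \<Longrightarrow> (\<integral>\<^sup>+x. ennreal ((g (x - y) - g x)\<^sup>2) \<partial>lborel) \<le> ennreal (e/16)"
    by (rule continuous_compact_support_translate[OF g(1,3), where e="e/16"]) (use e in auto)
  have [measurable]: "g \<in> borel_measurable borel" using g(1) borel_measurable_continuous_onI by blast
  have "(\<integral>\<^sup>+x. ennreal ((h (x - y) - h x)\<^sup>2) \<partial>lborel) \<le> ennreal e" if y: "norm y < d" for y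
  proof -
    have t: "(\<integral>\<^sup>+x. ennreal ((h (x - y) - g (x - y))\<^sup>2) \<partial>lborel) \<le> ennreal (e/16)"
      using nn_integral_translate[of "\<lambda>x. ennreal ((h x - g x)\<^sup>2)" "- y"] hg by simp
    have "(\<integral>\<^sup>+x. ennreal ((h (x - y) - h x)\<^sup>2) \<partial>lborel) \<le>
      2 * (\<integral>\<^sup>+x. ennreal ((h (x - y) - g (x - y))\<^sup>2) \<partial>lborel) + 2 * (\<integral>\<^sup>+x. ennreal ((g (x - y) - h x)\<^sup>2) \<partial>lborel)"
      by (rule nn_sq_triangle) auto
    also have "\<dots> \<le> 2 * (\<integral>\<^sup>+x. ennreal ((h (x - y) - g (x - y))\<^sup>2) \<partial>lborel) + 2 * 
       (2 * (\<integral>\<^sup>+x. ennreal ((g (x - y) - g x)\<^sup>2) \<partial>lborel) + 2 * (\<integral>\<^sup>+x. ennreal ((g x - h x)\<^sup>2) \<partial>lborel))"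
      by (intro add_mono mult_left_mono order_refl nn_sq_triangle) auto
    also have "\<dots> \<le> 2 * ennreal (e/16) + 2 * (2 * ennreal (e/16) + 2 * ennreal (e/16))"
      using t d(2)[OF y] hg by (intro add_mono mult_left_mono) (auto simp: power2_commute[of "g x" "h x" for x])
    also have "\<dots> = ennreal (2 * (e/16) + 2 * (2 * (e/16) + 2 * (e/16)))"
      using e by (simp add: two_ennreal ennreal_plus[symmetric] del: ennreal_plus)
    also have "\<dots> \<le> ennreal e" using e by (intro ennreal_leI) simp
    finally show ?thesis .
  qed
  then show ?thesis using that d(1) by blast
qed

section \<open>Mollification\<close>

lemma bump_test: "r > 0 \<Longrightarrow> bump r \<in> test_functions UNIV"
proof (rule test_functionsI[where K="cball 0 r"])
  show "C_infinity (bump r)" using C_infinity_bump(1)[of r 0] by simp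
  show "bump r x = 0" if "r > 0" "x \<notin> cball 0 r" for x :: 'a
    using bump_nonzero_iff[of r x] that by auto
qed auto

lemma integrable_test_function:
  assumes "\<phi> \<in> test_functions S"
  shows "integrable lborel \<phi>"
proof -
  let ?K = "closure {x. \<phi> x \<noteq> 0}"
  obtain B where B: "\<And>x. \<bar>\<phi> x\<bar> \<le> B" using test_functions_bounded[OF assms] by blast
  have K: "compact ?K" using test_functionsD[OF assms] by simp
  have i: "integrable lborel (\<lambda>x. B * indicator ?K x)"
    using emeasure_bounded_finite[OF compact_imp_bounded[OF K]] by (intro integrable_mult_right integrable_real_indicator) auto
  show ?thesis
  proof (rule Bochner_Integration.integrable_bound[OF i])
    show "\<phi> \<in> borel_measurable lborel" using test_functions_measurable[OF assms] by simp
    show "AE x in lborel. norm (\<phi> x) \<le> norm (B * indicator ?K x)"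
    proof (rule AE_I2)
      fix x show "norm (\<phi> x) \<le> norm (B * indicator ?K x)"
        using order_trans[OF B abs_ge_self, of x] closure_subset[of "{x. \<phi> x \<noteq> 0}"]
        by (cases "\<phi> x = 0") (auto simp: indicator_def)
    qed
  qed
qed

definition moll :: "real \<Rightarrow> 'a::euclidean_space \<Rightarrow> real" where
  "moll r x = bump r x / (\<integral>y. bump r (y::'a) \<partial>lborel)"

text \<open>A vanishing integral would make the nonnegative profile zero almost everywhere, although
  it is positive on a ball of positive measure.\<close>

lemma bump_integral_pos:
  assumes "r > 0"
  shows "0 < (\<integral>y. bump r (y::'a::euclidean_space) \<partial>lborel)"
proof -
  have i: "integrable lborel (bump r :: 'a \<Rightarrow> real)" by (rule integrable_test_function[OF bump_test[OF assms]])
  have "(\<integral>y. bump r (y::'a) \<partial>lborel) \<noteq> 0"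
  proof
    assume "(\<integral>y. bump r (y::'a) \<partial>lborel) = 0"
    then have "AE y in lborel. bump r (y::'a) = 0"
      using integral_nonneg_eq_0_iff_AE[OF i] bump_nonneg by auto
    then have "AE y in lborel. y \<notin> ball (0::'a) r"
      by (rule AE_mp) (use bump_nonzero_iff[OF assms, where 'a='a] in auto)
    then have "emeasure lborel (ball (0::'a) r) = 0"
      by (subst (asm) AE_iff_measurable[where N="ball 0 r"]) auto
    then show False using content_ball_pos[OF assms, of "0::'a"] by (simp add: measure_def)
  qed
  moreover have "0 \<le> (\<integral>y. bump r (y::'a) \<partial>lborel)" by (intro integral_nonneg_AE) (auto simp: bump_nonneg)
  ultimately show ?thesis by simp
qed

lemma moll_test: "r > 0 \<Longrightarrow> moll r \<in> test_functions UNIV"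
  using test_functions_mult[OF bump_test C_infinity_const, of r "1 / (\<integral>y. bump r (y::'a) \<partial>lborel)"]
  by (simp add: moll_def[abs_def])

lemma moll_nonneg: "0 \<le> moll r x"
  unfolding moll_def by (intro divide_nonneg_nonneg integral_nonneg_AE) (auto simp: bump_nonneg)

lemma moll_eq_0: "r > 0 \<Longrightarrow> norm x \<ge> r \<Longrightarrow> moll r x = 0"
  using bump_nonzero_iff[of r x] by (auto simp: moll_def)

lemma C_infinity_moll: "C_infinity (\<lambda>y. moll r (x - y))"
  using C_infinity_mult[OF C_infinity_bump(2) C_infinity_const, of r x "1 / (\<integral>y. bump r (y::'a) \<partial>lborel)"]
  by (simp add: moll_def[abs_def])

lemma integral_moll: "r > 0 \<Longrightarrow> (\<integral>x. moll r x \<partial>lborel) = 1"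
  using bump_integral_pos[of r, where 'a='a] by (simp add: moll_def[abs_def])

lemma nn_integral_moll: "r > 0 \<Longrightarrow> (\<integral>\<^sup>+x. ennreal (moll r x) \<partial>lborel) = 1"
  by (subst nn_integral_eq_integral) (auto simp: integral_moll moll_nonneg integrable_test_function[OF moll_test])

lemma nn_integral_moll_shift: "r > 0 \<Longrightarrow> (\<integral>\<^sup>+y. ennreal (moll r (x - y)) \<partial>lborel) = 1"
  using nn_integral_reflect[of "\<lambda>z. ennreal (moll r z)" x] nn_integral_moll[of r, where 'a='a]
    measurable_compose[OF test_functions_measurable[OF moll_test[of r]] measurable_ennreal] by simp

lemma has_integral_moll_shift:
  assumes "r > 0"
  shows "integrable lborel (\<lambda>y. moll r (x - y))" "(\<integral>y. moll r (x - y) \<partial>lborel) = 1"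
proof -
  have [measurable]: "moll r \<in> borel_measurable borel" by (rule test_functions_measurable[OF moll_test[OF assms]])
  have "has_bochner_integral lborel (\<lambda>y. moll r (x - y)) 1"
    by (rule has_bochner_integral_nn_integral) (auto simp: moll_nonneg nn_integral_moll_shift[OF assms])
  then show "integrable lborel (\<lambda>y. moll r (x - y))" "(\<integral>y. moll r (x - y) \<partial>lborel) = 1"
    by (auto simp: has_bochner_integral_iff)
qed

text \<open>Jensen's inequality for the probability density \<open>moll r\<close>, obtained from
  Cauchy-Schwarz by splitting the kernel into two square roots, one of which has total square mass
  1. Tonelli then exposes an average of squared translation errors.\<close>

lemma conv_moll_L2_le:
  fixes h :: "'a::euclidean_space \<Rightarrow> real"
  assumes r: "r > 0" and h: "integrable lborel h"
  shows "(\<integral>\<^sup>+x. ennreal ((conv (moll r) h x - h x)\<^sup>2) \<partial>lborel) \<le>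
    (\<integral>\<^sup>+z. ennreal (moll r z) * (\<integral>\<^sup>+x. ennreal ((h (x - z) - h x)\<^sup>2) \<partial>lborel) \<partial>lborel)"
proof -
  have [measurable]: "h \<in> borel_measurable borel" "moll r \<in> borel_measurable borel"
    using h test_functions_measurable[OF moll_test[OF r]] by auto
  have pw: "ennreal ((conv (moll r) h x - h x)\<^sup>2) \<le>
      (\<integral>\<^sup>+z. ennreal (moll r z) * ennreal ((h (x - z) - h x)\<^sup>2) \<partial>lborel)" for x
  proof -
    let ?s = "\<lambda>y. ennreal (sqrt (moll r (x - y)))"
    have i: "integrable lborel (\<lambda>y. moll r (x - y) * h y)"
      "integrable lborel (\<lambda>y. moll r (x - y) * h x)"
      using integrable_conv[OF moll_test[OF r] h] has_integral_moll_shift[OF r] by auto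
    have "conv (moll r) h x - h x = (\<integral>y. moll r (x - y) * h y - moll r (x - y) * h x \<partial>lborel)"
      using i has_integral_moll_shift[OF r, of x] by (simp add: conv_def)
    also have "ennreal (norm \<dots>) \<le> (\<integral>\<^sup>+y. norm (moll r (x - y) * h y - moll r (x - y) * h x) \<partial>lborel)"
      by (rule integral_norm_bound_ennreal) (use i in auto)
    also have "\<dots> = (\<integral>\<^sup>+y. ?s y * (?s y * ennreal \<bar>h y - h x\<bar>) \<partial>lborel)"
    proof (rule nn_integral_cong)
      fix y
      have "norm (moll r (x - y) * h y - moll r (x - y) * h x) = 
          sqrt (moll r (x - y)) * (sqrt (moll r (x - y)) * \<bar>h y - h x\<bar>)"
        using moll_nonneg[of r "x - y"] by (simp add: right_diff_distrib[symmetric] abs_mult mult.assoc[symmetric])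
      then show "ennreal (norm (moll r (x - y) * h y - moll r (x - y) * h x)) = ?s y * (?s y * ennreal \<bar>h y - h x\<bar>)"
        by (simp add: ennreal_mult moll_nonneg)
    qed
    finally have "ennreal \<bar>conv (moll r) h x - h x\<bar> ^ 2 \<le> (\<integral>\<^sup>+y. ?s y * (?s y * ennreal \<bar>h y - h x\<bar>) \<partial>lborel) ^ 2"
      by (intro power_mono) auto
    also have "\<dots> \<le> (\<integral>\<^sup>+y. ?s y ^ 2 \<partial>lborel) * (\<integral>\<^sup>+y. (?s y * ennreal \<bar>h y - h x\<bar>) ^ 2 \<partial>lborel)"
      by (rule Cauchy_Schwarz_nn_integral) auto
    also have "(\<lambda>y. ?s y ^ 2) = (\<lambda>y. ennreal (moll r (x - y)))"
      by (simp add: ennreal_power moll_nonneg)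
    also have "(\<lambda>y. (?s y * ennreal \<bar>h y - h x\<bar>) ^ 2) = (\<lambda>y. ennreal (moll r (x - y)) * ennreal ((h y - h x)\<^sup>2))"
      by (simp add: power_mult_distrib ennreal_power moll_nonneg)
    also have "(\<integral>\<^sup>+y. ennreal (moll r (x - y)) \<partial>lborel) = 1" by (rule nn_integral_moll_shift[OF r])
    also have "(\<integral>\<^sup>+y. ennreal (moll r (x - y)) * ennreal ((h y - h x)\<^sup>2) \<partial>lborel) =
        (\<integral>\<^sup>+z. ennreal (moll r z) * ennreal ((h (x - z) - h x)\<^sup>2) \<partial>lborel)"
      using nn_integral_reflect[of "\<lambda>y. ennreal (moll r (x - y)) * ennreal ((h y - h x)\<^sup>2)" x] by simp
    finally show ?thesis by (simp add: ennreal_power)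
  qed
  have "(\<integral>\<^sup>+x. ennreal ((conv (moll r) h x - h x)\<^sup>2) \<partial>lborel) \<le>
      (\<integral>\<^sup>+x. (\<integral>\<^sup>+z. ennreal (moll r z) * ennreal ((h (x - z) - h x)\<^sup>2) \<partial>lborel) \<partial>lborel)"
    by (rule nn_integral_mono) (rule pw)
  also have "\<dots> = (\<integral>\<^sup>+z. (\<integral>\<^sup>+x. ennreal (moll r z) * ennreal ((h (x - z) - h x)\<^sup>2) \<partial>lborel) \<partial>lborel)"
    by (rule lborel_pair.Fubini') measurable
  also have "\<dots> = (\<integral>\<^sup>+z. ennreal (moll r z) * (\<integral>\<^sup>+x. ennreal ((h (x - z) - h x)\<^sup>2) \<partial>lborel) \<partial>lborel)"
    by (intro nn_integral_cong nn_integral_cmult) auto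
  finally show ?thesis .
qed

lemma tendsto_0_ennreal_le:
  assumes "\<And>e. (0::real) < e \<Longrightarrow> \<forall>\<^sub>F n in F. f n \<le> ennreal e"
  shows "(f \<longlongrightarrow> 0) F"
proof (rule tendsto_zero_ennreal)
  fix e :: real assume e: "0 < e"
  then have "ennreal (e / 2) < ennreal e" by (simp add: ennreal_less_iff)
  then show "\<forall>\<^sub>F n in F. f n < ennreal e"
    using assms[of "e/2"] e by (auto elim!: eventually_mono intro: le_less_trans)
qed

text \<open>The kernel vanishes at distance \<open>r n\<close> and beyond, so once
  \<open>r n\<close> is below \<open>d\<close> only translations shorter than \<open>d\<close> enter
  the average, and these are all uniformly small.\<close>

lemma conv_moll_tendsto_L2:
  fixes h :: "'a::euclidean_space \<Rightarrow> real"
  assumes h: "integrable lborel h" and h2: "(\<integral>\<^sup>+x. ennreal ((h x)\<^sup>2) \<partial>lborel) < \<infinity>"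
    and r: "\<And>n. r n > 0" "r \<longlonglongrightarrow> 0"
  shows "(\<lambda>n. \<integral>\<^sup>+x. ennreal ((conv (moll (r n)) h x - h x)\<^sup>2) \<partial>lborel) \<longlonglongrightarrow> 0"
proof (rule tendsto_0_ennreal_le)
  fix e :: real assume e: "e > 0"
  have hm: "h \<in> borel_measurable borel" using h by auto
  obtain d where d: "d > 0" "\<And>y. norm y < d \<Longrightarrow> (\<integral>\<^sup>+x. ennreal ((h (x - y) - h x)\<^sup>2) \<partial>lborel) \<le> ennreal e"
    using L2_translation_continuous[OF hm h2 e] by blast
  have "\<forall>\<^sub>F n in sequentially. r n < d" using order_tendstoD(2)[OF r(2) d(1)] .
  then show "\<forall>\<^sub>F n in sequentially. (\<integral>\<^sup>+x. ennreal ((conv (moll (r n)) h x - h x)\<^sup>2) \<partial>lborel) \<le> ennreal e"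
  proof eventually_elim
    case (elim n)
    have m: "moll (r n) \<in> borel_measurable (borel :: 'a measure)" by (rule test_functions_measurable[OF moll_test[OF r(1)]])
    have "(\<integral>\<^sup>+x. ennreal ((conv (moll (r n)) h x - h x)\<^sup>2) \<partial>lborel) \<le>
      (\<integral>\<^sup>+z. ennreal (moll (r n) z) * (\<integral>\<^sup>+x. ennreal ((h (x - z) - h x)\<^sup>2) \<partial>lborel) \<partial>lborel)"
      by (rule conv_moll_L2_le[OF r(1) h])
    also have "\<dots> \<le> (\<integral>\<^sup>+z. ennreal (moll (r n) (z::'a)) * ennreal e \<partial>lborel)"
    proof (rule nn_integral_mono)
      fix z :: 'a
      show "ennreal (moll (r n) z) * (\<integral>\<^sup>+x. ennreal ((h (x - z) - h x)\<^sup>2) \<partial>lborel) \<le> ennreal (moll (r n) z) * ennreal e"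
      proof (cases "norm z < d")
        case True
        then show ?thesis using d(2) by (intro mult_left_mono) auto
      next
        case False
        then have "moll (r n) z = 0" using elim by (intro moll_eq_0 r) auto
        then show ?thesis by simp
      qed
    qed
    also have "\<dots> = ennreal e"
      using m nn_integral_moll[OF r(1)[of n], where 'a='a] by (simp add: nn_integral_multc)
    finally show ?case .
  qed
qed

section \<open>The fundamental lemma of the calculus of variations\<close>

lemma open_sets_lebesgue: "open S \<Longrightarrow> S \<inter> space lebesgue \<in> sets lebesgue"
  by auto

lemma borel_measurable_lebesgue_onI:
  "f \<in> borel_measurable borel \<Longrightarrow> f \<in> borel_measurable (lebesgue_on S)"
  by (simp add: measurable_completion measurable_restrict_space1)

text \<open>Elements of the function spaces are only Lebesgue measurable and arbitrary outside
  \<open>S\<close>. Convolution over the whole space and Tonelli's theorem are applied to this Borel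
  version extended by zero.\<close>

lemma borel_representative:
  fixes u :: "'a::euclidean_space \<Rightarrow> real"
  assumes S: "open S" and u: "u \<in> borel_measurable (lebesgue_on S)"
  obtains h where "h \<in> borel_measurable borel" "\<And>x. x \<notin> S \<Longrightarrow> h x = 0" "AE x in lebesgue_on S. h x = u x"
proof -
  have "(\<lambda>x. indicator S x *\<^sub>R u x) \<in> borel_measurable lebesgue"
    using u borel_measurable_restrict_space_iff[OF open_sets_lebesgue[OF S], of u] by simp
  then obtain g where g: "g \<in> borel_measurable lborel" "AE x in lborel. indicator S x *\<^sub>R u x = g x"
    using completion_ex_borel_measurable_real by blast
  have [measurable]: "g \<in> borel_measurable borel" "S \<in> sets borel" using g(1) S by auto
  show ?thesis
  proof (rule that[of "\<lambda>x. indicator S x * g x"])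
    have "AE x in lebesgue. indicator S x *\<^sub>R u x = g x" using g(2) by (simp add: AE_completion_iff)
    then show "AE x in lebesgue_on S. indicator S x * g x = u x"
      unfolding AE_restrict_space_iff[OF open_sets_lebesgue[OF S]] by eventually_elim auto
  qed auto
qed

lemma nn_integral_lebesgue_on:
  assumes "open S" "\<And>x. x \<notin> S \<Longrightarrow> f x = 0"
  shows "(\<integral>\<^sup>+x. f x \<partial>lebesgue_on S) = (\<integral>\<^sup>+x. f x \<partial>lborel)"
proof -
  have "(\<integral>\<^sup>+x. f x \<partial>lebesgue_on S) = (\<integral>\<^sup>+x. f x * indicator S x \<partial>lebesgue)"
    by (rule nn_integral_restrict_space[OF open_sets_lebesgue[OF assms(1)]])
  also have "\<dots> = (\<integral>\<^sup>+x. f x \<partial>lebesgue)"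
    by (intro nn_integral_cong) (use assms(2) in \<open>auto simp: indicator_def\<close>)
  finally show ?thesis by (simp add: nn_integral_completion)
qed

lemma nn_integral_lebesgue_on_le:
  assumes "open S"
  shows "(\<integral>\<^sup>+x. f x \<partial>lebesgue_on S) \<le> (\<integral>\<^sup>+x. f x \<partial>lborel)"
  unfolding nn_integral_restrict_space[OF open_sets_lebesgue[OF assms]] nn_integral_completion
  by (rule nn_integral_mono) (auto simp: indicator_def)

lemma integral_lebesgue_on:
  fixes f :: "'a::euclidean_space \<Rightarrow> real"
  assumes "open S" "\<And>x. x \<notin> S \<Longrightarrow> f x = 0" "f \<in> borel_measurable borel"
  shows "(\<integral>x. f x \<partial>lebesgue_on S) = (\<integral>x. f x \<partial>lborel)"
    "integrable (lebesgue_on S) f \<longleftrightarrow> integrable lborel f"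
proof -
  have eq: "(\<lambda>x. indicator S x *\<^sub>R f x) = f"
    using assms(2) by (auto simp: fun_eq_iff indicator_def)
  show "(\<integral>x. f x \<partial>lebesgue_on S) = (\<integral>x. f x \<partial>lborel)"
    using assms(3) unfolding integral_restrict_space[OF open_sets_lebesgue[OF assms(1)]] eq
    by (simp add: integral_completion)
  show "integrable (lebesgue_on S) f \<longleftrightarrow> integrable lborel f"
    using assms(3) unfolding integrable_restrict_space[OF open_sets_lebesgue[OF assms(1)]] eq
    by (simp add: integrable_completion)
qed

lemma open_sigma_compact:
  fixes S :: "'a::euclidean_space set"
  assumes "open S"
  shows "\<exists>C :: nat \<Rightarrow> 'a set. (\<forall>n. compact (C n) \<and> C n \<subseteq> S) \<and> \<Union>(range C) = S"
proof (rule open_Union_compact_subsets[OF assms])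
  fix C :: "nat \<Rightarrow> 'a set"
  assume "\<And>n. compact (C n)" "\<And>n. C n \<subseteq> S" "\<Union>(range C) = S"
  then show ?thesis by (intro exI[of _ C] conjI allI)
qed

text \<open>Local integrability gives measurability on each compact subset; a countable exhaustion
  by compact sets glues the pieces together.\<close>

lemma locally_integrable_measurable:
  fixes u :: "'a::euclidean_space \<Rightarrow> 'b::euclidean_space"
  assumes S: "open S" and u: "locally_integrable S u"
  shows "u \<in> borel_measurable (lebesgue_on S)"
proof -
  obtain C :: "nat \<Rightarrow> 'a set" where C': "\<forall>n. compact (C n) \<and> C n \<subseteq> S" and CS: "\<Union>(range C) = S"
    using open_sigma_compact[OF S] by (elim exE conjE) (rule that)
  have C: "compact (C n)" "C n \<subseteq> S" for n using C' by auto
  show ?thesis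
  proof (rule measurable_piecewise_restrict[of "range C"])
    fix c assume "c \<in> range C"
    then obtain n where n: "c = C n" by auto
    have Cm: "C n \<in> sets lebesgue" using lmeasurable_compact[OF C(1)] by (rule fmeasurableD)
    have Sm: "S \<in> sets lebesgue" using open_sets_lebesgue[OF S] by simp
    have "restrict_space (lebesgue_on S) (C n) = lebesgue_on (S \<inter> C n)"
      by (rule restrict_restrict_space) (use Cm Sm in simp_all)
    also have "S \<inter> C n = C n" using C(2)[of n] by blast
    finally show "u \<in> borel_measurable (restrict_space (lebesgue_on S) c)"
      using u C(1,2)[of n] unfolding locally_integrable_def n by (simp add: borel_measurable_integrable)
    have "C n \<in> sets (lebesgue_on S)"
      using C(2)[of n] Cm Sm by (subst sets_restrict_space_iff) simp_all
    then show "c \<inter> space (lebesgue_on S) \<in> sets (lebesgue_on S)"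
      using C(2)[of n] unfolding n by (simp add: inf_absorb1)
  next
    show "space (lebesgue_on S) \<subseteq> \<Union> (range C)" using CS by simp
  qed simp
qed

lemma integrable_locally_integrable_test:
  fixes u :: "'a::euclidean_space \<Rightarrow> real"
  assumes S: "open S" and u: "locally_integrable S u" and \<phi>: "\<phi> \<in> test_functions S"
  shows "integrable (lebesgue_on S) (\<lambda>x. u x * \<phi> x)"
proof -
  let ?K = "closure {x. \<phi> x \<noteq> 0}"
  have K: "compact ?K" "?K \<subseteq> S" using test_functionsD[OF \<phi>] by auto
  have Km: "?K \<inter> space lebesgue \<in> sets lebesgue" using lmeasurable_compact[OF K(1)] by auto
  obtain B where B: "\<And>x. \<bar>\<phi> x\<bar> \<le> B" using test_functions_bounded[OF \<phi>] by blast
  have i: "integrable (lebesgue_on ?K) u" using u K unfolding locally_integrable_def by blast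
  have "integrable (lebesgue_on ?K) (\<lambda>x. u x * \<phi> x)"
  proof (rule Bochner_Integration.integrable_bound[of _ "\<lambda>x. B * u x"])
    show "AE x in lebesgue_on ?K. norm (u x * \<phi> x) \<le> norm (B * u x)"
      using order_trans[OF B abs_ge_self] by (auto simp: abs_mult mult.commute intro!: mult_right_mono)
    show "(\<lambda>x. u x * \<phi> x) \<in> borel_measurable (lebesgue_on ?K)"
      using i borel_measurable_lebesgue_onI[OF test_functions_measurable[OF \<phi>]] by (intro borel_measurable_times) auto
  qed (use i in auto)
  then have "integrable lebesgue (\<lambda>x. indicator ?K x *\<^sub>R (u x * \<phi> x))"
    unfolding integrable_restrict_space[OF Km] .
  moreover have "(\<lambda>x. indicator ?K x *\<^sub>R (u x * \<phi> x)) = (\<lambda>x. indicator S x *\<^sub>R (u x * \<phi> x))"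
    using K(2) closure_subset[of "{x. \<phi> x \<noteq> 0}"] by (auto simp: fun_eq_iff indicator_def)
  ultimately show ?thesis
    unfolding integrable_restrict_space[OF open_sets_lebesgue[OF S]] by simp
qed

lemma L2_tendsto_AE_subseq:
  fixes f :: "nat \<Rightarrow> 'a \<Rightarrow> real"
  assumes [measurable]: "\<And>n. f n \<in> borel_measurable M"
    and lim: "(\<lambda>n. \<integral>\<^sup>+x. ennreal ((f n x)\<^sup>2) \<partial>M) \<longlonglongrightarrow> 0"
  obtains s :: "nat \<Rightarrow> nat" where "strict_mono s" "AE x in M. (\<lambda>n. f (s n) x) \<longlonglongrightarrow> 0"
proof -
  \<comment> \<open>Early members of the sequence may have infinite integral. Dropping the first
    \<open>N\<close> makes all the squares integrable, so that almost everywhere convergence of a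
    subsequence follows from convergence in L^1.\<close>
  obtain N where N: "\<And>n. n \<ge> N \<Longrightarrow> (\<integral>\<^sup>+x. ennreal ((f n x)\<^sup>2) \<partial>M) < 1"
    using order_tendstoD(2)[OF lim, of 1] by (auto simp: eventually_sequentially)
  define g where "g n x = (f (n + N) x)\<^sup>2" for n x
  have nn: "(\<integral>\<^sup>+x. ennreal (g n x) \<partial>M) < 1" for n using N[of "n + N"] by (simp add: g_def)
  have i: "integrable M (g n)" for n
    by (rule integrableI_nonneg) (use order.strict_trans[OF nn[of n], of \<infinity>] in \<open>auto simp: g_def[abs_def]\<close>)
  have "(\<lambda>n. ennreal (\<integral>x. norm (g n x) \<partial>M)) \<longlonglongrightarrow> ennreal 0"
  proof -
    have "ennreal (\<integral>x. norm (g n x) \<partial>M) = (\<integral>\<^sup>+x. ennreal ((f (n + N) x)\<^sup>2) \<partial>M)" for n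
      by (subst nn_integral_eq_integral[symmetric]) (use i[of n] in \<open>auto simp: g_def[abs_def]\<close>)
    then show ?thesis using LIMSEQ_ignore_initial_segment[OF lim, of N] by simp
  qed
  then have "(\<lambda>n. \<integral>x. norm (g n x) \<partial>M) \<longlonglongrightarrow> 0"
    by (subst (asm) tendsto_ennreal_iff) auto
  from tendsto_L1_AE_subseq[OF i this] obtain s :: "nat \<Rightarrow> nat" where s: "strict_mono s" "AE x in M. (\<lambda>n. g (s n) x) \<longlonglongrightarrow> 0"
    by blast
  show ?thesis
  proof (rule that[of "\<lambda>n. s n + N"])
    show "strict_mono (\<lambda>n. s n + N)" using s(1) by (simp add: strict_mono_def)
    show "AE x in M. (\<lambda>n. f (s n + N) x) \<longlonglongrightarrow> 0"
      using s(2)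
    proof eventually_elim
      case (elim x)
      then have "(\<lambda>n. sqrt ((f (s n + N) x)\<^sup>2)) \<longlonglongrightarrow> sqrt 0" unfolding g_def by (intro tendsto_intros)
      then show ?case by (simp add: tendsto_rabs_zero_iff)
    qed
  qed
qed

text \<open>The convolution lives on the Minkowski sum of \<open>K\<close> and a closed ball, which
  is compact and contained in \<open>S\<close> by assumption.\<close>

lemma conv_moll_test:
  assumes "r > 0" "integrable lborel g" "compact K" "\<And>x. x \<notin> K \<Longrightarrow> g x = 0"
    "(\<Union>x\<in>K. cball x r) \<subseteq> S"
  shows "conv (moll r) g \<in> test_functions S"
proof (rule test_functionsI)
  show "C_infinity (conv (moll r) g)" by (rule C_infinity_conv[OF moll_test[OF assms(1)] assms(2)])
  show "compact {x + y |x y. x \<in> K \<and> y \<in> cball 0 r}" by (rule compact_sums[OF assms(3) compact_cball])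
  show "{x + y |x y. x \<in> K \<and> y \<in> cball 0 r} \<subseteq> S"
  proof
    fix z assume "z \<in> {x + y |x y. x \<in> K \<and> y \<in> cball 0 r}"
    then obtain x y where "x \<in> K" "norm y \<le> r" "z = x + y" by auto
    then have "z \<in> cball x r" by (auto simp: dist_norm)
    then show "z \<in> S" using assms(5) \<open>x \<in> K\<close> by blast
  qed
  fix z assume z: "z \<notin> {x + y |x y. x \<in> K \<and> y \<in> cball 0 r}"
  have *: "moll r (z - y) * g y = 0" for y
  proof (cases "y \<in> K")
    case True
    have "norm (z - y) > r"
    proof (rule ccontr)
      assume "\<not> norm (z - y) > r"
      then have "y \<in> K \<and> z - y \<in> cball 0 r" "z = y + (z - y)" using True by auto
      then show False using z by blast
    qed
    then show ?thesis using assms(1) moll_eq_0[of r "z - y"] by simp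
  qed (use assms(4) in auto)
  show "conv (moll r) g z = 0" unfolding conv_def * by simp
qed

lemma abs_conv_moll_le:
  assumes r: "r > 0" and g: "integrable lborel g" and B: "\<And>x. \<bar>g x\<bar> \<le> B"
  shows "\<bar>conv (moll r) g x\<bar> \<le> B"
proof -
  have "\<bar>conv (moll r) g x\<bar> \<le> (\<integral>y. moll r (x - y) * B \<partial>lborel)"
    unfolding conv_def
  proof (rule integral_abs_bound_integral)
    show "integrable lborel (\<lambda>y. moll r (x - y) * g y)" by (rule integrable_conv[OF moll_test[OF r] g])
    show "integrable lborel (\<lambda>y. moll r (x - y) * B)" using has_integral_moll_shift[OF r] by auto
    show "\<bar>moll r (x - y) * g y\<bar> \<le> moll r (x - y) * B" for y
      using B moll_nonneg[of r "x - y"] by (auto simp: abs_mult intro: mult_left_mono)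
  qed
  also have "\<dots> = B" using has_integral_moll_shift[OF r, of x] by simp
  finally show ?thesis .
qed

text \<open>On a compact set the sign of \<open>h\<close> is the ideal test function. Its
  mollifications are admissible for small radii, stay bounded by 1 and converge almost everywhere
  along a subsequence, so dominated convergence makes the integral of |h| over the compact set
  vanish. Countably many compact sets exhaust \<open>S\<close>.\<close>

lemma fundamental_lemma:
  fixes h :: "'a::euclidean_space \<Rightarrow> real"
  assumes S: "open S" and h: "locally_integrable S h"
    and 0: "\<And>\<phi>. \<phi> \<in> test_functions S \<Longrightarrow> (\<integral>x. h x * \<phi> x \<partial>lebesgue_on S) = 0"
  shows "AE x in lebesgue_on S. h x = 0"
proof -
  let ?M = "lebesgue_on S"
  have hm [measurable]: "h \<in> borel_measurable ?M" by (rule locally_integrable_measurable[OF S h])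
  obtain h' where h' [measurable]: "h' \<in> borel_measurable borel" and hh': "AE x in ?M. h' x = h x"
    using borel_representative[OF S hm] by metis
  have main: "AE x in ?M. x \<in> K \<longrightarrow> h x = 0" if K: "compact K" "K \<subseteq> S" for K
  proof -
    obtain d where d: "d > 0" "(\<Union>x\<in>K. cball x d) \<subseteq> S"
      using compact_subset_open_imp_cball_epsilon_subset[OF K(1) S K(2)] by metis
    have K_sets [measurable]: "K \<in> sets borel" using K(1) by (simp add: borel_compact)
    \<comment> \<open>The sign is taken of the Borel version, so that \<open>g\<close> is Borel and
      can be convolved.\<close>
    define g where "g x = indicator K x * sgn (h' x)" for x
    have gm [measurable]: "g \<in> borel_measurable borel" unfolding g_def by measurable
    have g1: "\<bar>g x\<bar> \<le> 1" for x by (auto simp: g_def indicator_def sgn_real_def)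
    have fin: "emeasure lborel K < \<infinity>" using emeasure_bounded_finite[OF compact_imp_bounded[OF K(1)]] .
    have gi: "integrable lborel g"
      by (rule Bochner_Integration.integrable_bound[of _ "\<lambda>x. indicator K x :: real"])
        (use fin in \<open>auto simp: g_def sgn_real_def intro!: integrable_real_indicator\<close>)
    have g2: "(\<integral>\<^sup>+x. ennreal ((g x)\<^sup>2) \<partial>lborel) < \<infinity>"
    proof -
      have "(\<integral>\<^sup>+x. ennreal ((g x)\<^sup>2) \<partial>lborel) \<le> (\<integral>\<^sup>+x. indicator K x \<partial>lborel)"
        by (intro nn_integral_mono) (auto simp: g_def indicator_def sgn_real_def)
      then show ?thesis using fin by (auto intro: le_less_trans)
    qed
    define r where "r n = d / real (Suc (Suc n))" for n
    have r: "r n > 0" "r n \<le> d" for n using d(1) by (auto simp: r_def divide_le_eq mult_le_cancel_left1)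
    have "r \<longlonglongrightarrow> 0"
      using LIMSEQ_Suc[OF tendsto_mult_right_zero[OF LIMSEQ_inverse_real_of_nat], of d]
      by (simp add: r_def[abs_def] divide_inverse)
    note lim = conv_moll_tendsto_L2[OF gi g2 r(1) this]
    define \<phi> where "\<phi> n = conv (moll (r n)) g" for n
    have test: "\<phi> n \<in> test_functions (\<Union>x\<in>K. cball x d)" for n
      unfolding \<phi>_def
    proof (rule conv_moll_test[OF r(1) gi K(1)])
      show "(\<Union>x\<in>K. cball x (r n)) \<subseteq> (\<Union>x\<in>K. cball x d)"
        by (intro UN_mono subset_cball r) auto
    qed (auto simp: g_def)
    have testS: "\<phi> n \<in> test_functions S" for n using test_functions_mono[OF test d(2)] .
    have \<phi>m: "\<phi> n \<in> borel_measurable borel" for n using test_functions_measurable[OF test] .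
    have [measurable]: "\<phi> n \<in> borel_measurable ?M" "g \<in> borel_measurable ?M"
      "(indicator K :: 'a \<Rightarrow> real) \<in> borel_measurable ?M" for n
      by (rule borel_measurable_lebesgue_onI, use \<phi>m gm in simp)+
    have "(\<lambda>n. \<integral>\<^sup>+x. ennreal ((\<phi> n x - g x)\<^sup>2) \<partial>?M) \<longlonglongrightarrow> 0"
      by (rule tendsto_sandwich[OF _ _ tendsto_const lim])
        (auto simp: \<phi>_def intro!: always_eventually nn_integral_lebesgue_on_le[OF S])
    then obtain s :: "nat \<Rightarrow> nat" where s: "AE x in ?M. (\<lambda>n. \<phi> (s n) x - g x) \<longlonglongrightarrow> 0"
      by (rule L2_tendsto_AE_subseq[rotated]) measurable
    have cball_translation_UN: "(\<Union>x\<in>K. cball x d) = {x + y |x y. x \<in> K \<and> y \<in> cball 0 d}"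
    proof (intro set_eqI iffI)
      fix z assume "z \<in> (\<Union>x\<in>K. cball x d)"
      then obtain x where "x \<in> K" "norm (z - x) \<le> d" by (auto simp: dist_norm norm_minus_commute)
      moreover have "z = x + (z - x)" by simp
      ultimately show "z \<in> {x + y |x y. x \<in> K \<and> y \<in> cball 0 d}" by force
    qed (force simp: dist_norm)
    let ?K' = "{x + y |x y. x \<in> K \<and> y \<in> cball 0 d}"
    have K': "compact ?K'" by (rule compact_sums[OF K(1) compact_cball])
    have UK': "(\<Union>x\<in>K. cball x d) = ?K'"
      by (simp add: cball_translation_UN)
    have K'S: "?K' \<subseteq> S" using d(2) unfolding UK' .
    have iK': "integrable ?M (\<lambda>x. indicator ?K' x * h x)"
    proof -
      have "integrable (lebesgue_on ?K') h" using h K' K'S unfolding locally_integrable_def by blast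
      moreover have "?K' \<inter> space lebesgue \<in> sets lebesgue" using lmeasurable_compact[OF K'] by auto
      ultimately have "integrable lebesgue (\<lambda>x. indicator ?K' x *\<^sub>R h x)"
        using integrable_restrict_space[of ?K' lebesgue h] by simp
      moreover have "(\<lambda>x. indicator S x *\<^sub>R (indicator ?K' x * h x)) = (\<lambda>x. indicator ?K' x *\<^sub>R h x)"
        using K'S by (auto simp: indicator_def fun_eq_iff)
      ultimately show ?thesis
        unfolding integrable_restrict_space[OF open_sets_lebesgue[OF S]] by simp
    qed
    have "(\<lambda>n. \<integral>x. h x * \<phi> (s n) x \<partial>?M) \<longlonglongrightarrow> (\<integral>x. h x * g x \<partial>?M)"
    proof (rule integral_dominated_convergence)
      \<comment> \<open>All mollifications are bounded by 1 and vanish outside \<open>?K'\<close>,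
        the closed \<open>d\<close>-neighbourhood of \<open>K\<close>. This is a compact subset of
        \<open>S\<close>, so \<open>h\<close> is integrable on it.\<close>
      show "integrable ?M (\<lambda>x. \<bar>indicator ?K' x * h x\<bar>)" using iK' by (rule integrable_abs)
      show "AE x in ?M. (\<lambda>n. h x * \<phi> (s n) x) \<longlonglongrightarrow> h x * g x"
        using s by eventually_elim (auto intro: tendsto_mult_left simp: LIM_zero_iff)
      show "AE x in ?M. norm (h x * \<phi> (s n) x) \<le> \<bar>indicator ?K' x * h x\<bar>" for n
      proof (rule AE_I2)
        fix x
        have "\<bar>\<phi> (s n) x\<bar> \<le> 1" unfolding \<phi>_def by (rule abs_conv_moll_le[OF r(1) gi g1])
        moreover have "x \<notin> ?K' \<Longrightarrow> \<phi> (s n) x = 0"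
          using test_functionsD(3)[OF test[of "s n"]] closure_subset[of "{x. \<phi> (s n) x \<noteq> 0}"] unfolding UK' by auto
        ultimately show "norm (h x * \<phi> (s n) x) \<le> \<bar>indicator ?K' x * h x\<bar>"
          by (cases "x \<in> ?K'") (auto simp: abs_mult mult_left_le)
      qed
    qed measurable
    then have "(\<integral>x. h x * g x \<partial>?M) = 0" using 0[OF testS] by (simp add: LIMSEQ_const_iff)
    moreover have "AE x in ?M. h x * g x = indicator K x * \<bar>h x\<bar>"
      using hh' by eventually_elim (auto simp: g_def indicator_def abs_sgn)
    ultimately have z: "(\<integral>x. indicator K x * \<bar>h x\<bar> \<partial>?M) = 0"
      using integral_cong_AE[of "\<lambda>x. h x * g x" ?M "\<lambda>x. indicator K x * \<bar>h x\<bar>"] by simp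
    have "integrable ?M (\<lambda>x. indicator K x * \<bar>h x\<bar>)"
    proof (rule Bochner_Integration.integrable_bound[OF iK'])
      have "K \<subseteq> ?K'" using d(1) unfolding cball_translation_UN[symmetric] by force
      then show "AE x in ?M. norm (indicator K x * \<bar>h x\<bar>) \<le> norm (indicator ?K' x * h x)"
        by (intro AE_I2) (auto simp: indicator_def)
    qed measurable
    then have "AE x in ?M. indicator K x * \<bar>h x\<bar> = 0"
      using z by (subst (asm) integral_nonneg_eq_0_iff_AE) auto
    then show ?thesis by eventually_elim (auto simp: indicator_def)
  qed
  obtain C :: "nat \<Rightarrow> 'a set" where C': "\<forall>n. compact (C n) \<and> C n \<subseteq> S" and CS: "\<Union>(range C) = S"
    using open_sigma_compact[OF S] by (elim exE conjE) (rule that)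
  have C: "compact (C n)" "C n \<subseteq> S" for n using C' by auto
  have "AE x in ?M. \<forall>n. x \<in> C n \<longrightarrow> h x = 0"
    unfolding AE_all_countable using main C by blast
  moreover have "AE x in ?M. x \<in> S" by (rule AE_I2) simp
  ultimately show ?thesis by eventually_elim (use CS in blast)
qed

section \<open>Weak derivatives\<close>

text \<open>\<open>weak_deriv\<close> is an arbitrary choice among all weak derivatives; uniqueness
  up to null sets is what makes statements about the chosen one transferable to any explicit
  candidate.\<close>

lemma has_weak_deriv_unique:
  assumes S: "open S" and v: "has_weak_deriv S \<alpha> u v" "has_weak_deriv S \<alpha> u v'"
  shows "AE x in lebesgue_on S. v x = v' x"
proof -
  have li: "locally_integrable S v" "locally_integrable S v'" using v by (auto simp: has_weak_deriv_def)
  have "AE x in lebesgue_on S. v x - v' x = 0"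
  proof (rule fundamental_lemma[OF S])
    show "locally_integrable S (\<lambda>x. v x - v' x)"
      using li by (auto simp: locally_integrable_def)
    fix \<phi> assume \<phi>: "\<phi> \<in> test_functions S"
    have "(\<integral>x. v x * \<phi> x \<partial>lebesgue_on S) = (\<integral>x. v' x * \<phi> x \<partial>lebesgue_on S)"
      using v \<phi> by (auto simp: has_weak_deriv_def)
    then show "(\<integral>x. (v x - v' x) * \<phi> x \<partial>lebesgue_on S) = 0"
      using integrable_locally_integrable_test[OF S li(1) \<phi>] integrable_locally_integrable_test[OF S li(2) \<phi>]
      by (simp add: left_diff_distrib)
  qed
  then show ?thesis by simp
qed

lemma has_weak_deriv_weak_deriv: "has_weak_deriv S \<alpha> u v \<Longrightarrow> has_weak_deriv S \<alpha> u (weak_deriv S \<alpha> u)"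
  unfolding weak_deriv_def by (rule someI[where P="has_weak_deriv S \<alpha> u"])

lemma weak_deriv_AE_eq:
  assumes "open S" "has_weak_deriv S \<alpha> u v"
  shows "AE x in lebesgue_on S. weak_deriv S \<alpha> u x = v x"
  by (rule has_weak_deriv_unique[OF assms(1) has_weak_deriv_weak_deriv[OF assms(2)] assms(2)])

lemma has_weak_deriv_Nil: "locally_integrable S u \<Longrightarrow> has_weak_deriv S [] u u"
  by (simp add: has_weak_deriv_def)

lemma test_functions_partials:
  "\<phi> \<in> test_functions S \<Longrightarrow> set \<alpha> \<subseteq> Basis \<Longrightarrow> partials \<alpha> \<phi> \<in> test_functions S"
proof (induction \<alpha> arbitrary: \<phi> rule: rev_induct)
  case (snoc b \<alpha>)
  then show ?case using snoc.IH[of "partials [b] \<phi>"] by (simp add: partials_snoc test_functions_partial)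
qed simp

lemma has_weak_deriv_diff:
  assumes S: "open S" and \<alpha>: "set \<alpha> \<subseteq> Basis" and v: "has_weak_deriv S \<alpha> u v" "has_weak_deriv S \<alpha> u' v'"
  shows "has_weak_deriv S \<alpha> (\<lambda>x. u x - u' x) (\<lambda>x. v x - v' x)"
proof -
  have li: "locally_integrable S u" "locally_integrable S u'" "locally_integrable S v" "locally_integrable S v'"
    using v by (auto simp: has_weak_deriv_def)
  note i = integrable_locally_integrable_test[OF S]
  have "(\<integral>x. (u x - u' x) * partials \<alpha> \<phi> x \<partial>lebesgue_on S) =
        (- 1) ^ length \<alpha> * (\<integral>x. (v x - v' x) * \<phi> x \<partial>lebesgue_on S)" if \<phi>: "\<phi> \<in> test_functions S" for \<phi>
    using v \<phi> li i[OF _ \<phi>] i[OF _ test_functions_partials[OF \<phi> \<alpha>]]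
    by (simp add: left_diff_distrib has_weak_deriv_def right_diff_distrib)
  then show ?thesis using li by (simp add: has_weak_deriv_def locally_integrable_def)
qed

lemma locally_integrable_continuous:
  fixes f :: "'a::euclidean_space \<Rightarrow> 'b::euclidean_space"
  assumes "continuous_on UNIV f"
  shows "locally_integrable S f"
  unfolding locally_integrable_def
proof (intro allI impI)
  fix K assume "compact K \<and> K \<subseteq> S"
  then have K: "compact K" by simp
  have "integrable (lborel) (\<lambda>x. indicator K x *\<^sub>R f x)"
    by (rule borel_integrable_compact[OF K]) (rule continuous_on_subset[OF assms], simp)
  then have "integrable lebesgue (\<lambda>x. indicator K x *\<^sub>R f x)"
    by (subst integrable_completion) auto
  then show "integrable (lebesgue_on K) f"
    using lmeasurable_compact[OF K] by (subst integrable_restrict_space) auto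
qed

text \<open>Convolving \<phi> with the indicator of a large ball gives a function that is constant
  near 0, equal to the integral of \<phi>. Its derivative at 0 therefore vanishes, but that
  derivative is also the convolution of the partial derivative with the indicator, that is, the
  integral in question.\<close>

lemma integral_partial_test:
  assumes \<phi>: "\<phi> \<in> test_functions S" and b: "b \<in> Basis"
  shows "(\<integral>x. partials [b] \<phi> x \<partial>lborel) = 0"
proof -
  obtain R where R: "\<And>x. x \<in> closure {x. \<phi> x \<noteq> 0} \<Longrightarrow> norm x \<le> R"
    using compact_imp_bounded[OF test_functionsD(2)[OF \<phi>]] by (auto simp: bounded_iff)
  \<comment> \<open>If |x| < 1 and x - y lies in the support, then |y| < R + 1, so the ball of
    radius R + 2 contains every relevant y.\<close>
  define g :: "'a \<Rightarrow> real" where "g = indicator (ball 0 (R + 2))"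
  have g: "integrable lborel g"
    unfolding g_def using emeasure_bounded_finite[OF bounded_ball] by (intro integrable_real_indicator) auto
  have reflect: "(\<integral>y. f (x - y) \<partial>lborel) = (\<integral>y. f y \<partial>lborel)" if "f \<in> borel_measurable borel" for f :: "'a \<Rightarrow> real" and x
  proof -
    have eq: "lborel = distr lborel borel ((-) x)" using lborel_affine[of "-1" x] by (simp add: density_1)
    show ?thesis by (subst (2) eq) (use that in \<open>simp add: integral_distr\<close>)
  qed
  have c: "conv f g x = (\<integral>y. f y \<partial>lborel)"
    if "f \<in> borel_measurable borel" "\<And>z. z \<notin> closure {x. \<phi> x \<noteq> 0} \<Longrightarrow> f z = 0" "norm x < 1" for f x
  proof -
    have *: "f (x - y) * g y = f (x - y)" for y
    proof (cases "norm (x - y) \<le> R")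
      case True
      then have "norm y < R + 2" using norm_triangle_sub[of y x] that(3) by (simp add: norm_minus_commute)
      then show ?thesis by (simp add: g_def)
    qed (use R that(2) in force)
    show ?thesis unfolding conv_def * by (rule reflect[OF that(1)])
  qed
  let ?I = "\<integral>y. \<phi> y \<partial>lborel"
  have I: "conv \<phi> g x = ?I" if "norm x < 1" for x
  proof (rule c[OF test_functions_measurable[OF \<phi>] _ that])
    show "\<phi> z = 0" if "z \<notin> closure {x. \<phi> x \<noteq> 0}" for z
      using that closure_subset[of "{x. \<phi> x \<noteq> 0}"] by auto
  qed
  have "(conv \<phi> g has_derivative (\<lambda>h. 0)) (at 0)"
  proof (rule has_derivative_transform_within_open[OF has_derivative_const[of ?I]])
    show "?I = conv \<phi> g x" if "x \<in> ball 0 1" for x using I that by simp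
  qed auto
  from frechet_derivative_at[OF this, symmetric] have "partials [b] (conv \<phi> g) 0 = 0" by (simp add: partials.simps(2))
  then have "conv (partials [b] \<phi>) g 0 = 0" using partials_conv[OF \<phi> g b] by simp
  moreover have "conv (partials [b] \<phi>) g 0 = (\<integral>y. partials [b] \<phi> y \<partial>lborel)"
    by (rule c[OF test_functions_measurable[OF test_functions_partial[OF \<phi> b]] partials_outside_support]) auto
  ultimately show ?thesis by simp
qed

lemma partials_mult:
  assumes "f differentiable (at x)" "g differentiable (at x)"
  shows "partials [b] (\<lambda>x. f x * g x) x = f x * partials [b] g x + partials [b] f x * g x"
proof -
  have "((\<lambda>x. f x * g x) has_derivative (\<lambda>h. f x * frechet_derivative g (at x) h + frechet_derivative f (at x) h * g x)) (at x)"
    using assms by (intro has_derivative_mult) (simp_all add: frechet_derivative_works)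
  from frechet_derivative_at[OF this] show ?thesis by (simp add: partials.simps(2) fun_eq_iff)
qed

text \<open>The product of \<open>f\<close> with a test function is a test function, so the integral
  of its derivative vanishes; the product rule turns this into integration by parts.\<close>

lemma has_weak_deriv_smooth:
  assumes S: "open S" and f: "C_infinity f" and b: "b \<in> Basis"
  shows "has_weak_deriv S [b] f (partials [b] f)"
proof -
  have cont: "continuous_on UNIV f" "continuous_on UNIV (partials [b] f)"
    using f C_infinity_partial[OF f b] by (auto intro: C_infinity_continuous)
  have li: "locally_integrable S f" "locally_integrable S (partials [b] f)"
    using cont by (auto intro: locally_integrable_continuous)
  have "(\<integral>x. f x * partials [b] \<phi> x \<partial>lebesgue_on S) = - (\<integral>x. partials [b] f x * \<phi> x \<partial>lebesgue_on S)"
    if \<phi>: "\<phi> \<in> test_functions S" for \<phi>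
  proof -
    have i: "integrable (lebesgue_on S) (\<lambda>x. f x * partials [b] \<phi> x)" "integrable (lebesgue_on S) (\<lambda>x. partials [b] f x * \<phi> x)"
      using integrable_locally_integrable_test[OF S] li \<phi> test_functions_partial[OF \<phi> b] by blast+
    have \<psi>: "(\<lambda>x. \<phi> x * f x) \<in> test_functions S" by (rule test_functions_mult[OF \<phi> f])
    have "(\<integral>x. f x * partials [b] \<phi> x + partials [b] f x * \<phi> x \<partial>lebesgue_on S) =
        (\<integral>x. partials [b] (\<lambda>x. \<phi> x * f x) x \<partial>lebesgue_on S)"
      by (intro Bochner_Integration.integral_cong refl)
        (subst partials_mult, auto simp: test_functionsD(4)[OF \<phi>] C_infinity_differentiable[OF f])
    also have "\<dots> = (\<integral>x. partials [b] (\<lambda>x. \<phi> x * f x) x \<partial>lborel)"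
    proof (rule integral_lebesgue_on(1)[OF S])
      show "partials [b] (\<lambda>x. \<phi> x * f x) x = 0" if "x \<notin> S" for x
        using that test_functionsD(3)[OF \<psi>] by (intro partials_outside_support) blast
      show "partials [b] (\<lambda>x. \<phi> x * f x) \<in> borel_measurable borel"
        by (rule test_functions_measurable[OF test_functions_partial[OF \<psi> b]])
    qed
    also have "\<dots> = 0" by (rule integral_partial_test[OF \<psi> b])
    finally show ?thesis using i by simp
  qed
  then show ?thesis using li by (simp add: has_weak_deriv_def)
qed

text \<open>Pointwise |h| \<le> h^2 + w, because (|h| - 1)^2 \<ge> 0 and \<open>w\<close> is at
  least 1 wherever \<open>h\<close> is nonzero. The role of \<open>w\<close> is that of the
  indicator of a set of finite measure.\<close>

lemma L2_integrable_finite: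
  fixes h w :: "'a \<Rightarrow> real"
  assumes [measurable]: "h \<in> borel_measurable M" and "integrable M (\<lambda>x. (h x)\<^sup>2)" and "integrable M w" "\<And>x. h x \<noteq> 0 \<Longrightarrow> w x \<ge> 1"
    "\<And>x. w x \<ge> 0"
  shows "integrable M h"
proof (rule Bochner_Integration.integrable_bound[of _ "\<lambda>x. (h x)\<^sup>2 + w x"])
  show "AE x in M. norm (h x) \<le> norm ((h x)\<^sup>2 + w x)"
  proof (rule AE_I2)
    fix x
    have "\<bar>h x\<bar> \<le> (h x)\<^sup>2 + w x"
    proof (cases "h x = 0")
      case False
      have "0 \<le> (\<bar>h x\<bar> - 1)\<^sup>2" by simp
      also have "\<dots> = (h x)\<^sup>2 - 2 * \<bar>h x\<bar> + 1" by (simp add: power2_eq_square algebra_simps)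
      finally show ?thesis using assms(4)[OF False] by simp
    qed (use assms(5) in simp)
    then show "norm (h x) \<le> norm ((h x)\<^sup>2 + w x)" by simp
  qed
qed (use assms in auto)

lemma L2_representative:
  fixes u :: "'a::euclidean_space \<Rightarrow> real"
  assumes S: "open S" "bounded S" and u: "u \<in> L2 (lebesgue_on S)"
  obtains h where "h \<in> borel_measurable borel" "\<And>x. x \<notin> S \<Longrightarrow> h x = 0" "AE x in lebesgue_on S. h x = u x"
    "integrable lborel h" "(\<integral>\<^sup>+x. ennreal ((h x)\<^sup>2) \<partial>lborel) < \<infinity>"
proof -
  have um [measurable]: "u \<in> borel_measurable (lebesgue_on S)" and u2: "integrable (lebesgue_on S) (\<lambda>x. (u x)\<^sup>2)"
    using u by (auto simp: L2_def)
  obtain h where h [measurable]: "h \<in> borel_measurable borel" and h0: "\<And>x. x \<notin> S \<Longrightarrow> h x = 0"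
    and hu: "AE x in lebesgue_on S. h x = u x"
    by (rule borel_representative[OF S(1) um]) (rule that)
  have [measurable]: "h \<in> borel_measurable (lebesgue_on S)" by (rule borel_measurable_lebesgue_onI) measurable
  have "AE x in lebesgue_on S. (u x)\<^sup>2 = (h x)\<^sup>2" using hu by eventually_elim simp
  with u2 have "integrable (lebesgue_on S) (\<lambda>x. (h x)\<^sup>2)"
    by (subst (asm) integrable_cong_AE) auto
  then have h2: "integrable lborel (\<lambda>x. (h x)\<^sup>2)"
    using integral_lebesgue_on(2)[OF S(1), of "\<lambda>x. (h x)\<^sup>2"] h0 by simp
  have "integrable lborel h"
  proof (rule L2_integrable_finite[OF _ h2, of "indicator S"])
    show "integrable lborel (indicator S :: 'a \<Rightarrow> real)"
      using emeasure_bounded_finite[OF S(2)] S(1) by (intro integrable_real_indicator) auto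
    show "indicator S x \<ge> (1::real)" if "h x \<noteq> 0" for x using h0 that by (auto simp: indicator_def)
  qed auto
  moreover have "(\<integral>\<^sup>+x. ennreal ((h x)\<^sup>2) \<partial>lborel) < \<infinity>"
    using h2 by (subst nn_integral_eq_integral) auto
  ultimately show ?thesis using that h h0 hu by blast
qed

text \<open>Mollification commutes with the weak derivative only at points whose kernel stays inside
  \<open>S\<close>; hence the identity between the derivative of \<open>U n\<close> and
  \<open>Q n b\<close> is asserted on \<open>K\<close> alone. \<open>Q n b\<close> is the mollified
  weak derivative, extended by zero before mollifying, and converges in L^2 on all of
  \<open>S\<close> even where it is not the derivative of \<open>U n\<close>.\<close>

lemma weak_deriv_mollify:
  fixes u :: "'a::euclidean_space \<Rightarrow> real"
  assumes S: "open S" "bounded S" and K: "compact K" "K \<subseteq> S"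
    and u: "u \<in> L2 (lebesgue_on S)" and p: "\<And>b. b \<in> Basis \<Longrightarrow> p b \<in> L2 (lebesgue_on S)"
    and w: "\<And>b. b \<in> Basis \<Longrightarrow> has_weak_deriv S [b] u (p b)"
  obtains U Q where "\<And>n. C_infinity (U n)" "AE x in lebesgue_on S. (\<lambda>n. U n x) \<longlonglongrightarrow> u x"
    "\<And>n b x. b \<in> Basis \<Longrightarrow> x \<in> K \<Longrightarrow> partials [b] (U n) x = Q n b x"
    "\<And>n b. b \<in> Basis \<Longrightarrow> Q n b \<in> borel_measurable (lebesgue_on S)"
    "\<And>b. b \<in> Basis \<Longrightarrow> (\<lambda>n. \<integral>\<^sup>+x. ennreal ((Q n b x - p b x)\<^sup>2) \<partial>lebesgue_on S) \<longlonglongrightarrow> 0"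
proof -
  let ?M = "lebesgue_on S"
  obtain h where h: "h \<in> borel_measurable borel" "\<And>x. x \<notin> S \<Longrightarrow> h x = 0" "AE x in ?M. h x = u x"
    "integrable lborel h" "(\<integral>\<^sup>+x. ennreal ((h x)\<^sup>2) \<partial>lborel) < \<infinity>"
    by (rule L2_representative[OF S u]) (rule that)
  have "\<forall>b\<in>Basis. \<exists>k. k \<in> borel_measurable borel \<and> (\<forall>x. x \<notin> S \<longrightarrow> k x = 0) \<and> (AE x in ?M. k x = p b x) \<and>
    integrable lborel k \<and> (\<integral>\<^sup>+x. ennreal ((k x)\<^sup>2) \<partial>lborel) < \<infinity>"
  proof
    fix b :: 'a assume b: "b \<in> Basis"
    obtain k where "k \<in> borel_measurable borel" "\<And>x. x \<notin> S \<Longrightarrow> k x = 0" "AE x in ?M. k x = p b x"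
      "integrable lborel k" "(\<integral>\<^sup>+x. ennreal ((k x)\<^sup>2) \<partial>lborel) < \<infinity>"
      by (rule L2_representative[OF S p[OF b]]) (rule that)
    then show "\<exists>k. k \<in> borel_measurable borel \<and> (\<forall>x. x \<notin> S \<longrightarrow> k x = 0) \<and> (AE x in ?M. k x = p b x) \<and>
      integrable lborel k \<and> (\<integral>\<^sup>+x. ennreal ((k x)\<^sup>2) \<partial>lborel) < \<infinity>"
      by (intro exI[of _ k]) simp
  qed
  from bchoice[OF this] obtain k where
    "\<forall>b\<in>Basis. k b \<in> borel_measurable borel \<and> (\<forall>x. x \<notin> S \<longrightarrow> k b x = 0) \<and> (AE x in ?M. k b x = p b x) \<and>
    integrable lborel (k b) \<and> (\<integral>\<^sup>+x. ennreal ((k b x)\<^sup>2) \<partial>lborel) < \<infinity>"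
    by (rule exE)
  then have k: "\<And>b. b \<in> Basis \<Longrightarrow> k b \<in> borel_measurable borel"
     "\<And>b x. b \<in> Basis \<Longrightarrow> x \<notin> S \<Longrightarrow> k b x = 0" "\<And>b. b \<in> Basis \<Longrightarrow> AE x in ?M. k b x = p b x"
     "\<And>b. b \<in> Basis \<Longrightarrow> integrable lborel (k b)" "\<And>b. b \<in> Basis \<Longrightarrow> (\<integral>\<^sup>+x. ennreal ((k b x)\<^sup>2) \<partial>lborel) < \<infinity>"
    by simp_all
  obtain d where d: "d > 0" "(\<Union>x\<in>K. cball x d) \<subseteq> S"
    using compact_subset_open_imp_cball_epsilon_subset[OF K(1) S(1) K(2)] by metis
  define r where "r n = d / real (Suc (Suc n))" for n
  have r: "r n > 0" "r n \<le> d" for n using d(1) by (auto simp: r_def divide_le_eq mult_le_cancel_left1)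
  have r0: "r \<longlonglongrightarrow> 0"
    using LIMSEQ_Suc[OF tendsto_mult_right_zero[OF LIMSEQ_inverse_real_of_nat], of d]
    by (simp add: r_def[abs_def] divide_inverse)
  define V where "V n = conv (moll (r n)) h" for n
  define W where "W n b = conv (moll (r n)) (k b)" for n b
  have Vs: "C_infinity (V n)" for n unfolding V_def by (rule C_infinity_conv[OF moll_test[OF r(1)] h(4)])
  have Ws: "C_infinity (W n b)" if "b \<in> Basis" for n b
    unfolding W_def by (rule C_infinity_conv[OF moll_test[OF r(1)] k(4)[OF that]])
  have smooth_m: "f \<in> borel_measurable ?M" if "C_infinity f" for f :: "'a \<Rightarrow> real"
    using C_infinity_continuous[OF that] by (intro borel_measurable_lebesgue_onI borel_measurable_continuous_onI)
  have L2lim: "(\<lambda>n. \<integral>\<^sup>+x. ennreal ((conv (moll (r n)) g x - v x)\<^sup>2) \<partial>?M) \<longlonglongrightarrow> 0"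
    if g: "integrable lborel g" "(\<integral>\<^sup>+x. ennreal ((g x)\<^sup>2) \<partial>lborel) < \<infinity>" "AE x in ?M. g x = v x" for g v :: "'a \<Rightarrow> real"
  proof -
    have "(\<integral>\<^sup>+x. ennreal ((conv (moll (r n)) g x - v x)\<^sup>2) \<partial>?M) = (\<integral>\<^sup>+x. ennreal ((conv (moll (r n)) g x - g x)\<^sup>2) \<partial>?M)" for n
      by (rule nn_integral_cong_AE) (use g(3) in eventually_elim, simp)
    moreover have "(\<lambda>n. \<integral>\<^sup>+x. ennreal ((conv (moll (r n)) g x - g x)\<^sup>2) \<partial>?M) \<longlonglongrightarrow> 0"
      by (rule tendsto_sandwich[OF _ _ tendsto_const conv_moll_tendsto_L2[OF g(1,2) r(1) r0]])
        (auto intro!: always_eventually nn_integral_lebesgue_on_le[OF S(1)])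
    ultimately show ?thesis by simp
  qed
  have Vlim: "(\<lambda>n. \<integral>\<^sup>+x. ennreal ((V n x - u x)\<^sup>2) \<partial>?M) \<longlonglongrightarrow> 0"
    unfolding V_def by (rule L2lim[OF h(4,5,3)])
  have Wlim: "(\<lambda>n. \<integral>\<^sup>+x. ennreal ((W n b x - p b x)\<^sup>2) \<partial>?M) \<longlonglongrightarrow> 0" if "b \<in> Basis" for b
    unfolding W_def by (rule L2lim[OF k(4,5,3)[OF that]])
  have um: "u \<in> borel_measurable ?M" using u by (simp add: L2_def)
  \<comment> \<open>Almost everywhere convergence of the functions holds along a subsequence; the
    derivatives are later taken along the same one, which keeps their L^2 convergence.\<close>
  obtain s :: "nat \<Rightarrow> nat" where s: "strict_mono s" "AE x in ?M. (\<lambda>n. V (s n) x - u x) \<longlonglongrightarrow> 0"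
    by (rule L2_tendsto_AE_subseq[OF _ Vlim]) (use smooth_m[OF Vs] um in auto)
  have part: "partials [b] (V n) x = W n b x" if b: "b \<in> Basis" and x: "x \<in> K" for n b x
  proof -
    \<comment> \<open>Viewed as a function of \<open>y\<close>, the kernel is a test function in
      \<open>S\<close>. The sign from differentiating x - y cancels against the sign in the
      definition of the weak derivative.\<close>
    define \<zeta> where "\<zeta> y = moll (r n) (x - y)" for y
    have cb: "cball x (r n) \<subseteq> S" using d(2) x subset_cball[OF r(2), of x n] by blast
    have \<zeta>: "\<zeta> \<in> test_functions S"
    proof (rule test_functionsI[OF _ compact_cball cb])
      show "C_infinity \<zeta>" unfolding \<zeta>_def by (rule C_infinity_moll)
      show "\<zeta> y = 0" if "y \<notin> cball x (r n)" for y
        using that r(1)[of n] unfolding \<zeta>_def by (intro moll_eq_0) (auto simp: dist_norm)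
    qed
    have d\<zeta>: "partials [b] \<zeta> y = - partials [b] (moll (r n)) (x - y)" for y
    proof -
      have "(moll (r n) has_derivative (\<lambda>h. grad (moll (r n)) (x - y) \<bullet> h)) (at (x - y))"
        by (rule has_derivative_grad[OF test_functionsD(4)[OF moll_test[OF r(1)]]])
      moreover have "((\<lambda>y. x - y) has_derivative (\<lambda>h. 0 - h)) (at y)"
        by (rule has_derivative_diff[OF has_derivative_const has_derivative_ident])
      ultimately have "(\<zeta> has_derivative (\<lambda>h. grad (moll (r n)) (x - y) \<bullet> (0 - h))) (at y)"
        unfolding \<zeta>_def by (rule has_derivative_compose[rotated])
      from frechet_derivative_at[OF this, symmetric] show ?thesis
        using b by (simp add: partials.simps(2)[of b "[]" \<zeta>] grad_inner)
    qed
    have "partials [b] (V n) x = (\<integral>y. partials [b] (moll (r n)) (x - y) * h y \<partial>lborel)"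
      using partials_conv[OF moll_test[OF r(1)] h(4) b] by (simp add: V_def conv_def)
    also have "\<dots> = - (\<integral>y. h y * partials [b] \<zeta> y \<partial>lborel)"
      by (simp add: d\<zeta> mult.commute)
    also have "(\<integral>y. h y * partials [b] \<zeta> y \<partial>lborel) = (\<integral>y. h y * partials [b] \<zeta> y \<partial>?M)"
      by (rule integral_lebesgue_on(1)[OF S(1), symmetric])
        (use h(1,2) test_functions_measurable[OF test_functions_partial[OF \<zeta> b]] in auto)
    also have "\<dots> = (\<integral>y. u y * partials [b] \<zeta> y \<partial>?M)"
    proof (rule integral_cong_AE)
      show "AE y in ?M. h y * partials [b] \<zeta> y = u y * partials [b] \<zeta> y" using h(3) by eventually_elim simp
    qed (use h(1) um test_functions_measurable[OF test_functions_partial[OF \<zeta> b]]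
          in \<open>auto intro!: borel_measurable_times intro: borel_measurable_lebesgue_onI\<close>)
    also have "\<dots> = - (\<integral>y. p b y * \<zeta> y \<partial>?M)"
      using w[OF b] \<zeta> by (simp add: has_weak_deriv_def)
    also have "(\<integral>y. p b y * \<zeta> y \<partial>?M) = (\<integral>y. k b y * \<zeta> y \<partial>?M)"
    proof (rule integral_cong_AE)
      show "AE y in ?M. p b y * \<zeta> y = k b y * \<zeta> y" using k(3)[OF b] by eventually_elim simp
      have "p b \<in> borel_measurable ?M" using p[OF b] by (simp add: L2_def)
      then show "(\<lambda>y. p b y * \<zeta> y) \<in> borel_measurable ?M" 
        by (intro borel_measurable_times borel_measurable_lebesgue_onI[OF test_functions_measurable[OF \<zeta>]])
    qed (intro borel_measurable_times borel_measurable_lebesgue_onI k(1) b test_functions_measurable[OF \<zeta>])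
    also have "\<dots> = (\<integral>y. k b y * \<zeta> y \<partial>lborel)"
      by (rule integral_lebesgue_on(1)[OF S(1)])
        (use k(1,2)[OF b] test_functions_measurable[OF \<zeta>] in auto)
    also have "\<dots> = W n b x" by (simp add: W_def conv_def \<zeta>_def mult.commute)
    finally show ?thesis by simp
  qed
  show ?thesis
  proof (rule that[of "\<lambda>n. V (s n)" "\<lambda>n. W (s n)"])
    show "AE x in ?M. (\<lambda>n. V (s n) x) \<longlonglongrightarrow> u x" using s(2) by (simp add: LIM_zero_iff)
    show "(\<lambda>n. \<integral>\<^sup>+x. ennreal ((W (s n) b x - p b x)\<^sup>2) \<partial>?M) \<longlonglongrightarrow> 0" if "b \<in> Basis" for b
      using LIMSEQ_subseq_LIMSEQ[OF Wlim[OF that] s(1)] by (simp add: o_def)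
  qed (use Vs part smooth_m[OF Ws] in auto)
qed

section \<open>Ladyzhenskaya's inequality\<close>

text \<open>Integral over the coordinate subspace spanned by \<open>I\<close>. The product measure
  over \<open>I\<close> allows any chosen coordinates to be integrated separately, without
  identifying the space with a product of spaces.\<close>

definition slice_integral :: "'a::euclidean_space set \<Rightarrow> ('a \<Rightarrow> ennreal) \<Rightarrow> ennreal" where
  "slice_integral I G = (\<integral>\<^sup>+x. G (\<Sum>b\<in>I. x b *\<^sub>R b) \<partial>(\<Pi>\<^sub>M b\<in>I. lborel :: real measure))"

lemma slice_integral_Basis:
  fixes G :: "'a::euclidean_space \<Rightarrow> ennreal"
  assumes "G \<in> borel_measurable borel"
  shows "slice_integral Basis G = (\<integral>\<^sup>+x. G x \<partial>lborel)"
  unfolding slice_integral_def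
  by (subst (2) lborel_eq) (use assms in \<open>auto intro!: nn_integral_distr[symmetric]\<close>)

lemma slice_measurable [measurable]:
  fixes G :: "'a::euclidean_space \<Rightarrow> ennreal"
  assumes [measurable]: "G \<in> borel_measurable borel"
  shows "(\<lambda>x. G (\<Sum>b\<in>I. x b *\<^sub>R b)) \<in> borel_measurable (\<Pi>\<^sub>M b\<in>I. lborel :: real measure)"
proof (rule measurable_compose[OF _ assms], rule borel_measurable_sum)
  fix b :: 'a assume "b \<in> I"
  then have "(\<lambda>x. x b) \<in> measurable (\<Pi>\<^sub>M b\<in>I. lborel :: real measure) lborel"
    by (rule measurable_component_singleton)
  then show "(\<lambda>x. x b *\<^sub>R b) \<in> borel_measurable (\<Pi>\<^sub>M b\<in>I. lborel :: real measure)"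
    by (intro borel_measurable_scaleR) auto
qed

lemma slice_integral_empty: "slice_integral {} G = G 0"
  by (simp add: slice_integral_def PiM_empty nn_integral_count_space_finite)

lemma slice_sum_insert:
  assumes "finite I" "i \<notin> I"
  shows "(\<Sum>b\<in>insert i I. (x(i := y)) b *\<^sub>R b) = y *\<^sub>R i + (\<Sum>b\<in>I. x b *\<^sub>R b)"
proof -
  have "(\<Sum>b\<in>I. (x(i := y)) b *\<^sub>R b) = (\<Sum>b\<in>I. x b *\<^sub>R b)"
    using assms(2) by (intro sum.cong) auto
  then show ?thesis using assms by (subst sum.insert) auto
qed

text \<open>Both orders of integration are needed: the new coordinate outermost for slicing into
  parallel planes, innermost where an integral along a line bounds a pointwise value.\<close>

lemma slice_integral_insert:
  fixes G :: "'a::euclidean_space \<Rightarrow> ennreal"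
  assumes G: "G \<in> borel_measurable borel" and I: "finite I" "i \<notin> I"
  shows "slice_integral (insert i I) G = (\<integral>\<^sup>+y. slice_integral I (\<lambda>v. G (y *\<^sub>R i + v)) \<partial>lborel)"
    "slice_integral (insert i I) G = slice_integral I (\<lambda>v. \<integral>\<^sup>+y. G (y *\<^sub>R i + v) \<partial>lborel)"
proof -
  interpret product_sigma_finite "\<lambda>_. lborel :: real measure" by standard
  show "slice_integral (insert i I) G = (\<integral>\<^sup>+y. slice_integral I (\<lambda>v. G (y *\<^sub>R i + v)) \<partial>lborel)"
    unfolding slice_integral_def
    by (subst product_nn_integral_insert_rev[OF I slice_measurable[OF G]]) (simp only: slice_sum_insert[OF I])
  show "slice_integral (insert i I) G = slice_integral I (\<lambda>v. \<integral>\<^sup>+y. G (y *\<^sub>R i + v) \<partial>lborel)"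
    unfolding slice_integral_def
    by (subst product_nn_integral_insert[OF I slice_measurable[OF G]]) (simp only: slice_sum_insert[OF I])
qed

lemma slice_integral_pair:
  fixes G :: "'a::euclidean_space \<Rightarrow> ennreal"
  assumes G: "G \<in> borel_measurable borel" and ne: "i \<noteq> j"
  shows "slice_integral {i, j} G = (\<integral>\<^sup>+s. \<integral>\<^sup>+t. G (s *\<^sub>R i + t *\<^sub>R j) \<partial>lborel \<partial>lborel)"
proof -
  have "slice_integral {i, j} G = (\<integral>\<^sup>+s. slice_integral {j} (\<lambda>v. G (s *\<^sub>R i + v)) \<partial>lborel)"
    using G ne by (intro slice_integral_insert) auto
  also have "\<dots> = (\<integral>\<^sup>+s. \<integral>\<^sup>+t. G (s *\<^sub>R i + t *\<^sub>R j) \<partial>lborel \<partial>lborel)"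
  proof (rule nn_integral_cong)
    fix s
    have "(\<lambda>v. G (s *\<^sub>R i + v)) \<in> borel_measurable borel" using G by measurable
    from slice_integral_insert(1)[OF this, of "{}" j]
    show "slice_integral {j} (\<lambda>v. G (s *\<^sub>R i + v)) = (\<integral>\<^sup>+t. G (s *\<^sub>R i + t *\<^sub>R j) \<partial>lborel)"
      by (simp add: slice_integral_empty)
  qed
  finally show ?thesis .
qed

lemma slice_integral_mono: "(\<And>x. F x \<le> G x) \<Longrightarrow> slice_integral I F \<le> slice_integral I G"
  unfolding slice_integral_def by (intro nn_integral_mono) auto

text \<open>Fundamental theorem of calculus for the square of \<phi> along a line, started at a
  point outside the support; the range of integration is then enlarged to the whole line, which
  removes the dependence on \<open>t\<close>.\<close>

lemma test_function_sq_le_line_integral: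
  fixes \<phi> :: "'a::euclidean_space \<Rightarrow> real"
  assumes \<phi>: "\<phi> \<in> test_functions S" and e: "e \<in> Basis"
  shows "ennreal ((\<phi> (x + t *\<^sub>R e))\<^sup>2) \<le> (\<integral>\<^sup>+s. ennreal \<bar>2 * \<phi> (x + s *\<^sub>R e) * partials [e] \<phi> (x + s *\<^sub>R e)\<bar> \<partial>lborel)"
proof -
  obtain R where R: "\<And>x. x \<in> closure {x. \<phi> x \<noteq> 0} \<Longrightarrow> norm x \<le> R"
    using compact_imp_bounded[OF test_functionsD(2)[OF \<phi>]] by (auto simp: bounded_iff)
  define F where "F s = (\<phi> (x + s *\<^sub>R e))\<^sup>2" for s
  define F' where "F' s = 2 * \<phi> (x + s *\<^sub>R e) * partials [e] \<phi> (x + s *\<^sub>R e)" for s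
  \<comment> \<open>So far out that |a| exceeds |x| + |R|, hence x + a e lies outside the ball of
    radius R containing the support, and not beyond \<open>t\<close>.\<close>
  define a where "a = min t (- (norm x + \<bar>R\<bar> + 1))"
  have "\<phi> (x + a *\<^sub>R e) = 0"
  proof (rule ccontr)
    assume "\<phi> (x + a *\<^sub>R e) \<noteq> 0"
    then have "norm (x + a *\<^sub>R e) \<le> R" using R closure_subset[of "{x. \<phi> x \<noteq> 0}"] by blast
    moreover have "\<bar>a\<bar> = norm (a *\<^sub>R e)" using e by simp
    moreover have "norm (a *\<^sub>R e) \<le> norm (x + a *\<^sub>R e) + norm x"
      using norm_triangle_ineq4[of "x + a *\<^sub>R e" x] by simp
    moreover have "\<bar>a\<bar> \<ge> norm x + \<bar>R\<bar> + 1" by (auto simp: a_def)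
    ultimately show False by linarith
  qed
  then have Fa: "F a = 0" by (simp add: F_def)
  have at: "a \<le> t" by (simp add: a_def)
  have "continuous_on UNIV F'"
    unfolding F'_def
    by (intro continuous_intros continuous_on_compose2[OF test_functionsD(5)[OF \<phi>, of UNIV]]
        continuous_on_compose2[OF test_functionsD(5)[OF test_functions_partial[OF \<phi> e], of UNIV]]) auto
  then have F'c: "isCont F' s" and cont: "continuous_on {a..t} F'" and F'm: "F' \<in> borel_measurable borel" for s
    by (auto intro: continuous_on_subset borel_measurable_continuous_onI continuous_at_imp_continuous_on simp: continuous_on_eq_continuous_at)
  have deriv: "(F has_real_derivative F' s) (at s)" for s
  proof -
    have "(\<phi> has_derivative (\<lambda>h. grad \<phi> (x + s *\<^sub>R e) \<bullet> h)) (at (x + s *\<^sub>R e))"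
      by (rule has_derivative_grad[OF test_functionsD(4)[OF \<phi>]])
    moreover have "((\<lambda>s. x + s *\<^sub>R e) has_derivative (\<lambda>h. h *\<^sub>R e)) (at s)"
      by (auto intro!: derivative_eq_intros)
    ultimately have "((\<lambda>s. \<phi> (x + s *\<^sub>R e)) has_derivative (\<lambda>h. grad \<phi> (x + s *\<^sub>R e) \<bullet> (h *\<^sub>R e))) (at s)"
      by (rule has_derivative_compose[rotated])
    then have "((\<lambda>s. \<phi> (x + s *\<^sub>R e)) has_real_derivative partials [e] \<phi> (x + s *\<^sub>R e)) (at s)"
      using e unfolding has_field_derivative_def by (simp add: grad_inner mult.commute[of _ "partials [e] \<phi> _"])
    from DERIV_power[OF this, of 2] show ?thesis by (simp add: F_def[abs_def] F'_def mult_ac)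
  qed
  have "(\<integral>s. indicator {a..t} s *\<^sub>R F' s \<partial>lborel) = F t - F a"
    using integral_FTC_Icc_real[OF at deriv F'c] by (simp add: mult.commute)
  then have "ennreal (F t) = ennreal (norm (\<integral>s. indicator {a..t} s *\<^sub>R F' s \<partial>lborel))"
    using Fa by (simp add: F_def)
  also have "\<dots> \<le> (\<integral>\<^sup>+s. ennreal (norm (indicator {a..t} s *\<^sub>R F' s)) \<partial>lborel)"
    by (rule integral_norm_bound_ennreal) (rule borel_integrable_compact[OF compact_Icc cont])
  also have "\<dots> \<le> (\<integral>\<^sup>+s. ennreal \<bar>F' s\<bar> \<partial>lborel)"
    by (intro nn_integral_mono) (auto simp: indicator_def)
  finally show ?thesis by (simp add: F_def F'_def)
qed

lemma ennreal_power2_le_imp_le: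
  fixes x y :: ennreal
  assumes "x\<^sup>2 \<le> y\<^sup>2" shows "x \<le> y"
proof (cases x; cases y)
  fix r s :: real assume "x = ennreal r" "0 \<le> r" "y = ennreal s" "0 \<le> s"
  then show ?thesis using assms by (auto simp: ennreal_power power2_le_iff_abs_le abs_le_square_iff[symmetric])
next
  fix s :: real assume "x = top" "y = ennreal s" "0 \<le> s"
  then show ?thesis using assms by (auto simp: ennreal_power top_unique power_eq_top_ennreal)
qed auto

text \<open>In the plane, the square of \<phi> at (s, t) is bounded by a line integral in direction
  \<open>i\<close>, which depends only on t, and by one in direction \<open>j\<close>, which depends
  only on s. Their product dominates the fourth power and integrates to a product of two plane
  integrals. The offset \<open>z\<close> admits planes not through the origin.\<close>

lemma ladyzhenskaya_slice:
  fixes \<phi> :: "'a::euclidean_space \<Rightarrow> real"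
  assumes \<phi>: "\<phi> \<in> test_functions S" and ij: "i \<in> Basis" "j \<in> Basis" "i \<noteq> j"
  shows "slice_integral {i, j} (\<lambda>v. ennreal (\<phi> (z + v) ^ 4)) \<le>
    slice_integral {i, j} (\<lambda>v. ennreal \<bar>2 * \<phi> (z + v) * partials [i] \<phi> (z + v)\<bar>) *
    slice_integral {i, j} (\<lambda>v. ennreal \<bar>2 * \<phi> (z + v) * partials [j] \<phi> (z + v)\<bar>)"
proof -
  have [measurable]: "\<phi> \<in> borel_measurable borel" by (rule test_functions_measurable[OF \<phi>])
  have [measurable]: "partials [i] \<phi> \<in> borel_measurable borel" "partials [j] \<phi> \<in> borel_measurable borel"
    using test_functions_measurable[OF test_functions_partial[OF \<phi>]] ij by auto
  define A where "A t = (\<integral>\<^sup>+s. ennreal \<bar>2 * \<phi> (z + (t *\<^sub>R j + s *\<^sub>R i)) * partials [i] \<phi> (z + (t *\<^sub>R j + s *\<^sub>R i))\<bar> \<partial>lborel)" for t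
  define B where "B s = (\<integral>\<^sup>+t. ennreal \<bar>2 * \<phi> (z + (s *\<^sub>R i + t *\<^sub>R j)) * partials [j] \<phi> (z + (s *\<^sub>R i + t *\<^sub>R j))\<bar> \<partial>lborel)" for s
  have [measurable]: "A \<in> borel_measurable borel" "B \<in> borel_measurable borel"
    unfolding A_def B_def by measurable
  have "slice_integral {i, j} (\<lambda>v. ennreal (\<phi> (z + v) ^ 4)) =
     (\<integral>\<^sup>+s. \<integral>\<^sup>+t. ennreal (\<phi> (z + (s *\<^sub>R i + t *\<^sub>R j)) ^ 4) \<partial>lborel \<partial>lborel)"
    by (rule slice_integral_pair) (use ij in auto)
  also have "\<dots> \<le> (\<integral>\<^sup>+s. \<integral>\<^sup>+t. A t * B s \<partial>lborel \<partial>lborel)"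
  proof (intro nn_integral_mono)
    fix s t :: real
    have "ennreal ((\<phi> (z + (s *\<^sub>R i + t *\<^sub>R j)))\<^sup>2) \<le> A t"
      using test_function_sq_le_line_integral[OF \<phi> ij(1), of "z + t *\<^sub>R j" s] by (simp add: A_def add_ac)
    moreover have "ennreal ((\<phi> (z + (s *\<^sub>R i + t *\<^sub>R j)))\<^sup>2) \<le> B s"
      using test_function_sq_le_line_integral[OF \<phi> ij(2), of "z + s *\<^sub>R i" t] by (simp add: B_def add_ac)
    ultimately have "ennreal ((\<phi> (z + (s *\<^sub>R i + t *\<^sub>R j)))\<^sup>2) * ennreal ((\<phi> (z + (s *\<^sub>R i + t *\<^sub>R j)))\<^sup>2) \<le> A t * B s"
      by (intro mult_mono) auto
    then show "ennreal (\<phi> (z + (s *\<^sub>R i + t *\<^sub>R j)) ^ 4) \<le> A t * B s"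
      by (simp add: ennreal_mult[symmetric] power_add[symmetric])
  qed
  also have "\<dots> = (\<integral>\<^sup>+t. A t \<partial>lborel) * (\<integral>\<^sup>+s. B s \<partial>lborel)"
    by (simp add: nn_integral_multc nn_integral_cmult)
  also have "(\<integral>\<^sup>+t. A t \<partial>lborel) = slice_integral {j, i} (\<lambda>v. ennreal \<bar>2 * \<phi> (z + v) * partials [i] \<phi> (z + v)\<bar>)"
    unfolding A_def by (rule slice_integral_pair[symmetric]) (use ij in auto)
  also have "(\<integral>\<^sup>+s. B s \<partial>lborel) = slice_integral {i, j} (\<lambda>v. ennreal \<bar>2 * \<phi> (z + v) * partials [j] \<phi> (z + v)\<bar>)"
    unfolding B_def by (rule slice_integral_pair[symmetric]) (use ij in auto)
  finally show ?thesis by (simp add: insert_commute)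
qed

lemma two_mult_le_sq: "ennreal \<bar>2 * a * b\<bar> \<le> ennreal (a\<^sup>2) + ennreal (b\<^sup>2)"
proof -
  have "0 \<le> (\<bar>a\<bar> - \<bar>b\<bar>)\<^sup>2" by simp
  then have "\<bar>2 * a * b\<bar> \<le> a\<^sup>2 + b\<^sup>2" by (simp add: power2_eq_square algebra_simps abs_mult)
  then show ?thesis by (simp add: ennreal_plus[symmetric] ennreal_leI del: ennreal_plus)
qed

text \<open>The plane is the whole space here, and 2|ab| \<le> a^2 + b^2 bounds each of the two
  factors by the squared H^1 norm.\<close>

lemma sobolev_L4_dim2:
  fixes \<phi> :: "'a::euclidean_space \<Rightarrow> real"
  assumes \<phi>: "\<phi> \<in> test_functions S" and d: "DIM('a) = 2"
  shows "(\<integral>\<^sup>+x. ennreal (\<phi> x ^ 4) \<partial>lborel) \<le>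
    ((\<integral>\<^sup>+x. ennreal ((\<phi> x)\<^sup>2) \<partial>lborel) + (\<Sum>b\<in>Basis. \<integral>\<^sup>+x. ennreal ((partials [b] \<phi> x)\<^sup>2) \<partial>lborel))\<^sup>2"
    (is "_ \<le> ?E\<^sup>2")
proof -
  obtain i j :: 'a where B: "Basis = {i, j}" "i \<noteq> j" using d unfolding card_2_iff by blast
  have ij: "i \<in> Basis" "j \<in> Basis" using B by auto
  have [measurable]: "\<phi> \<in> borel_measurable borel" by (rule test_functions_measurable[OF \<phi>])
  have m [measurable]: "partials [b] \<phi> \<in> borel_measurable borel" if "b \<in> Basis" for b
    using test_functions_measurable[OF test_functions_partial[OF \<phi> that]] .
  have le: "slice_integral Basis (\<lambda>v. ennreal \<bar>2 * \<phi> (0 + v) * partials [b] \<phi> (0 + v)\<bar>) \<le> ?E" if b: "b \<in> Basis" for b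
  proof -
    note [measurable] = m[OF b]
    have "slice_integral Basis (\<lambda>v. ennreal \<bar>2 * \<phi> (0 + v) * partials [b] \<phi> (0 + v)\<bar>) =
      (\<integral>\<^sup>+v. ennreal \<bar>2 * \<phi> v * partials [b] \<phi> v\<bar> \<partial>lborel)"
      by (subst slice_integral_Basis) auto
    also have "\<dots> \<le> (\<integral>\<^sup>+v. ennreal ((\<phi> v)\<^sup>2) + ennreal ((partials [b] \<phi> v)\<^sup>2) \<partial>lborel)"
      by (intro nn_integral_mono two_mult_le_sq)
    also have "\<dots> = (\<integral>\<^sup>+v. ennreal ((\<phi> v)\<^sup>2) \<partial>lborel) + (\<integral>\<^sup>+v. ennreal ((partials [b] \<phi> v)\<^sup>2) \<partial>lborel)"
      by (rule nn_integral_add) auto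
    also have "\<dots> \<le> ?E"
      using b by (intro add_left_mono member_le_sum) auto
    finally show ?thesis .
  qed
  have "(\<integral>\<^sup>+x. ennreal (\<phi> x ^ 4) \<partial>lborel) = slice_integral {i, j} (\<lambda>v. ennreal (\<phi> (0 + v) ^ 4))"
    unfolding B(1)[symmetric] by (subst slice_integral_Basis) auto
  also have "\<dots> \<le> ?E * ?E"
    by (rule order_trans[OF ladyzhenskaya_slice[OF \<phi> ij B(2)]])
      (unfold B(1)[symmetric], intro mult_mono le ij, auto)
  finally show ?thesis by (simp add: power2_eq_square)
qed

lemma slice_integral_Cauchy_Schwarz:
  fixes f g :: "'a::euclidean_space \<Rightarrow> real"
  assumes [measurable]: "f \<in> borel_measurable borel" "g \<in> borel_measurable borel"
  shows "(slice_integral I (\<lambda>v. ennreal \<bar>2 * f v * g v\<bar>))\<^sup>2 \<le>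
    4 * (slice_integral I (\<lambda>v. ennreal ((f v)\<^sup>2)) * slice_integral I (\<lambda>v. ennreal ((g v)\<^sup>2)))"
proof -
  let ?M = "\<Pi>\<^sub>M b\<in>I. lborel :: real measure" and ?s = "\<lambda>x. \<Sum>b\<in>I. x b *\<^sub>R b"
  have [measurable]: "(\<lambda>x. ennreal \<bar>f (?s x)\<bar>) \<in> borel_measurable ?M" "(\<lambda>x. ennreal \<bar>g (?s x)\<bar>) \<in> borel_measurable ?M"
    by (rule slice_measurable[of "\<lambda>v. ennreal \<bar>f v\<bar>" I] slice_measurable[of "\<lambda>v. ennreal \<bar>g v\<bar>" I], measurable)+
  have "slice_integral I (\<lambda>v. ennreal \<bar>2 * f v * g v\<bar>) = (\<integral>\<^sup>+x. 2 * (ennreal \<bar>f (?s x)\<bar> * ennreal \<bar>g (?s x)\<bar>) \<partial>?M)"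
    unfolding slice_integral_def by (simp add: abs_mult ennreal_mult mult.assoc)
  also have "\<dots> = 2 * (\<integral>\<^sup>+x. ennreal \<bar>f (?s x)\<bar> * ennreal \<bar>g (?s x)\<bar> \<partial>?M)"
    by (rule nn_integral_cmult) measurable
  also have "\<dots>\<^sup>2 = 4 * (\<integral>\<^sup>+x. ennreal \<bar>f (?s x)\<bar> * ennreal \<bar>g (?s x)\<bar> \<partial>?M)\<^sup>2"
    by (simp add: power_mult_distrib)
  also have "\<dots> \<le> 4 * ((\<integral>\<^sup>+x. ennreal \<bar>f (?s x)\<bar> ^ 2 \<partial>?M) * (\<integral>\<^sup>+x. ennreal \<bar>g (?s x)\<bar> ^ 2 \<partial>?M))"
    by (intro mult_left_mono Cauchy_Schwarz_nn_integral) auto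
  finally show ?thesis by (simp add: slice_integral_def ennreal_power)
qed

text \<open>Planes orthogonal to \<open>k\<close> are treated by the planar inequality and
  Cauchy-Schwarz. The mass of the square of \<phi> on a plane is bounded uniformly in its height by
  a line integral in direction \<open>k\<close>, so only one factor still depends on the height, and
  it integrates to at most the squared H^1 norm.\<close>

lemma sobolev_L4_dim3:
  fixes \<phi> :: "'a::euclidean_space \<Rightarrow> real"
  assumes \<phi>: "\<phi> \<in> test_functions S" and d: "DIM('a) = 3"
  shows "(\<integral>\<^sup>+x. ennreal (\<phi> x ^ 4) \<partial>lborel) \<le>
    4 * ((\<integral>\<^sup>+x. ennreal ((\<phi> x)\<^sup>2) \<partial>lborel) + (\<Sum>b\<in>Basis. \<integral>\<^sup>+x. ennreal ((partials [b] \<phi> x)\<^sup>2) \<partial>lborel))\<^sup>2"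
    (is "_ \<le> 4 * ?E\<^sup>2")
proof -
  obtain k i j :: 'a where B: "Basis = {k, i, j}" and ne: "k \<noteq> i" "k \<noteq> j" "i \<noteq> j"
    using d unfolding card_3_iff by blast
  have kij: "k \<in> Basis" "i \<in> Basis" "j \<in> Basis" using B by auto
  have [measurable]: "\<phi> \<in> borel_measurable borel" by (rule test_functions_measurable[OF \<phi>])
  have m: "partials [b] \<phi> \<in> borel_measurable borel" if "b \<in> Basis" for b
    using test_functions_measurable[OF test_functions_partial[OF \<phi> that]] .
  note [measurable] = m[OF kij(1)] m[OF kij(2)] m[OF kij(3)]
  let ?J = "slice_integral {i, j}"
  let ?D = "\<lambda>b. \<integral>\<^sup>+x. ennreal ((partials [b] \<phi> x)\<^sup>2) \<partial>lborel"
  have total: "(\<integral>\<^sup>+x. G x \<partial>lborel) = (\<integral>\<^sup>+r. ?J (\<lambda>v. G (r *\<^sub>R k + v)) \<partial>lborel)"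
    "(\<integral>\<^sup>+x. G x \<partial>lborel) = ?J (\<lambda>v. \<integral>\<^sup>+r. G (r *\<^sub>R k + v) \<partial>lborel)"
    if "G \<in> borel_measurable borel" for G :: "'a \<Rightarrow> ennreal"
    using slice_integral_Basis[OF that] slice_integral_insert[OF that, of "{i, j}" k] ne
    unfolding B by auto
  \<comment> \<open>\<open>a r\<close> and \<open>p b r\<close> are the squared L^2 norms of \<phi>
    and of its partial derivative on the plane at height \<open>r\<close>.\<close>
  define a where "a r = ?J (\<lambda>v. ennreal ((\<phi> (r *\<^sub>R k + v))\<^sup>2))" for r
  define p where "p b r = ?J (\<lambda>v. ennreal ((partials [b] \<phi> (r *\<^sub>R k + v))\<^sup>2))" for b r
  have E: "?E = (\<integral>\<^sup>+x. ennreal ((\<phi> x)\<^sup>2) \<partial>lborel) + (?D k + (?D i + ?D j))"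
    using ne unfolding B by simp
  have aE: "a r \<le> ?E" for r
  proof -
    have "a r \<le> ?J (\<lambda>v. \<integral>\<^sup>+s. ennreal ((\<phi> (s *\<^sub>R k + v))\<^sup>2) + ennreal ((partials [k] \<phi> (s *\<^sub>R k + v))\<^sup>2) \<partial>lborel)"
      unfolding a_def
    proof (rule slice_integral_mono)
      fix v
      have "ennreal ((\<phi> (r *\<^sub>R k + v))\<^sup>2) \<le> (\<integral>\<^sup>+s. ennreal \<bar>2 * \<phi> (s *\<^sub>R k + v) * partials [k] \<phi> (s *\<^sub>R k + v)\<bar> \<partial>lborel)"
        using test_function_sq_le_line_integral[OF \<phi> kij(1), of v r] by (simp add: add.commute)
      also have "\<dots> \<le> (\<integral>\<^sup>+s. ennreal ((\<phi> (s *\<^sub>R k + v))\<^sup>2) + ennreal ((partials [k] \<phi> (s *\<^sub>R k + v))\<^sup>2) \<partial>lborel)"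
        by (intro nn_integral_mono two_mult_le_sq)
      finally show "ennreal ((\<phi> (r *\<^sub>R k + v))\<^sup>2) \<le> \<dots>" .
    qed
    also have "\<dots> = (\<integral>\<^sup>+x. ennreal ((\<phi> x)\<^sup>2) + ennreal ((partials [k] \<phi> x)\<^sup>2) \<partial>lborel)"
      by (rule total(2)[symmetric]) measurable
    also have "\<dots> = (\<integral>\<^sup>+x. ennreal ((\<phi> x)\<^sup>2) \<partial>lborel) + ?D k"
      by (rule nn_integral_add) auto
    also have "\<dots> \<le> ?E" unfolding E by (intro add_left_mono) simp
    finally show ?thesis .
  qed
  \<comment> \<open>As an integral over a product measure \<open>p b\<close> hides its dependence on
    the height; rewritten as an iterated integral it is visibly measurable.\<close>
  have pm [measurable]: "p b \<in> borel_measurable borel" if "b \<in> {i, j}" for b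
  proof -
    note [measurable] = m[of b]
    have "b \<in> Basis" using that kij by auto
    then have "p b r = (\<integral>\<^sup>+s. \<integral>\<^sup>+t. ennreal ((partials [b] \<phi> (r *\<^sub>R k + (s *\<^sub>R i + t *\<^sub>R j)))\<^sup>2) \<partial>lborel \<partial>lborel)" for r
      unfolding p_def by (intro slice_integral_pair ne(3)) measurable
    moreover have "(\<lambda>r. \<integral>\<^sup>+s. \<integral>\<^sup>+t. ennreal ((partials [b] \<phi> (r *\<^sub>R k + (s *\<^sub>R i + t *\<^sub>R j)))\<^sup>2) \<partial>lborel \<partial>lborel) \<in> borel_measurable borel"
      using \<open>b \<in> Basis\<close> by measurable
    ultimately show ?thesis by presburger
  qed
  have slice: "?J (\<lambda>v. ennreal (\<phi> (r *\<^sub>R k + v) ^ 4)) \<le> 4 * (?E * (p i r + p j r))" for r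
  proof -
    let ?X = "\<lambda>b. ?J (\<lambda>v. ennreal \<bar>2 * \<phi> (r *\<^sub>R k + v) * partials [b] \<phi> (r *\<^sub>R k + v)\<bar>)"
    have X: "(?X b)\<^sup>2 \<le> 4 * (a r * (p i r + p j r))" if b: "b \<in> {i, j}" for b
    proof -
      have "b \<in> Basis" using b kij by auto
      note [measurable] = m[OF this]
      have "(?X b)\<^sup>2 \<le> 4 * (a r * p b r)"
        unfolding a_def p_def by (rule slice_integral_Cauchy_Schwarz) measurable
      also have "\<dots> \<le> 4 * (a r * (p i r + p j r))"
        using b by (intro mult_left_mono) auto
      finally show ?thesis .
    qed
    have "?X i * ?X j \<le> 4 * (a r * (p i r + p j r))"
    \<comment> \<open>Each factor has its square below one common bound, so the squared product is
      below the square of that bound.\<close>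
    proof (rule ennreal_power2_le_imp_le)
      have "(?X i * ?X j)\<^sup>2 = (?X i)\<^sup>2 * (?X j)\<^sup>2" by (rule power_mult_distrib)
      also have "\<dots> \<le> (4 * (a r * (p i r + p j r))) * (4 * (a r * (p i r + p j r)))"
        by (intro mult_mono X) auto
      finally show "(?X i * ?X j)\<^sup>2 \<le> (4 * (a r * (p i r + p j r)))\<^sup>2" by (simp only: power2_eq_square)
    qed
    also have "\<dots> \<le> 4 * (?E * (p i r + p j r))"
      by (intro mult_left_mono mult_right_mono aE) auto
    finally show ?thesis
      using order_trans[OF ladyzhenskaya_slice[OF \<phi> kij(2,3) ne(3)]] by blast
  qed
  have "(\<integral>\<^sup>+x. ennreal (\<phi> x ^ 4) \<partial>lborel) = (\<integral>\<^sup>+r. ?J (\<lambda>v. ennreal (\<phi> (r *\<^sub>R k + v) ^ 4)) \<partial>lborel)"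
    by (rule total(1)) measurable
  also have "\<dots> \<le> (\<integral>\<^sup>+r. 4 * (?E * (p i r + p j r)) \<partial>lborel)"
    by (intro nn_integral_mono slice)
  also have "\<dots> = 4 * (?E * ((\<integral>\<^sup>+r. p i r \<partial>lborel) + (\<integral>\<^sup>+r. p j r \<partial>lborel)))"
    by (simp add: nn_integral_cmult nn_integral_add)
  also have "(\<integral>\<^sup>+r. p i r \<partial>lborel) = ?D i"
    unfolding p_def by (rule total(1)[symmetric]) measurable
  also have "(\<integral>\<^sup>+r. p j r \<partial>lborel) = ?D j"
    unfolding p_def by (rule total(1)[symmetric]) measurable
  also have "4 * (?E * (?D i + ?D j)) \<le> 4 * (?E * ?E)"
    unfolding E by (intro mult_left_mono) (auto simp: add.assoc intro: add_increasing)
  finally show ?thesis by (simp only: power2_eq_square)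
qed

lemma sobolev_L4:
  fixes \<phi> :: "'a::euclidean_space \<Rightarrow> real"
  assumes \<phi>: "\<phi> \<in> test_functions S" and d: "DIM('a) = 2 \<or> DIM('a) = 3"
  shows "(\<integral>\<^sup>+x. ennreal (\<phi> x ^ 4) \<partial>lborel) \<le>
    4 * ((\<integral>\<^sup>+x. ennreal ((\<phi> x)\<^sup>2) \<partial>lborel) + (\<Sum>b\<in>Basis. \<integral>\<^sup>+x. ennreal ((partials [b] \<phi> x)\<^sup>2) \<partial>lborel))\<^sup>2"
    (is "_ \<le> 4 * ?E\<^sup>2")
proof -
  have "1 * ?E\<^sup>2 \<le> 4 * ?E\<^sup>2" by (intro mult_right_mono) auto
  then show ?thesis using sobolev_L4_dim2[OF \<phi>] sobolev_L4_dim3[OF \<phi>] d by (auto intro: order_trans)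
qed

section \<open>Square-integrable functions\<close>

lemma L2_measurable: "f \<in> L2 M \<Longrightarrow> f \<in> borel_measurable M"
  by (simp add: L2_def)

lemma L2_nn_integral:
  assumes "f \<in> L2 M"
  shows "(\<integral>\<^sup>+x. ennreal ((f x)\<^sup>2) \<partial>M) = ennreal ((L2_norm M f)\<^sup>2)"
  using assms by (subst nn_integral_eq_integral) (auto simp: L2_def L2_norm_def)

lemma L2I_nn_integral:
  assumes "f \<in> borel_measurable M" "(\<integral>\<^sup>+x. ennreal ((f x)\<^sup>2) \<partial>M) < \<infinity>"
  shows "f \<in> L2 M"
  unfolding L2_def using assms by (auto intro!: integrableI_nonneg)

lemma L2_norm_nonneg: "0 \<le> L2_norm M f"
  by (simp add: L2_norm_def)

lemma L2_Cauchy_Schwarz: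
  assumes f: "f \<in> L2 M" and g: "g \<in> L2 M"
  shows "integrable M (\<lambda>x. f x * g x)" "(\<integral>x. \<bar>f x * g x\<bar> \<partial>M) \<le> L2_norm M f * L2_norm M g"
    "\<bar>\<integral>x. f x * g x \<partial>M\<bar> \<le> L2_norm M f * L2_norm M g"
proof -
  have [measurable]: "f \<in> borel_measurable M" "g \<in> borel_measurable M" using f g by (auto simp: L2_def)
  have "(\<integral>\<^sup>+x. ennreal \<bar>f x\<bar> * ennreal \<bar>g x\<bar> \<partial>M)\<^sup>2 \<le>
      (\<integral>\<^sup>+x. ennreal \<bar>f x\<bar> ^ 2 \<partial>M) * (\<integral>\<^sup>+x. ennreal \<bar>g x\<bar> ^ 2 \<partial>M)"
    by (rule Cauchy_Schwarz_nn_integral) auto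
  then have "(\<integral>\<^sup>+x. ennreal \<bar>f x * g x\<bar> \<partial>M)\<^sup>2 \<le> ennreal ((L2_norm M f)\<^sup>2) * ennreal ((L2_norm M g)\<^sup>2)"
    by (simp add: L2_nn_integral[OF f, symmetric] L2_nn_integral[OF g, symmetric] ennreal_power abs_mult ennreal_mult)
  also have "\<dots> = (ennreal (L2_norm M f * L2_norm M g))\<^sup>2"
    by (simp add: ennreal_mult[symmetric] ennreal_power L2_norm_nonneg power_mult_distrib)
  finally have le: "(\<integral>\<^sup>+x. ennreal \<bar>f x * g x\<bar> \<partial>M) \<le> ennreal (L2_norm M f * L2_norm M g)"
    by (rule ennreal_power2_le_imp_le)
  show i: "integrable M (\<lambda>x. f x * g x)"
    by (rule integrableI_bounded) (use le_less_trans[OF le] in auto)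
  have "ennreal (\<integral>x. \<bar>f x * g x\<bar> \<partial>M) \<le> ennreal (L2_norm M f * L2_norm M g)"
    using le i by (subst nn_integral_eq_integral[symmetric]) auto
  then show le': "(\<integral>x. \<bar>f x * g x\<bar> \<partial>M) \<le> L2_norm M f * L2_norm M g"
    by (simp add: L2_norm_nonneg)
  show "\<bar>\<integral>x. f x * g x \<partial>M\<bar> \<le> L2_norm M f * L2_norm M g"
    using order_trans[OF integral_abs_bound le'] .
qed

lemma L2_add:
  assumes f: "f \<in> L2 M" and g: "g \<in> L2 M"
  shows "(\<lambda>x. f x + g x) \<in> L2 M"
proof -
  have "(\<lambda>x. (f x + g x)\<^sup>2) = (\<lambda>x. (f x)\<^sup>2 + 2 * (f x * g x) + (g x)\<^sup>2)"
    by (simp add: fun_eq_iff power2_eq_square algebra_simps)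
  then show ?thesis using assms L2_Cauchy_Schwarz(1)[OF f g] by (auto simp: L2_def)
qed

lemma L2_cmult: "f \<in> L2 M \<Longrightarrow> (\<lambda>x. c * f x) \<in> L2 M"
  by (auto simp: L2_def power_mult_distrib)

lemma L2_diff: "f \<in> L2 M \<Longrightarrow> g \<in> L2 M \<Longrightarrow> (\<lambda>x. f x - g x) \<in> L2 M"
  using L2_add[of f M "\<lambda>x. -1 * g x"] L2_cmult[of g M "-1"] by simp

lemma L2_bounded:
  assumes f: "f \<in> L2 M" and g [measurable]: "g \<in> borel_measurable M" and le: "AE x in M. \<bar>g x\<bar> \<le> C * \<bar>f x\<bar>"
  shows "g \<in> L2 M"
proof -
  have "integrable M (\<lambda>x. C\<^sup>2 * (f x)\<^sup>2)" using f by (auto simp: L2_def)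
  then have "integrable M (\<lambda>x. (g x)\<^sup>2)"
  proof (rule Bochner_Integration.integrable_bound)
    show "AE x in M. norm ((g x)\<^sup>2) \<le> norm (C\<^sup>2 * (f x)\<^sup>2)"
      using le
    proof eventually_elim
      case (elim x)
      then have "\<bar>g x\<bar>\<^sup>2 \<le> (C * \<bar>f x\<bar>)\<^sup>2" by (intro power_mono) auto
      then show ?case by (simp add: power_mult_distrib)
    qed
  qed measurable
  then show ?thesis by (simp add: L2_def)
qed

lemma L2_norm_le:
  assumes f: "f \<in> L2 M" and g: "g \<in> L2 M" and le: "AE x in M. \<bar>g x\<bar> \<le> C * \<bar>f x\<bar>" and C: "C \<ge> 0"
  shows "L2_norm M g \<le> C * L2_norm M f"
proof -
  have "(\<integral>x. (g x)\<^sup>2 \<partial>M) \<le> (\<integral>x. C\<^sup>2 * (f x)\<^sup>2 \<partial>M)"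
  proof (rule integral_mono_AE)
    show "AE x in M. (g x)\<^sup>2 \<le> C\<^sup>2 * (f x)\<^sup>2"
      using le
    proof eventually_elim
      case (elim x)
      then have "\<bar>g x\<bar>\<^sup>2 \<le> (C * \<bar>f x\<bar>)\<^sup>2" by (intro power_mono) auto
      then show ?case by (simp add: power_mult_distrib)
    qed
  qed (use f g in \<open>auto simp: L2_def\<close>)
  then have "sqrt (\<integral>x. (g x)\<^sup>2 \<partial>M) \<le> sqrt (C\<^sup>2 * (\<integral>x. (f x)\<^sup>2 \<partial>M))" by simp
  then show ?thesis using C by (simp add: L2_norm_def real_sqrt_mult)
qed

section \<open>Limits of integrals of products\<close>

lemma integral_bounded_mult_tendsto:
  fixes f g :: "'a \<Rightarrow> real" and G :: "nat \<Rightarrow> 'a \<Rightarrow> real"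
  assumes f: "integrable M f" and [measurable]: "\<And>n. G n \<in> borel_measurable M" "g \<in> borel_measurable M"
    and bd: "\<And>n. AE x in M. \<bar>G n x\<bar> \<le> C" and lim: "AE x in M. (\<lambda>n. G n x) \<longlonglongrightarrow> g x"
  shows "(\<lambda>n. \<integral>x. f x * G n x \<partial>M) \<longlonglongrightarrow> (\<integral>x. f x * g x \<partial>M)" "integrable M (\<lambda>x. f x * G n x)"
proof -
  have [measurable]: "f \<in> borel_measurable M" using f by auto
  have i: "integrable M (\<lambda>x. C * \<bar>f x\<bar>)" using f by auto
  have b: "AE x in M. norm (f x * G n x) \<le> C * \<bar>f x\<bar>" for n
    using bd[of n] by eventually_elim (simp add: abs_mult mult.commute[of C] mult_left_mono)
  show "(\<lambda>n. \<integral>x. f x * G n x \<partial>M) \<longlonglongrightarrow> (\<integral>x. f x * g x \<partial>M)"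
  proof (rule integral_dominated_convergence[OF _ _ i _ b])
    show "AE x in M. (\<lambda>n. f x * G n x) \<longlonglongrightarrow> f x * g x"
      using lim by eventually_elim (intro tendsto_intros)
  qed measurable
  show "integrable M (\<lambda>x. f x * G n x)"
  proof (rule Bochner_Integration.integrable_bound[OF i])
    show "AE x in M. norm (f x * G n x) \<le> norm (C * \<bar>f x\<bar>)"
      using b[of n] by eventually_elim simp
  qed measurable
qed

text \<open>Split \<open>Q n\<close> into \<open>Q n - p\<close> and \<open>p\<close>. The first
  part tends to 0 by Cauchy-Schwarz, as \<open>w\<close> times \<open>G n\<close> stays bounded in
  L^2; the second converges by domination. Since the difference may fail to be square integrable for
  early n, integrability is claimed only eventually.\<close>

lemma integral_L2_mult_tendsto:
  fixes f w :: "'a \<Rightarrow> real" and Q :: "nat \<Rightarrow> 'a \<Rightarrow> real"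
  assumes w: "w \<in> L2 M" and p: "p \<in> L2 M" and G [measurable]: "\<And>n. G n \<in> borel_measurable M" "g \<in> borel_measurable M"
    and bd: "\<And>n. AE x in M. \<bar>G n x\<bar> \<le> C" and lim: "AE x in M. (\<lambda>n. G n x) \<longlonglongrightarrow> g x"
    and Q [measurable]: "\<And>n. Q n \<in> borel_measurable M"
    and Qlim: "(\<lambda>n. \<integral>\<^sup>+x. ennreal ((Q n x - p x)\<^sup>2) \<partial>M) \<longlonglongrightarrow> 0"
  shows "(\<lambda>n. \<integral>x. w x * G n x * Q n x \<partial>M) \<longlonglongrightarrow> (\<integral>x. w x * g x * p x \<partial>M)"
    "\<forall>\<^sub>F n in sequentially. integrable M (\<lambda>x. w x * G n x * Q n x)"
proof -
  have [measurable]: "w \<in> borel_measurable M" "p \<in> borel_measurable M" using w p by (auto simp: L2_def)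
  have wG: "(\<lambda>x. w x * G n x) \<in> L2 M" "L2_norm M (\<lambda>x. w x * G n x) \<le> \<bar>C\<bar> * L2_norm M w" for n
  proof -
    have *: "AE x in M. \<bar>w x * G n x\<bar> \<le> \<bar>C\<bar> * \<bar>w x\<bar>"
      using bd[of n]
    proof eventually_elim
      case (elim x)
      then have "\<bar>w x\<bar> * \<bar>G n x\<bar> \<le> \<bar>w x\<bar> * \<bar>C\<bar>" by (intro mult_left_mono) auto
      then show ?case by (simp add: abs_mult mult.commute)
    qed
    show 1: "(\<lambda>x. w x * G n x) \<in> L2 M" by (rule L2_bounded[OF w _ *]) measurable
    show "L2_norm M (\<lambda>x. w x * G n x) \<le> \<bar>C\<bar> * L2_norm M w" by (rule L2_norm_le[OF w 1 *]) simp
  qed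
  have ev: "\<forall>\<^sub>F n in sequentially. (\<lambda>x. Q n x - p x) \<in> L2 M"
    using order_tendstoD(2)[OF Qlim, of \<infinity>]
    by (auto elim!: eventually_mono intro!: L2I_nn_integral)
  have main: "\<forall>\<^sub>F n in sequentially. integrable M (\<lambda>x. w x * G n x * Q n x) \<and>
      (\<integral>x. w x * G n x * Q n x \<partial>M) = (\<integral>x. (w x * G n x) * (Q n x - p x) \<partial>M) + (\<integral>x. (w x * p x) * G n x \<partial>M)"
    using ev
  proof eventually_elim
    case (elim n)
    have eq: "(\<lambda>x. w x * G n x * Q n x) = (\<lambda>x. (w x * G n x) * (Q n x - p x) + (w x * p x) * G n x)"
      by (simp add: fun_eq_iff algebra_simps)
    have "integrable M (\<lambda>x. (w x * p x) * G n x)"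
      using L2_Cauchy_Schwarz(1)[OF wG(1)[of n] p] by (simp add: mult_ac)
    then show ?case unfolding eq using L2_Cauchy_Schwarz(1)[OF wG(1) elim] by simp
  qed
  then show "\<forall>\<^sub>F n in sequentially. integrable M (\<lambda>x. w x * G n x * Q n x)"
    by eventually_elim simp
  have "(\<lambda>n. \<integral>x. (w x * G n x) * (Q n x - p x) \<partial>M) \<longlonglongrightarrow> 0"
  proof (rule Lim_null_comparison)
    show "\<forall>\<^sub>F n in sequentially. norm (\<integral>x. (w x * G n x) * (Q n x - p x) \<partial>M) \<le>
        \<bar>C\<bar> * L2_norm M w * L2_norm M (\<lambda>x. Q n x - p x)"
      using ev
    proof eventually_elim
      case (elim n)
      show ?case
        using order_trans[OF L2_Cauchy_Schwarz(3)[OF wG(1) elim] mult_right_mono[OF wG(2) L2_norm_nonneg]] by simp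
    qed
    have "(\<lambda>n. L2_norm M (\<lambda>x. Q n x - p x)) \<longlonglongrightarrow> sqrt 0"
      unfolding L2_norm_def
    proof (rule tendsto_real_sqrt)
      have "(\<lambda>n. enn2real (\<integral>\<^sup>+x. ennreal ((Q n x - p x)\<^sup>2) \<partial>M)) \<longlonglongrightarrow> 0"
        by (rule tendsto_enn2real) (use Qlim in simp_all)
      then show "(\<lambda>n. \<integral>x. (Q n x - p x)\<^sup>2 \<partial>M) \<longlonglongrightarrow> 0"
        by (subst integral_eq_nn_integral) auto
    qed
    then have "(\<lambda>n. \<bar>C\<bar> * L2_norm M w * L2_norm M (\<lambda>x. Q n x - p x)) \<longlonglongrightarrow> \<bar>C\<bar> * L2_norm M w * sqrt 0"
      by (intro tendsto_intros)
    then show "(\<lambda>n. \<bar>C\<bar> * L2_norm M w * L2_norm M (\<lambda>x. Q n x - p x)) \<longlonglongrightarrow> 0" by simp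
  qed
  moreover have "(\<lambda>n. \<integral>x. (w x * p x) * G n x \<partial>M) \<longlonglongrightarrow> (\<integral>x. (w x * p x) * g x \<partial>M)"
    by (rule integral_bounded_mult_tendsto(1)[OF L2_Cauchy_Schwarz(1)[OF w p] G bd lim])
  ultimately have "(\<lambda>n. (\<integral>x. (w x * G n x) * (Q n x - p x) \<partial>M) + (\<integral>x. (w x * p x) * G n x \<partial>M)) \<longlonglongrightarrow>
      0 + (\<integral>x. (w x * p x) * g x \<partial>M)"
    by (rule tendsto_add)
  then have "(\<lambda>n. \<integral>x. w x * G n x * Q n x \<partial>M) \<longlonglongrightarrow> 0 + (\<integral>x. (w x * p x) * g x \<partial>M)"
    by (rule Lim_transform_eventually) (use main in eventually_elim, simp)
  then show "(\<lambda>n. \<integral>x. w x * G n x * Q n x \<partial>M) \<longlonglongrightarrow> (\<integral>x. w x * g x * p x \<partial>M)"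
    by (simp add: mult_ac)
qed

text \<open>A smooth bounded substitute for \<open>1/t\<close>, recovered as \<open>\<eta>\<close> tends to \<open>0\<close>.\<close>

definition reg_inv :: "real \<Rightarrow> real \<Rightarrow> real" where
  "reg_inv \<eta> t = t * inverse (t * t + \<eta>)"

definition reg_inv' :: "real \<Rightarrow> real \<Rightarrow> real" where
  "reg_inv' \<eta> t = (\<eta> - t * t) * inverse (t * t + \<eta>) * inverse (t * t + \<eta>)"

lemma reg_pos: "\<eta> > 0 \<Longrightarrow> t * t + \<eta> > (0::real)"
  by (simp add: add_nonneg_pos)

lemma reg_inv_deriv:
  assumes "\<eta> > 0"
  shows "(reg_inv \<eta> has_real_derivative reg_inv' \<eta> t) (at t)"
  unfolding reg_inv_def[abs_def] reg_inv'_def using reg_pos[OF assms, of t]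
  by (auto intro!: derivative_eq_intros simp: field_simps power2_eq_square)

text \<open>The first two bounds depend on \<eta> but hold for every t, as needed while
  mollifications may come close to 0; the last two are independent of \<eta> away from 0, as needed
  when \<eta> tends to 0.\<close>

lemma reg_inv_bound:
  assumes "\<eta> > 0" shows "\<bar>reg_inv \<eta> t\<bar> \<le> 1 + 1 / \<eta>" "\<bar>reg_inv' \<eta> t\<bar> \<le> 1 / \<eta>"
    "t \<noteq> 0 \<Longrightarrow> \<bar>reg_inv \<eta> t\<bar> \<le> 1 / \<bar>t\<bar>" "t \<noteq> 0 \<Longrightarrow> \<bar>reg_inv' \<eta> t\<bar> \<le> 1 / t\<^sup>2"
proof -
  note pos = reg_pos[OF assms, of t]
  have d: "inverse (t * t + \<eta>) > 0" using pos by simp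
  have *: "\<bar>reg_inv' \<eta> t\<bar> \<le> inverse (t * t + \<eta>)"
  proof -
    have "\<bar>\<eta> - t * t\<bar> \<le> t * t + \<eta>" using assms by (auto simp: abs_le_iff)
    then have "\<bar>\<eta> - t * t\<bar> * inverse (t * t + \<eta>) \<le> 1" using pos by (simp add: field_simps)
    from mult_right_mono[OF this less_imp_le[OF d]] show ?thesis
      using d by (simp add: reg_inv'_def abs_mult)
  qed
  have "\<bar>t\<bar> \<le> 1 + t * t"
    using zero_le_power2[of "\<bar>t\<bar> - 1"] zero_le_square[of t] by (simp add: power2_eq_square algebra_simps)
  also have "\<dots> \<le> (1 + 1 / \<eta>) * (t * t + \<eta>)"
    using assms by (simp add: field_simps)
  finally show "\<bar>reg_inv \<eta> t\<bar> \<le> 1 + 1 / \<eta>"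
    using pos d by (simp add: reg_inv_def abs_mult field_simps)
  have "inverse (t * t + \<eta>) \<le> 1 / \<eta>" using assms pos by (simp add: inverse_eq_divide frac_le)
  then show "\<bar>reg_inv' \<eta> t\<bar> \<le> 1 / \<eta>" using * by linarith
  assume t: "t \<noteq> 0"
  then have tt: "t * t > 0" using not_real_square_gt_zero by blast
  have i: "inverse (t * t + \<eta>) \<le> 1 / (t * t)" using assms tt by (simp add: inverse_eq_divide frac_le)
  then show "\<bar>reg_inv' \<eta> t\<bar> \<le> 1 / t\<^sup>2" using * by (simp add: power2_eq_square)
  have "\<bar>reg_inv \<eta> t\<bar> = \<bar>t\<bar> * inverse (t * t + \<eta>)" using d by (simp add: reg_inv_def abs_mult)
  also have "\<dots> \<le> \<bar>t\<bar> * (1 / (t * t))" using i by (intro mult_left_mono) auto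
  also have "\<dots> = 1 / \<bar>t\<bar>" using t by (simp add: field_simps abs_mult[symmetric])
  finally show "\<bar>reg_inv \<eta> t\<bar> \<le> 1 / \<bar>t\<bar>" .
qed

lemma reg_inv_measurable [measurable]: "reg_inv \<eta> \<in> borel_measurable borel" "reg_inv' \<eta> \<in> borel_measurable borel"
  unfolding reg_inv_def[abs_def] reg_inv'_def[abs_def] by measurable

lemma reg_inv_tendsto:
  assumes "f \<longlonglongrightarrow> t" "\<eta> > 0"
  shows "(\<lambda>n. reg_inv \<eta> (f n)) \<longlonglongrightarrow> reg_inv \<eta> t" "(\<lambda>n. reg_inv' \<eta> (f n)) \<longlonglongrightarrow> reg_inv' \<eta> t"
  unfolding reg_inv_def reg_inv'_def using reg_pos[OF assms(2), of t]
  by (intro tendsto_intros assms(1); simp)+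

lemma reg_inv_tendsto_inverse:
  assumes "\<eta> \<longlonglongrightarrow> 0" "t \<noteq> 0"
  shows "(\<lambda>n. reg_inv (\<eta> n) t) \<longlonglongrightarrow> 1 / t" "(\<lambda>n. reg_inv' (\<eta> n) t) \<longlonglongrightarrow> - 1 / t\<^sup>2"
proof -
  have "(\<lambda>n. reg_inv (\<eta> n) t) \<longlonglongrightarrow> t * inverse (t * t + 0)"
    unfolding reg_inv_def using assms by (intro tendsto_intros) auto
  then show "(\<lambda>n. reg_inv (\<eta> n) t) \<longlonglongrightarrow> 1 / t" using assms(2) by (simp add: field_simps)
  have "(\<lambda>n. reg_inv' (\<eta> n) t) \<longlonglongrightarrow> (0 - t * t) * inverse (t * t + 0) * inverse (t * t + 0)"
    unfolding reg_inv'_def using assms by (intro tendsto_intros) auto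
  then show "(\<lambda>n. reg_inv' (\<eta> n) t) \<longlonglongrightarrow> - 1 / t\<^sup>2"
    using assms(2) by (simp add: field_simps power2_eq_square)
qed

lemma C_infinity_reg_inv:
  assumes "C_infinity U" "\<eta> > 0"
  shows "C_infinity (\<lambda>x. reg_inv \<eta> (U x))"
  unfolding reg_inv_def
  by (intro C_infinity_mult C_infinity_inverse C_infinity_add C_infinity_const assms(1))
    (use reg_pos[OF assms(2)] in \<open>metis less_irrefl\<close>)

lemma partials_reg_inv:
  assumes "C_infinity U" "\<eta> > 0"
  shows "partials [b] (\<lambda>x. reg_inv \<eta> (U x)) x = reg_inv' \<eta> (U x) * partials [b] U x"
proof -
  have "(U has_derivative frechet_derivative U (at x)) (at x)"
    using C_infinity_differentiable[OF assms(1)] frechet_derivative_works by blast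
  from has_derivative_compose[OF this, of "reg_inv \<eta>"] reg_inv_deriv[OF assms(2), of "U x"]
  have "((\<lambda>x. reg_inv \<eta> (U x)) has_derivative (\<lambda>h. reg_inv' \<eta> (U x) * frechet_derivative U (at x) h)) (at x)"
    by (simp add: has_field_derivative_def)
  from frechet_derivative_at[OF this, symmetric] show ?thesis by (simp add: partials.simps(2))
qed

lemma L2_test_functions:
  assumes "\<phi> \<in> test_functions S" and T: "open T"
  shows "\<phi> \<in> L2 (lebesgue_on T)"
proof -
  have [measurable]: "\<phi> \<in> borel_measurable borel" by (rule test_functions_measurable[OF assms(1)])
  have eq: "(\<lambda>x. (\<phi> x)\<^sup>2) = (\<lambda>x. \<phi> x * \<phi> x)" by (simp add: power2_eq_square)
  have "(\<lambda>x. (\<phi> x)\<^sup>2) \<in> test_functions S"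
    unfolding eq by (rule test_functions_mult[OF assms(1) test_functionsD(1)[OF assms(1)]])
  then have "integrable lborel (\<lambda>x. (\<phi> x)\<^sup>2)" by (rule integrable_test_function)
  then have fin: "(\<integral>\<^sup>+x. ennreal ((\<phi> x)\<^sup>2) \<partial>lborel) < \<infinity>"
    by (subst nn_integral_eq_integral) auto
  show ?thesis
  proof (rule L2I_nn_integral)
    show "\<phi> \<in> borel_measurable (lebesgue_on T)" by (rule borel_measurable_lebesgue_onI) measurable
    show "(\<integral>\<^sup>+x. ennreal ((\<phi> x)\<^sup>2) \<partial>lebesgue_on T) < \<infinity>"
      by (rule le_less_trans[OF nn_integral_lebesgue_on_le[OF T] fin])
  qed
qed

section \<open>Testing a weak divergence with a quotient\<close>

lemma has_weak_div_test:
  assumes F: "has_weak_div S F w" and \<zeta>: "\<zeta> \<in> test_functions S"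
  shows "(\<integral>x. (\<Sum>b\<in>Basis. (F x \<bullet> b) * partials [b] \<zeta> x) \<partial>lebesgue_on S) = - (\<integral>x. w x * \<zeta> x \<partial>lebesgue_on S)"
proof -
  have "F x \<bullet> grad \<zeta> x = (\<Sum>b\<in>Basis. (F x \<bullet> b) * partials [b] \<zeta> x)" for x
    by (subst euclidean_inner) (simp add: grad_inner)
  then have "(\<integral>x. (\<Sum>b\<in>Basis. (F x \<bullet> b) * partials [b] \<zeta> x) \<partial>lebesgue_on S) = (\<integral>x. F x \<bullet> grad \<zeta> x \<partial>lebesgue_on S)"
    by simp
  also have "\<dots> = - (\<integral>x. w x * \<zeta> x \<partial>lebesgue_on S)"
    using F \<zeta> unfolding has_weak_div_def by blast
  finally show ?thesis .
qed

text \<open>For fixed \<eta> the function \<psi> \<open>* reg_inv\<close> \<eta>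
  \<open>(U n)\<close> is a genuine test function for every mollification \<open>U n\<close>. In the
  limit the coefficients are bounded and converge almost everywhere, while the derivatives of
  \<open>U n\<close> converge in L^2 to those of \<open>u\<close>.\<close>

lemma weak_div_reg_inv:
  fixes S :: "'a::euclidean_space set"
  assumes S: "open S" "bounded S" and \<eta>: "\<eta> > 0"
    and F: "\<And>b. b \<in> Basis \<Longrightarrow> (\<lambda>x. F x \<bullet> b) \<in> L2 (lebesgue_on S)"
    and w: "w \<in> L2 (lebesgue_on S)" and div: "has_weak_div S F w"
    and u: "u \<in> L2 (lebesgue_on S)" and p: "\<And>b. b \<in> Basis \<Longrightarrow> p b \<in> L2 (lebesgue_on S)"
    and up: "\<And>b. b \<in> Basis \<Longrightarrow> has_weak_deriv S [b] u (p b)"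
    and \<psi>: "\<psi> \<in> test_functions S"
  shows "(\<Sum>b\<in>Basis. (\<integral>x. ((F x \<bullet> b) * partials [b] \<psi> x) * reg_inv \<eta> (u x) \<partial>lebesgue_on S) +
      (\<integral>x. (F x \<bullet> b) * (\<psi> x * reg_inv' \<eta> (u x)) * p b x \<partial>lebesgue_on S)) =
    - (\<integral>x. (w x * \<psi> x) * reg_inv \<eta> (u x) \<partial>lebesgue_on S)"
proof -
  let ?M = "lebesgue_on S" and ?K = "closure {x. \<psi> x \<noteq> 0}"
  obtain U Q where U: "\<And>n. C_infinity (U n)" and Ulim: "AE x in ?M. (\<lambda>n. U n x) \<longlonglongrightarrow> u x"
    and UQ: "\<And>n b x. b \<in> Basis \<Longrightarrow> x \<in> ?K \<Longrightarrow> partials [b] (U n) x = Q n b x"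
    and Q: "\<And>n b. b \<in> Basis \<Longrightarrow> Q n b \<in> borel_measurable ?M"
    and Qlim: "\<And>b. b \<in> Basis \<Longrightarrow> (\<lambda>n. \<integral>\<^sup>+x. ennreal ((Q n b x - p b x)\<^sup>2) \<partial>?M) \<longlonglongrightarrow> 0"
    by (rule weak_deriv_mollify[OF S test_functionsD(2,3)[OF \<psi>] u p up], assumption, assumption) (rule that)
  have Um [measurable]: "U n \<in> borel_measurable ?M" for n
    using C_infinity_continuous[OF U] by (intro borel_measurable_lebesgue_onI borel_measurable_continuous_onI)
  have um [measurable]: "u \<in> borel_measurable ?M" "w \<in> borel_measurable ?M" using u w by (auto simp: L2_def)
  have \<psi>m [measurable]: "\<psi> \<in> borel_measurable ?M"
    by (rule borel_measurable_lebesgue_onI[OF test_functions_measurable[OF \<psi>]])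
  obtain B where B: "B \<ge> 0" "\<And>x. \<bar>\<psi> x\<bar> \<le> B" using test_functions_bounded[OF \<psi>] by blast
  have G: "(\<lambda>x. reg_inv \<eta> (U n x)) \<in> borel_measurable ?M" "(\<lambda>x. reg_inv \<eta> (u x)) \<in> borel_measurable ?M"
    "(\<lambda>x. \<psi> x * reg_inv' \<eta> (U n x)) \<in> borel_measurable ?M" "(\<lambda>x. \<psi> x * reg_inv' \<eta> (u x)) \<in> borel_measurable ?M" for n
    by measurable
  have Glim: "AE x in ?M. (\<lambda>n. reg_inv \<eta> (U n x)) \<longlonglongrightarrow> reg_inv \<eta> (u x)"
    "AE x in ?M. (\<lambda>n. \<psi> x * reg_inv' \<eta> (U n x)) \<longlonglongrightarrow> \<psi> x * reg_inv' \<eta> (u x)"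
    using Ulim by (eventually_elim, auto intro!: tendsto_mult_left reg_inv_tendsto \<eta>)+
  have Gbd: "AE x in ?M. \<bar>reg_inv \<eta> (U n x)\<bar> \<le> 1 + 1 / \<eta>" "AE x in ?M. \<bar>\<psi> x * reg_inv' \<eta> (U n x)\<bar> \<le> B * (1 / \<eta>)" for n
    using reg_inv_bound(1,2)[OF \<eta>] B by (auto simp only: abs_mult intro!: AE_I2 mult_mono)
  define T1 where "T1 n b = (\<integral>x. ((F x \<bullet> b) * partials [b] \<psi> x) * reg_inv \<eta> (U n x) \<partial>?M)" for n b
  define T2 where "T2 n b = (\<integral>x. (F x \<bullet> b) * (\<psi> x * reg_inv' \<eta> (U n x)) * Q n b x \<partial>?M)" for n b
  have iF: "integrable ?M (\<lambda>x. (F x \<bullet> b) * partials [b] \<psi> x)" if "b \<in> Basis" for b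
    by (rule L2_Cauchy_Schwarz(1)[OF F[OF that] L2_test_functions[OF test_functions_partial[OF \<psi> that] S(1)]])
  have iw: "integrable ?M (\<lambda>x. w x * \<psi> x)"
    by (rule L2_Cauchy_Schwarz(1)[OF w L2_test_functions[OF \<psi> S(1)]])
  have T1: "(\<lambda>n. T1 n b) \<longlonglongrightarrow> (\<integral>x. ((F x \<bullet> b) * partials [b] \<psi> x) * reg_inv \<eta> (u x) \<partial>?M)"
    "\<And>n. integrable ?M (\<lambda>x. ((F x \<bullet> b) * partials [b] \<psi> x) * reg_inv \<eta> (U n x))" if "b \<in> Basis" for b
    unfolding T1_def by (rule integral_bounded_mult_tendsto[OF iF[OF that] G(1,2) Gbd(1) Glim(1)])+
  have T2: "(\<lambda>n. T2 n b) \<longlonglongrightarrow> (\<integral>x. (F x \<bullet> b) * (\<psi> x * reg_inv' \<eta> (u x)) * p b x \<partial>?M)"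
    "\<forall>\<^sub>F n in sequentially. integrable ?M (\<lambda>x. (F x \<bullet> b) * (\<psi> x * reg_inv' \<eta> (U n x)) * Q n b x)" if "b \<in> Basis" for b
    unfolding T2_def
    by (rule integral_L2_mult_tendsto[OF F[OF that] p[OF that] G(3,4) Gbd(2) Glim(2) Q[OF that] Qlim[OF that]])+
  have T3: "(\<lambda>n. \<integral>x. (w x * \<psi> x) * reg_inv \<eta> (U n x) \<partial>?M) \<longlonglongrightarrow> (\<integral>x. (w x * \<psi> x) * reg_inv \<eta> (u x) \<partial>?M)"
    by (rule integral_bounded_mult_tendsto(1)[OF iw G(1,2) Gbd(1) Glim(1)])
  have "\<forall>\<^sub>F n in sequentially. \<forall>b\<in>Basis. integrable ?M (\<lambda>x. (F x \<bullet> b) * (\<psi> x * reg_inv' \<eta> (U n x)) * Q n b x)"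
    by (intro eventually_ball_finite finite_Basis ballI T2(2))
  then have ident: "\<forall>\<^sub>F n in sequentially. (\<Sum>b\<in>Basis. T1 n b + T2 n b) = - (\<integral>x. (w x * \<psi> x) * reg_inv \<eta> (U n x) \<partial>?M)"
  proof eventually_elim
    case (elim n)
    define \<zeta> where "\<zeta> x = \<psi> x * reg_inv \<eta> (U n x)" for x
    have \<zeta>: "\<zeta> \<in> test_functions S"
      unfolding \<zeta>_def by (rule test_functions_mult[OF \<psi> C_infinity_reg_inv[OF U \<eta>]])
    have d\<zeta>: "partials [b] \<zeta> x = \<psi> x * reg_inv' \<eta> (U n x) * Q n b x + partials [b] \<psi> x * reg_inv \<eta> (U n x)"
      if b: "b \<in> Basis" for b x
    proof -
      have "partials [b] \<zeta> x = \<psi> x * (reg_inv' \<eta> (U n x) * partials [b] (U n) x) + partials [b] \<psi> x * reg_inv \<eta> (U n x)"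
        unfolding \<zeta>_def partials_reg_inv[OF U \<eta>, symmetric]
        by (rule partials_mult[OF test_functionsD(4)[OF \<psi>] C_infinity_differentiable[OF C_infinity_reg_inv[OF U \<eta>]]])
      \<comment> \<open>On the support of \<psi> the derivative of \<open>U n\<close> is
        \<open>Q n\<close>; elsewhere both sides carry the factor 0.\<close>
      moreover have "\<psi> x * partials [b] (U n) x = \<psi> x * Q n b x"
        using UQ[OF b, of x n] closure_subset[of "{x. \<psi> x \<noteq> 0}"] by (cases "\<psi> x = 0") auto
      ultimately show ?thesis by (auto simp: mult_ac)
    qed
    have "- (\<integral>x. (w x * \<psi> x) * reg_inv \<eta> (U n x) \<partial>?M) = - (\<integral>x. w x * \<zeta> x \<partial>?M)"
      by (simp add: \<zeta>_def mult.assoc)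
    also have "\<dots> = (\<integral>x. (\<Sum>b\<in>Basis. (F x \<bullet> b) * partials [b] \<zeta> x) \<partial>?M)"
      by (rule has_weak_div_test[OF div \<zeta>, symmetric])
    also have "\<dots> = (\<integral>x. (\<Sum>b\<in>Basis. ((F x \<bullet> b) * partials [b] \<psi> x) * reg_inv \<eta> (U n x) +
        (F x \<bullet> b) * (\<psi> x * reg_inv' \<eta> (U n x)) * Q n b x) \<partial>?M)"
      by (intro Bochner_Integration.integral_cong sum.cong refl) (simp add: d\<zeta> algebra_simps)
    also have "\<dots> = (\<Sum>b\<in>Basis. T1 n b + T2 n b)"
      unfolding T1_def T2_def using T1(2) elim
      by (subst Bochner_Integration.integral_sum) (auto intro!: sum.cong Bochner_Integration.integral_add)
    finally show ?case by simp
  qed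
  have "(\<lambda>n. \<Sum>b\<in>Basis. T1 n b + T2 n b) \<longlonglongrightarrow>
      (\<Sum>b\<in>Basis. (\<integral>x. ((F x \<bullet> b) * partials [b] \<psi> x) * reg_inv \<eta> (u x) \<partial>?M) +
        (\<integral>x. (F x \<bullet> b) * (\<psi> x * reg_inv' \<eta> (u x)) * p b x \<partial>?M))"
    by (intro tendsto_sum tendsto_add T1 T2)
  moreover have "(\<lambda>n. \<Sum>b\<in>Basis. T1 n b + T2 n b) \<longlonglongrightarrow> - (\<integral>x. (w x * \<psi> x) * reg_inv \<eta> (u x) \<partial>?M)"
    by (rule Lim_transform_eventually[OF tendsto_minus[OF T3]]) (use ident in eventually_elim, simp)
  ultimately show ?thesis by (rule LIMSEQ_unique)
qed

text \<open>Dominated convergence as \<eta> tends to 0: the lower bound \<open>c\<close> makes 1/c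
  and 1/c^2 bounds that no longer depend on \<eta>. The derivative of 1/t accounts for the minus
  sign before the second integral.\<close>

lemma weak_div_test_divide:
  fixes S :: "'a::euclidean_space set"
  assumes S: "open S" "bounded S"
    and F: "\<And>b. b \<in> Basis \<Longrightarrow> (\<lambda>x. F x \<bullet> b) \<in> L2 (lebesgue_on S)"
    and w: "w \<in> L2 (lebesgue_on S)" and div: "has_weak_div S F w"
    and u: "u \<in> L2 (lebesgue_on S)" and p: "\<And>b. b \<in> Basis \<Longrightarrow> p b \<in> L2 (lebesgue_on S)"
    and up: "\<And>b. b \<in> Basis \<Longrightarrow> has_weak_deriv S [b] u (p b)"
    and c: "c > 0" "AE x in lebesgue_on S. c \<le> \<bar>u x\<bar>"
    and \<psi>: "\<psi> \<in> test_functions S"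
  shows "(\<Sum>b\<in>Basis. (\<integral>x. (F x \<bullet> b) * partials [b] \<psi> x / u x \<partial>lebesgue_on S) -
      (\<integral>x. (F x \<bullet> b) * \<psi> x * p b x / (u x)\<^sup>2 \<partial>lebesgue_on S)) =
    - (\<integral>x. w x * \<psi> x / u x \<partial>lebesgue_on S)"
proof -
  let ?M = "lebesgue_on S"
  define \<eta> where "\<eta> n = inverse (real (Suc n))" for n
  have \<eta>: "\<eta> n > 0" for n by (simp add: \<eta>_def)
  have \<eta>0: "\<eta> \<longlonglongrightarrow> 0" unfolding \<eta>_def by (rule LIMSEQ_inverse_real_of_nat)
  have um [measurable]: "u \<in> borel_measurable ?M" "w \<in> borel_measurable ?M" using u w by (auto simp: L2_def)
  have \<psi>m [measurable]: "\<psi> \<in> borel_measurable ?M"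
    by (rule borel_measurable_lebesgue_onI[OF test_functions_measurable[OF \<psi>]])
  obtain B where B: "B \<ge> 0" "\<And>x. \<bar>\<psi> x\<bar> \<le> B" using test_functions_bounded[OF \<psi>] by blast
  have G: "(\<lambda>x. reg_inv (\<eta> n) (u x)) \<in> borel_measurable ?M" "(\<lambda>x. 1 / u x) \<in> borel_measurable ?M"
    "(\<lambda>x. \<psi> x * reg_inv' (\<eta> n) (u x)) \<in> borel_measurable ?M" "(\<lambda>x. \<psi> x * (- 1 / (u x)\<^sup>2)) \<in> borel_measurable ?M" for n
    by measurable
  have Glim: "AE x in ?M. (\<lambda>n. reg_inv (\<eta> n) (u x)) \<longlonglongrightarrow> 1 / u x"
    "AE x in ?M. (\<lambda>n. \<psi> x * reg_inv' (\<eta> n) (u x)) \<longlonglongrightarrow> \<psi> x * (- 1 / (u x)\<^sup>2)"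
    using c(2) by (eventually_elim, use c(1) in \<open>intro tendsto_mult_left reg_inv_tendsto_inverse \<eta>0, force\<close>)+
  have Gbd: "AE x in ?M. \<bar>reg_inv (\<eta> n) (u x)\<bar> \<le> 1 / c" "AE x in ?M. \<bar>\<psi> x * reg_inv' (\<eta> n) (u x)\<bar> \<le> B * (1 / c\<^sup>2)" for n
  proof -
    show "AE x in ?M. \<bar>reg_inv (\<eta> n) (u x)\<bar> \<le> 1 / c"
      using c(2)
    proof eventually_elim
      case (elim x)
      then have "u x \<noteq> 0" "1 / \<bar>u x\<bar> \<le> 1 / c" using c(1) by (auto intro: frac_le)
      then show ?case using reg_inv_bound(3)[OF \<eta>, of "u x" n] by linarith
    qed
    show "AE x in ?M. \<bar>\<psi> x * reg_inv' (\<eta> n) (u x)\<bar> \<le> B * (1 / c\<^sup>2)"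
      using c(2)
    proof eventually_elim
      case (elim x)
      have "c\<^sup>2 \<le> \<bar>u x\<bar>\<^sup>2" using elim c(1) by (intro power_mono) auto
      then have "u x \<noteq> 0" "1 / (u x)\<^sup>2 \<le> 1 / c\<^sup>2" using c(1) elim by (auto intro: frac_le)
      then have "\<bar>reg_inv' (\<eta> n) (u x)\<bar> \<le> 1 / c\<^sup>2" using reg_inv_bound(4)[OF \<eta>, of "u x" n] by linarith
      then show ?case unfolding abs_mult using B by (intro mult_mono) auto
    qed
  qed
  have iF: "integrable ?M (\<lambda>x. (F x \<bullet> b) * partials [b] \<psi> x)" if "b \<in> Basis" for b
    by (rule L2_Cauchy_Schwarz(1)[OF F[OF that] L2_test_functions[OF test_functions_partial[OF \<psi> that] S(1)]])
  have iw: "integrable ?M (\<lambda>x. w x * \<psi> x)"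
    by (rule L2_Cauchy_Schwarz(1)[OF w L2_test_functions[OF \<psi> S(1)]])
  have iFp: "integrable ?M (\<lambda>x. (F x \<bullet> b) * p b x)" if "b \<in> Basis" for b
    by (rule L2_Cauchy_Schwarz(1)[OF F[OF that] p[OF that]])
  have T1: "(\<lambda>n. \<integral>x. ((F x \<bullet> b) * partials [b] \<psi> x) * reg_inv (\<eta> n) (u x) \<partial>?M) \<longlonglongrightarrow>
      (\<integral>x. ((F x \<bullet> b) * partials [b] \<psi> x) * (1 / u x) \<partial>?M)" if "b \<in> Basis" for b
    by (rule integral_bounded_mult_tendsto(1)[OF iF[OF that] G(1,2) Gbd(1) Glim(1)])
  have T2: "(\<lambda>n. \<integral>x. ((F x \<bullet> b) * p b x) * (\<psi> x * reg_inv' (\<eta> n) (u x)) \<partial>?M) \<longlonglongrightarrow>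
      (\<integral>x. ((F x \<bullet> b) * p b x) * (\<psi> x * (- 1 / (u x)\<^sup>2)) \<partial>?M)" if "b \<in> Basis" for b
    by (rule integral_bounded_mult_tendsto(1)[OF iFp[OF that] G(3,4) Gbd(2) Glim(2)])
  have T3: "(\<lambda>n. \<integral>x. (w x * \<psi> x) * reg_inv (\<eta> n) (u x) \<partial>?M) \<longlonglongrightarrow> (\<integral>x. (w x * \<psi> x) * (1 / u x) \<partial>?M)"
    by (rule integral_bounded_mult_tendsto(1)[OF iw G(1,2) Gbd(1) Glim(1)])
  have "(\<Sum>b\<in>Basis. (\<integral>x. ((F x \<bullet> b) * partials [b] \<psi> x) * reg_inv (\<eta> n) (u x) \<partial>?M) +
      (\<integral>x. ((F x \<bullet> b) * p b x) * (\<psi> x * reg_inv' (\<eta> n) (u x)) \<partial>?M)) =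
    - (\<integral>x. (w x * \<psi> x) * reg_inv (\<eta> n) (u x) \<partial>?M)" for n
    using weak_div_reg_inv[OF S \<eta> F w div u p up \<psi>, of n] by (simp add: mult_ac)
  note eq = this[symmetric]
  have "(\<lambda>n. - (\<integral>x. (w x * \<psi> x) * reg_inv (\<eta> n) (u x) \<partial>?M)) \<longlonglongrightarrow>
      (\<Sum>b\<in>Basis. (\<integral>x. ((F x \<bullet> b) * partials [b] \<psi> x) * (1 / u x) \<partial>?M) +
        (\<integral>x. ((F x \<bullet> b) * p b x) * (\<psi> x * (- 1 / (u x)\<^sup>2)) \<partial>?M))"
    unfolding eq by (intro tendsto_sum tendsto_add T1 T2)
  from LIMSEQ_unique[OF this tendsto_minus[OF T3]]
  show ?thesis by (simp add: mult_ac)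
qed

section \<open>Energy estimates\<close>

text \<open>The gradient is a separate argument \<open>d\<close>, so that the same expression serves
  classical partials of test functions, weak derivatives, and differences of the two.\<close>

definition H1_sq :: "'a::euclidean_space set \<Rightarrow> ('a \<Rightarrow> real) \<Rightarrow> ('a \<Rightarrow> 'a \<Rightarrow> real) \<Rightarrow> real" where
  "H1_sq S v d = (L2_norm (lebesgue_on S) v)\<^sup>2 + (\<Sum>b\<in>Basis. (L2_norm (lebesgue_on S) (d b))\<^sup>2)"

lemma H1_sq_nonneg: "0 \<le> H1_sq S v d"
  by (simp add: H1_sq_def sum_nonneg)

lemma L2_norm_le_H1:
  "L2_norm (lebesgue_on S) v \<le> sqrt (H1_sq S v d)"
  "b \<in> Basis \<Longrightarrow> L2_norm (lebesgue_on S) (d b) \<le> sqrt (H1_sq S v d)"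
proof -
  show "L2_norm (lebesgue_on S) v \<le> sqrt (H1_sq S v d)"
    by (rule real_le_rsqrt) (simp add: H1_sq_def sum_nonneg)
  assume "b \<in> Basis"
  then have "(L2_norm (lebesgue_on S) (d b))\<^sup>2 \<le> (\<Sum>b\<in>Basis. (L2_norm (lebesgue_on S) (d b))\<^sup>2)"
    by (intro member_le_sum) auto
  then show "L2_norm (lebesgue_on S) (d b) \<le> sqrt (H1_sq S v d)"
    by (intro real_le_rsqrt) (simp add: H1_sq_def add_increasing)
qed

text \<open>The left side is the squared L^4 norm of \<phi>; the factor 2 is the root of the 4 in
  the fourth-power inequality.\<close>

lemma L2_norm_sq_test:
  fixes \<phi> :: "'a::euclidean_space \<Rightarrow> real"
  assumes S: "open S" and \<phi>: "\<phi> \<in> test_functions S" and d: "DIM('a) = 2 \<or> DIM('a) = 3"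
  shows "L2_norm (lebesgue_on S) (\<lambda>x. (\<phi> x)\<^sup>2) \<le> 2 * H1_sq S \<phi> (\<lambda>b. partials [b] \<phi>)"
proof -
  have nn: "(\<integral>\<^sup>+x. ennreal ((\<psi> x)\<^sup>2) \<partial>lborel) = ennreal ((L2_norm (lebesgue_on S) \<psi>)\<^sup>2)" if "\<psi> \<in> test_functions S" for \<psi>
  proof -
    have "(\<integral>\<^sup>+x. ennreal ((\<psi> x)\<^sup>2) \<partial>lebesgue_on S) = (\<integral>\<^sup>+x. ennreal ((\<psi> x)\<^sup>2) \<partial>lborel)"
    proof (rule nn_integral_lebesgue_on[OF S])
      show "ennreal ((\<psi> x)\<^sup>2) = 0" if "x \<notin> S" for x
        using that test_functionsD(3)[OF \<open>\<psi> \<in> test_functions S\<close>] closure_subset[of "{x. \<psi> x \<noteq> 0}"] by auto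
    qed
    then show ?thesis using L2_nn_integral[OF L2_test_functions[OF that S]] by simp
  qed
  have \<phi>2: "(\<lambda>x. (\<phi> x)\<^sup>2) \<in> test_functions S"
    using test_functions_mult[OF \<phi> test_functionsD(1)[OF \<phi>]] by (simp add: power2_eq_square)
  have "ennreal ((L2_norm (lebesgue_on S) (\<lambda>x. (\<phi> x)\<^sup>2))\<^sup>2) = (\<integral>\<^sup>+x. ennreal (\<phi> x ^ 4) \<partial>lborel)"
    using nn[OF \<phi>2] by (simp add: power_mult[symmetric])
  also have "\<dots> \<le> 4 * ((\<integral>\<^sup>+x. ennreal ((\<phi> x)\<^sup>2) \<partial>lborel) + (\<Sum>b\<in>Basis. \<integral>\<^sup>+x. ennreal ((partials [b] \<phi> x)\<^sup>2) \<partial>lborel))\<^sup>2"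
    by (rule sobolev_L4[OF \<phi> d])
  also have "\<dots> = 4 * (ennreal (H1_sq S \<phi> (\<lambda>b. partials [b] \<phi>)))\<^sup>2"
    using nn[OF \<phi>] nn[OF test_functions_partial[OF \<phi>]]
    by (simp add: H1_sq_def sum_ennreal sum_nonneg)
  also have "\<dots> = ennreal ((2 * H1_sq S \<phi> (\<lambda>b. partials [b] \<phi>))\<^sup>2)"
    by (simp add: ennreal_power H1_sq_nonneg power_mult_distrib ennreal_mult)
  finally have "(L2_norm (lebesgue_on S) (\<lambda>x. (\<phi> x)\<^sup>2))\<^sup>2 \<le> (2 * H1_sq S \<phi> (\<lambda>b. partials [b] \<phi>))\<^sup>2"
    by (subst (asm) ennreal_le_iff) auto
  then show ?thesis by (rule power2_le_imp_le) (simp add: H1_sq_nonneg)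
qed

lemma L2_mult_bounded:
  assumes f: "f \<in> L2 M" and g: "g \<in> borel_measurable M" "AE x in M. \<bar>g x\<bar> \<le> C" and C: "C \<ge> 0"
  shows "(\<lambda>x. g x * f x) \<in> L2 M" "L2_norm M (\<lambda>x. g x * f x) \<le> C * L2_norm M f"
proof -
  have *: "AE x in M. \<bar>g x * f x\<bar> \<le> C * \<bar>f x\<bar>"
    using g(2) by eventually_elim (simp add: abs_mult mult_right_mono)
  show 1: "(\<lambda>x. g x * f x) \<in> L2 M"
    by (rule L2_bounded[OF f _ *]) (use f g(1) in \<open>auto simp: L2_def\<close>)
  show "L2_norm M (\<lambda>x. g x * f x) \<le> C * L2_norm M f" by (rule L2_norm_le[OF f 1 * C])
qed

text \<open>Testing the equation with \<open>\<phi>\<^sup>2/u\<close> controls \<open>\<phi> \<nabla>(log u)\<close>; this replaces the embedding of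
  \<open>\<nabla>u\<close> into \<open>L\<^sup>4\<close>, which would need the regularity of the boundary.\<close>

lemma log_gradient_estimate:
  fixes S :: "'a::euclidean_space set"
  assumes S: "open S" "bounded S" and dim: "DIM('a) = 2 \<or> DIM('a) = 3"
    and a: "a \<in> borel_measurable (lebesgue_on S)" "a0 > 0" "AE x in lebesgue_on S. a0 \<le> a x \<and> a x \<le> A"
    and u: "u \<in> L2 (lebesgue_on S)" and p: "\<And>b. b \<in> Basis \<Longrightarrow> p b \<in> L2 (lebesgue_on S)"
    and up: "\<And>b. b \<in> Basis \<Longrightarrow> has_weak_deriv S [b] u (p b)"
    and c: "c > 0" "AE x in lebesgue_on S. c \<le> \<bar>u x\<bar>"
    and w: "w \<in> L2 (lebesgue_on S)" and div: "has_weak_div S F w"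
    and F: "\<And>x b. b \<in> Basis \<Longrightarrow> F x \<bullet> b = a x * p b x"
    and A: "A \<ge> 0"
    and \<phi>: "\<phi> \<in> test_functions S" and b: "b \<in> Basis"
  shows "(\<lambda>x. \<phi> x * p b x / u x) \<in> L2 (lebesgue_on S)"
    "L2_norm (lebesgue_on S) (\<lambda>x. \<phi> x * p b x / u x) \<le>
      sqrt (2 / a0 * (2 * A + 2 * L2_norm (lebesgue_on S) w / c)) * sqrt (H1_sq S \<phi> (\<lambda>b. partials [b] \<phi>))"
proof -
  let ?M = "lebesgue_on S"
  let ?E = "H1_sq S \<phi> (\<lambda>b. partials [b] \<phi>)"
  define X where "X b x = \<phi> x * p b x / u x" for b x
  obtain B where B: "B \<ge> 0" "\<And>x. \<bar>\<phi> x\<bar> \<le> B" using test_functions_bounded[OF \<phi>] by blast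
  have um [measurable]: "u \<in> borel_measurable ?M" "w \<in> borel_measurable ?M" using u w by (auto simp: L2_def)
  have \<phi>m [measurable]: "\<phi> \<in> borel_measurable ?M"
    by (rule borel_measurable_lebesgue_onI[OF test_functions_measurable[OF \<phi>]])
  note [measurable] = a(1)
  have inv: "AE x in ?M. \<bar>1 / u x\<bar> \<le> 1 / c"
    using c(2) by eventually_elim (use c(1) in \<open>auto intro: frac_le\<close>)
  have aA: "AE x in ?M. \<bar>a x\<bar> \<le> A" using a(3) by eventually_elim (use a(2) in auto)
  have XL2: "X b \<in> L2 ?M" if b: "b \<in> Basis" for b
  proof -
    have "AE x in ?M. \<bar>\<phi> x / u x\<bar> \<le> B * (1 / c)"
      using inv
    proof eventually_elim
      case (elim x)
      then have "\<bar>\<phi> x\<bar> * \<bar>1 / u x\<bar> \<le> B * (1 / c)" using B by (intro mult_mono) auto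
      then show ?case by (simp add: abs_mult[symmetric])
    qed
    from L2_mult_bounded(1)[OF p[OF b] _ this] show ?thesis
      using B(1) c(1) by (simp add: X_def[abs_def])
  qed
  show "(\<lambda>x. \<phi> x * p b x / u x) \<in> L2 ?M" using XL2[OF b] by (simp add: X_def[abs_def])
  have d\<phi>: "partials [b] \<phi> \<in> L2 ?M" if "b \<in> Basis" for b
    by (rule L2_test_functions[OF test_functions_partial[OF \<phi> that] S(1)])
  have \<phi>2: "(\<lambda>x. (\<phi> x)\<^sup>2) \<in> test_functions S"
    using test_functions_mult[OF \<phi> test_functionsD(1)[OF \<phi>]] by (simp add: power2_eq_square)
  have d\<phi>2: "partials [b] (\<lambda>x. (\<phi> x)\<^sup>2) x = 2 * \<phi> x * partials [b] \<phi> x" for b x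
    using partials_mult[OF test_functionsD(4)[OF \<phi>] test_functionsD(4)[OF \<phi>], of b x]
    by (simp add: power2_eq_square)
  have FL2: "(\<lambda>x. F x \<bullet> b) \<in> L2 ?M" if b: "b \<in> Basis" for b
    using L2_mult_bounded(1)[OF p[OF b] a(1) aA A] by (simp add: F[OF b])
  have aX: "(\<lambda>x. a x * X b x) \<in> L2 ?M" if b: "b \<in> Basis" for b
    by (rule L2_mult_bounded(1)[OF XL2[OF b] a(1) aA A])
  have ad\<phi>: "(\<lambda>x. a x * partials [b] \<phi> x) \<in> L2 ?M" if b: "b \<in> Basis" for b
    by (rule L2_mult_bounded(1)[OF d\<phi>[OF b] a(1) aA A])
  \<comment> \<open>\<open>J b\<close> is the quadratic term to be controlled, \<open>T b\<close>
    the cross term coming from the derivative of \<open>\<phi>\<^sup>2\<close>.\<close>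
  define J where "J b = (\<integral>x. a x * X b x * X b x \<partial>?M)" for b
  define T where "T b = (\<integral>x. 2 * (a x * X b x * partials [b] \<phi> x) \<partial>?M)" for b
  have iJ: "integrable ?M (\<lambda>x. a x * X b x * X b x)"
    and iT: "integrable ?M (\<lambda>x. 2 * (a x * X b x * partials [b] \<phi> x))"
    and iD: "integrable ?M (\<lambda>x. a x * partials [b] \<phi> x * partials [b] \<phi> x)" if b: "b \<in> Basis" for b
    using L2_Cauchy_Schwarz(1)[OF aX[OF b] XL2[OF b]] L2_Cauchy_Schwarz(1)[OF aX[OF b] d\<phi>[OF b]]
      L2_Cauchy_Schwarz(1)[OF ad\<phi>[OF b] d\<phi>[OF b]] by auto
  have ident: "(\<Sum>b\<in>Basis. T b - J b) = - (\<integral>x. w x * (\<phi> x)\<^sup>2 / u x \<partial>?M)"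
  proof -
    have "(\<integral>x. (F x \<bullet> b) * partials [b] (\<lambda>x. (\<phi> x)\<^sup>2) x / u x \<partial>?M) = T b"
      "(\<integral>x. (F x \<bullet> b) * (\<phi> x)\<^sup>2 * p b x / (u x)\<^sup>2 \<partial>?M) = J b" if b: "b \<in> Basis" for b
      unfolding T_def J_def
      by (intro Bochner_Integration.integral_cong refl; simp add: d\<phi>2 F[OF b] X_def; simp add: power2_eq_square)+
    then show ?thesis
      using weak_div_test_divide[OF S FL2 w div u p up c \<phi>2] by simp
  qed
  have TJ: "T b \<le> J b / 2 + 2 * A * (L2_norm ?M (partials [b] \<phi>))\<^sup>2" if b: "b \<in> Basis" for b
  proof -
    have "T b \<le> (\<integral>x. 1 / 2 * (a x * X b x * X b x) + 2 * (a x * partials [b] \<phi> x * partials [b] \<phi> x) \<partial>?M)"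
      unfolding T_def
    proof (rule integral_mono_AE)
      show "AE x in ?M. 2 * (a x * X b x * partials [b] \<phi> x) \<le>
         1 / 2 * (a x * X b x * X b x) + 2 * (a x * partials [b] \<phi> x * partials [b] \<phi> x)"
        using a(3)
      proof eventually_elim
        case (elim x)
        \<comment> \<open>Young's inequality weighted so that the cross term costs only half of the
          quadratic term.\<close>
        have "0 \<le> a x * (X b x - 2 * partials [b] \<phi> x)\<^sup>2" using elim a(2) by (intro mult_nonneg_nonneg) auto
        then show ?case by (simp add: power2_eq_square algebra_simps)
      qed
    qed (use iT[OF b] iJ[OF b] iD[OF b] in auto)
    also have "\<dots> = J b / 2 + 2 * (\<integral>x. a x * partials [b] \<phi> x * partials [b] \<phi> x \<partial>?M)"
      using iJ[OF b] iD[OF b] by (simp add: J_def)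
    also have "(\<integral>x. a x * partials [b] \<phi> x * partials [b] \<phi> x \<partial>?M) \<le> (A * L2_norm ?M (partials [b] \<phi>)) * L2_norm ?M (partials [b] \<phi>)"
      using order_trans[OF L2_Cauchy_Schwarz(3)[OF ad\<phi>[OF b] d\<phi>[OF b]]
        mult_right_mono[OF L2_mult_bounded(2)[OF d\<phi>[OF b] a(1) aA A] L2_norm_nonneg]] by simp
    finally show ?thesis by (simp add: power2_eq_square mult_ac)
  qed
  \<comment> \<open>\<open>w\<close> is merely square integrable, so Cauchy-Schwarz puts all of
    \<open>\<phi>\<^sup>2\<close> into L^2; here the L^4 bound enters, and with it the
    dimension.\<close>
  have R: "(\<integral>x. w x * (\<phi> x)\<^sup>2 / u x \<partial>?M) \<le> L2_norm ?M w * (1 / c * (2 * ?E))"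
  proof -
    note \<phi>2L2 = L2_test_functions[OF \<phi>2 S(1)]
    have im: "(\<lambda>x. 1 / u x) \<in> borel_measurable ?M" by measurable
    have c0: "0 \<le> 1 / c" using c(1) by simp
    have "(\<integral>x. w x * (1 / u x * (\<phi> x)\<^sup>2) \<partial>?M) \<le> L2_norm ?M w * L2_norm ?M (\<lambda>x. 1 / u x * (\<phi> x)\<^sup>2)"
      using L2_Cauchy_Schwarz(3)[OF w L2_mult_bounded(1)[OF \<phi>2L2 im inv c0]] by linarith
    also have "\<dots> \<le> L2_norm ?M w * (1 / c * (2 * ?E))"
      by (intro mult_left_mono L2_norm_nonneg order_trans[OF L2_mult_bounded(2)[OF \<phi>2L2 im inv c0]]
         L2_norm_sq_test[OF S(1) \<phi> dim] c0)
    finally show ?thesis by simp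
  qed
  have "(\<Sum>b\<in>Basis. J b) = (\<Sum>b\<in>Basis. T b) + (\<integral>x. w x * (\<phi> x)\<^sup>2 / u x \<partial>?M)"
    using ident by (simp add: sum_subtractf)
  also have "(\<Sum>b\<in>Basis. T b) \<le> (\<Sum>b\<in>Basis. J b / 2 + 2 * A * (L2_norm ?M (partials [b] \<phi>))\<^sup>2)"
    by (intro sum_mono TJ)
  also have "\<dots> = (\<Sum>b\<in>Basis. J b) / 2 + 2 * A * (\<Sum>b\<in>Basis. (L2_norm ?M (partials [b] \<phi>))\<^sup>2)"
    by (simp add: sum.distrib sum_divide_distrib sum_distrib_left)
  also have "\<dots> \<le> (\<Sum>b\<in>Basis. J b) / 2 + 2 * A * ?E"
    using A by (intro add_left_mono mult_left_mono) (auto simp: H1_sq_def)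
  \<comment> \<open>Moving half of the sum of \<open>J\<close> to the left doubles the remaining
    terms.\<close>
  finally have sumJ: "(\<Sum>b\<in>Basis. J b) \<le> 2 * (2 * A + 2 * L2_norm ?M w / c) * ?E"
    using R by (simp add: algebra_simps)
  \<comment> \<open>Coercivity: the lower bound \<open>a0\<close> recovers the L^2 norm from the
    weighted quadratic term. It also makes every \<open>J b\<close> nonnegative, so one direction is
    bounded by the sum.\<close>
  have J0: "a0 * (L2_norm ?M (X b))\<^sup>2 \<le> J b" if b: "b \<in> Basis" for b
  proof -
    have iX: "integrable ?M (\<lambda>x. (X b x)\<^sup>2)" using XL2[OF b] by (simp add: L2_def)
    have "a0 * (L2_norm ?M (X b))\<^sup>2 = (\<integral>x. a0 * (X b x)\<^sup>2 \<partial>?M)"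
      by (simp add: L2_norm_def)
    also have "\<dots> \<le> J b"
      unfolding J_def
    proof (rule integral_mono_AE)
      show "AE x in ?M. a0 * (X b x)\<^sup>2 \<le> a x * X b x * X b x"
        using a(3) by eventually_elim (simp add: power2_eq_square mult_right_mono mult.assoc)
    qed (use iX iJ[OF b] in auto)
    finally show ?thesis .
  qed
  have J_nonneg: "0 \<le> J b" if "b \<in> Basis" for b
    using order_trans[OF _ J0[OF that]] a(2) by simp
  have "a0 * (L2_norm ?M (X b))\<^sup>2 \<le> (\<Sum>b\<in>Basis. J b)"
    by (rule order_trans[OF J0[OF b]]) (rule member_le_sum[OF b J_nonneg], auto)
  then have "a0 * (L2_norm ?M (X b))\<^sup>2 \<le> 2 * (2 * A + 2 * L2_norm ?M w / c) * ?E" using sumJ by linarith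
  then have "(L2_norm ?M (X b))\<^sup>2 \<le> 2 / a0 * (2 * A + 2 * L2_norm ?M w / c) * ?E"
    using a(2) by (simp add: field_simps)
  then have "L2_norm ?M (X b) \<le> sqrt (2 / a0 * (2 * A + 2 * L2_norm ?M w / c) * ?E)"
    by (rule real_le_rsqrt)
  then show "L2_norm ?M (\<lambda>x. \<phi> x * p b x / u x) \<le> sqrt (2 / a0 * (2 * A + 2 * L2_norm ?M w / c)) * sqrt ?E"
    unfolding X_def[abs_def] real_sqrt_mult .
qed

text \<open>To be read with \<open>u\<close> the true state, \<open>v\<close> the difference of
  states and \<open>r\<close> the difference of coefficients. Testing the divergence with
  \<phi>\<open>/u\<close> isolates the pairing of \<open>r\<close> with \<phi>; each remaining
  integral contains \<open>v\<close> or one of its derivatives, a coefficient bounded through 1/c,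
  and one of \<phi>, its partial derivatives, or \<phi> times the logarithmic gradient of
  \<open>u\<close>.\<close>

lemma dual_estimate:
  fixes S :: "'a::euclidean_space set"
  assumes S: "open S" "bounded S"
    and a: "a \<in> borel_measurable (lebesgue_on S)" "AE x in lebesgue_on S. \<bar>a x\<bar> \<le> A" "A \<ge> 0"
    and u: "u \<in> L2 (lebesgue_on S)" and p: "\<And>b. b \<in> Basis \<Longrightarrow> p b \<in> L2 (lebesgue_on S)"
    and up: "\<And>b. b \<in> Basis \<Longrightarrow> has_weak_deriv S [b] u (p b)"
    and c: "c > 0" "AE x in lebesgue_on S. c \<le> \<bar>u x\<bar>"
    and v: "v \<in> L2 (lebesgue_on S)" and d: "\<And>b. b \<in> Basis \<Longrightarrow> d b \<in> L2 (lebesgue_on S)"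
    and W: "W \<in> L2 (lebesgue_on S)" and div: "has_weak_div S F W"
    and F: "\<And>x b. b \<in> Basis \<Longrightarrow> F x \<bullet> b = a x * d b x"
    and q: "q \<in> borel_measurable (lebesgue_on S)" "AE x in lebesgue_on S. \<bar>q x\<bar> \<le> Q" "Q \<ge> 0"
    and r: "r \<in> L2 (lebesgue_on S)"
    and Weq: "AE x in lebesgue_on S. W x = q x * v x + r x * u x"
    and \<phi>: "\<phi> \<in> test_functions S"
    and X: "\<And>b. b \<in> Basis \<Longrightarrow> (\<lambda>x. \<phi> x * p b x / u x) \<in> L2 (lebesgue_on S)"
      "\<And>b. b \<in> Basis \<Longrightarrow> L2_norm (lebesgue_on S) (\<lambda>x. \<phi> x * p b x / u x) \<le> C * sqrt (H1_sq S \<phi> (\<lambda>b. partials [b] \<phi>))"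
    and C: "C \<ge> 0"
  shows "\<bar>\<integral>x. r x * \<phi> x \<partial>lebesgue_on S\<bar> \<le>
    (Q / c + real DIM('a) * (A / c * (1 + C))) * sqrt (H1_sq S v d) * sqrt (H1_sq S \<phi> (\<lambda>b. partials [b] \<phi>))"
proof -
  let ?M = "lebesgue_on S"
  let ?E = "sqrt (H1_sq S \<phi> (\<lambda>b. partials [b] \<phi>))" and ?D = "sqrt (H1_sq S v d)"
  have um [measurable]: "u \<in> borel_measurable ?M" using u by (simp add: L2_def)
  note [measurable] = a(1) q(1)
  have inv: "AE x in ?M. \<bar>1 / u x\<bar> \<le> 1 / c"
    using c(2) by eventually_elim (use c(1) in \<open>auto intro: frac_le\<close>)
  have au: "AE x in ?M. \<bar>a x / u x\<bar> \<le> A / c"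
    using inv a(2)
  proof eventually_elim
    case (elim x)
    then have "\<bar>a x\<bar> * \<bar>1 / u x\<bar> \<le> A * (1 / c)" using a(3) by (intro mult_mono) auto
    then show ?case by (simp add: abs_mult[symmetric])
  qed
  have qu: "AE x in ?M. \<bar>q x / u x\<bar> \<le> Q / c"
    using inv q(2)
  proof eventually_elim
    case (elim x)
    then have "\<bar>q x\<bar> * \<bar>1 / u x\<bar> \<le> Q * (1 / c)" using q(3) by (intro mult_mono) auto
    then show ?case by (simp add: abs_mult[symmetric])
  qed
  have Ac: "A / c \<ge> 0" "Q / c \<ge> 0" using a(3) q(3) c(1) by auto
  have aum: "(\<lambda>x. a x / u x) \<in> borel_measurable ?M" "(\<lambda>x. q x / u x) \<in> borel_measurable ?M" by measurable
  note auL2 = L2_mult_bounded[OF d aum(1) au Ac(1)] and quL2 = L2_mult_bounded[OF v aum(2) qu Ac(2)]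
  have \<phi>L2: "\<phi> \<in> L2 ?M" by (rule L2_test_functions[OF \<phi> S(1)])
  have d\<phi>: "partials [b] \<phi> \<in> L2 ?M" if "b \<in> Basis" for b
    by (rule L2_test_functions[OF test_functions_partial[OF \<phi> that] S(1)])
  have FL2: "(\<lambda>x. F x \<bullet> b) \<in> L2 ?M" if b: "b \<in> Basis" for b
    using L2_mult_bounded(1)[OF d[OF b] a(1,2,3)] by (simp add: F[OF b])
  \<comment> \<open>The two powers of \<open>u\<close> in the denominator of the second term are
    split: one goes to the bounded coefficient, the other forms the logarithmic gradient covered by
    the assumption.\<close>
  define T1 where "T1 b = (\<integral>x. (a x / u x * d b x) * partials [b] \<phi> x \<partial>?M)" for b
  define T2 where "T2 b = (\<integral>x. (a x / u x * d b x) * (\<phi> x * p b x / u x) \<partial>?M)" for b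
  have WL: "(\<integral>x. W x * \<phi> x / u x \<partial>?M) = (\<integral>x. (q x / u x * v x) * \<phi> x + r x * \<phi> x \<partial>?M)"
  proof (rule integral_cong_AE)
    have [measurable]: "W \<in> borel_measurable ?M" "v \<in> borel_measurable ?M" "r \<in> borel_measurable ?M" "\<phi> \<in> borel_measurable ?M"
      using W v r \<phi>L2 by (auto simp: L2_def)
    show "(\<lambda>x. W x * \<phi> x / u x) \<in> borel_measurable ?M" "(\<lambda>x. (q x / u x * v x) * \<phi> x + r x * \<phi> x) \<in> borel_measurable ?M"
      by measurable
    show "AE x in ?M. W x * \<phi> x / u x = (q x / u x * v x) * \<phi> x + r x * \<phi> x"
      using Weq c(2)
    proof eventually_elim
      case (elim x)
      then have "u x \<noteq> 0" using c(1) by auto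
      then show ?case using elim by (simp add: field_simps)
    qed
  qed
  also have "\<dots> = (\<integral>x. (q x / u x * v x) * \<phi> x \<partial>?M) + (\<integral>x. r x * \<phi> x \<partial>?M)"
    by (intro Bochner_Integration.integral_add L2_Cauchy_Schwarz(1) quL2 r \<phi>L2)
  finally have WL: "(\<integral>x. W x * \<phi> x / u x \<partial>?M) = (\<integral>x. (q x / u x * v x) * \<phi> x \<partial>?M) + (\<integral>x. r x * \<phi> x \<partial>?M)" .
  have "(\<integral>x. (F x \<bullet> b) * partials [b] \<phi> x / u x \<partial>?M) = T1 b"
    "(\<integral>x. (F x \<bullet> b) * \<phi> x * p b x / (u x)\<^sup>2 \<partial>?M) = T2 b" if b: "b \<in> Basis" for b
    unfolding T1_def T2_def
    by (intro Bochner_Integration.integral_cong refl; simp add: F[OF b] power2_eq_square)+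
  then have "(\<Sum>b\<in>Basis. T1 b - T2 b) = - (\<integral>x. W x * \<phi> x / u x \<partial>?M)"
    using weak_div_test_divide[OF S FL2 W div u p up c \<phi>] by simp
  then have eq: "(\<integral>x. r x * \<phi> x \<partial>?M) = - (\<integral>x. (q x / u x * v x) * \<phi> x \<partial>?M) - (\<Sum>b\<in>Basis. T1 b - T2 b)"
    using WL by simp
  have b1: "\<bar>\<integral>x. (q x / u x * v x) * \<phi> x \<partial>?M\<bar> \<le> (Q / c * ?D) * ?E"
  proof -
    have "\<bar>\<integral>x. (q x / u x * v x) * \<phi> x \<partial>?M\<bar> \<le> L2_norm ?M (\<lambda>x. q x / u x * v x) * L2_norm ?M \<phi>"
      by (rule L2_Cauchy_Schwarz(3)[OF quL2(1) \<phi>L2])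
    also have "\<dots> \<le> (Q / c * ?D) * ?E"
      by (intro mult_mono L2_norm_le_H1 L2_norm_nonneg order_trans[OF quL2(2)] mult_left_mono mult_nonneg_nonneg Ac)
        (simp_all add: H1_sq_nonneg)
    finally show ?thesis .
  qed
  have b2: "\<bar>T1 b - T2 b\<bar> \<le> (A / c * (1 + C)) * ?D * ?E" if b: "b \<in> Basis" for b
  proof -
    have n: "L2_norm ?M (\<lambda>x. a x / u x * d b x) \<le> A / c * ?D"
      by (rule order_trans[OF auL2(2)[OF b]], intro mult_left_mono L2_norm_le_H1 b Ac)
    have AD: "0 \<le> A / c * ?D" by (intro mult_nonneg_nonneg Ac) (simp add: H1_sq_nonneg)
    have "\<bar>T1 b\<bar> \<le> L2_norm ?M (\<lambda>x. a x / u x * d b x) * L2_norm ?M (partials [b] \<phi>)"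
      unfolding T1_def by (rule L2_Cauchy_Schwarz(3)[OF auL2(1)[OF b] d\<phi>[OF b]])
    also have "\<dots> \<le> (A / c * ?D) * ?E"
      by (intro mult_mono n AD L2_norm_nonneg L2_norm_le_H1(2)[of _ _ "\<lambda>b. partials [b] \<phi>"] b)
    finally have 1: "\<bar>T1 b\<bar> \<le> (A / c * ?D) * ?E" .
    have "\<bar>T2 b\<bar> \<le> L2_norm ?M (\<lambda>x. a x / u x * d b x) * L2_norm ?M (\<lambda>x. \<phi> x * p b x / u x)"
      unfolding T2_def by (rule L2_Cauchy_Schwarz(3)[OF auL2(1)[OF b] X(1)[OF b]])
    also have "\<dots> \<le> (A / c * ?D) * (C * ?E)"
      by (intro mult_mono n AD L2_norm_nonneg X(2) b)
    finally have 2: "\<bar>T2 b\<bar> \<le> (A / c * ?D) * (C * ?E)" .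
    have "\<bar>T1 b - T2 b\<bar> \<le> (A / c * ?D) * ?E + (A / c * ?D) * (C * ?E)"
      using 1 2 by linarith
    also have "\<dots> = (A / c * (1 + C)) * ?D * ?E" by (simp add: algebra_simps add_divide_distrib)
    finally show ?thesis .
  qed
  have "\<bar>\<integral>x. r x * \<phi> x \<partial>?M\<bar> \<le> \<bar>\<integral>x. (q x / u x * v x) * \<phi> x \<partial>?M\<bar> + (\<Sum>b\<in>Basis. \<bar>T1 b - T2 b\<bar>)"
    using eq sum_abs[of "\<lambda>b. T1 b - T2 b" "Basis"] by linarith
  also have "\<dots> \<le> (Q / c * ?D) * ?E + (\<Sum>b\<in>(Basis::'a set). (A / c * (1 + C)) * ?D * ?E)"
    by (intro add_mono b1 sum_mono b2)
  also have "\<dots> = (Q / c + real DIM('a) * (A / c * (1 + C))) * ?D * ?E"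
    by (simp add: algebra_simps)
  finally show ?thesis .
qed

section \<open>Sobolev--Slobodeckij norms\<close>

text \<open>A point between the radii R/2^(k+1) and R/2^k is covered by the k-th term of a sum over
  balls, whose volumes are explicit; overlaps only increase the sum. With d the dimension, the terms
  are geometric with ratio 2^(p - d), which is less than 1.\<close>

lemma nn_integral_norm_powr_cball:
  fixes p R :: real
  assumes p: "0 \<le> p" "p < real DIM('a::euclidean_space)" and R: "R > 0"
  shows "(\<integral>\<^sup>+z. ennreal (norm (z::'a) powr (- p)) * indicator (cball 0 R) z \<partial>lborel) < \<infinity>"
proof -
  let ?d = "DIM('a)"
  define r where "r k = R / 2 ^ k" for k :: nat
  have r: "r k > 0" for k using R by (simp add: r_def)
  define V where "V = unit_ball_vol (real ?d)"
  have V: "V \<ge> 0" by (simp add: V_def)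
  define c where "c k = r (Suc k) powr (- p)" for k
  have le: "ennreal (norm z powr (- p)) * indicator (cball 0 R) z \<le>
      (\<Sum>k. ennreal (c k) * indicator (cball 0 (r k)) z)" for z :: 'a
  \<comment> \<open>The origin contributes nothing, since 0 \<open>powr\<close> any exponent is
    0.\<close>
  proof (cases "z \<noteq> 0 \<and> norm z \<le> R")
    case True
    then have z: "norm z > 0" "norm z \<le> R" by auto
    have "\<exists>k. r k < norm z"
    proof -
      obtain k where "R / norm z < 2 ^ k" using real_arch_pow[of 2] by auto
      then have "r k < norm z" using z by (simp add: r_def field_simps)
      then show ?thesis by blast
    qed
    define k where "k = (LEAST k. r k < norm z)"
    have k: "r k < norm z" unfolding k_def using \<open>\<exists>k. r k < norm z\<close> by (rule LeastI_ex)
    have "k \<noteq> 0" using k z(2) by (intro notI) (simp add: r_def)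
    then obtain j where j: "k = Suc j" by (cases k) auto
    have "\<not> r j < norm z" using not_less_Least[of j "\<lambda>k. r k < norm z"] j by (simp add: k_def)
    then have zj: "norm z \<le> r j" by simp
    have "norm z powr (- p) \<le> c j"
      unfolding c_def using k j p(1) r by (intro powr_mono2') auto
    then have "ennreal (norm z powr (- p)) * indicator (cball 0 R) z \<le> ennreal (c j) * indicator (cball 0 (r j)) z"
      using zj z by (simp add: ennreal_leI)
    moreover define T where "T k = ennreal (c k) * indicator (cball 0 (r k)) z" for k
    have "T j \<le> (\<Sum>k. T k)" using sum_le_suminf[of T "{j}"] by simp
    ultimately show ?thesis unfolding T_def by (rule order_trans)
  qed (auto simp: indicator_def)
  have "(\<integral>\<^sup>+z. ennreal (norm (z::'a) powr (- p)) * indicator (cball 0 R) z \<partial>lborel) \<le>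
      (\<integral>\<^sup>+z. (\<Sum>k. ennreal (c k) * indicator (cball (0::'a) (r k)) z) \<partial>lborel)"
    using le by (rule nn_integral_mono)
  also have "\<dots> = (\<Sum>k. \<integral>\<^sup>+z. ennreal (c k) * indicator (cball (0::'a) (r k)) z \<partial>lborel)"
    by (rule nn_integral_suminf)
      (intro borel_measurable_times_ennreal borel_measurable_const borel_measurable_indicator, simp)
  also have "\<dots> = (\<Sum>k. ennreal (c k * (V * r k ^ ?d)))"
  proof (intro suminf_cong)
    fix k
    have "(\<integral>\<^sup>+z. ennreal (c k) * indicator (cball (0::'a) (r k)) z \<partial>lborel) = ennreal (c k) * emeasure lborel (cball (0::'a) (r k))"
      by (rule nn_integral_cmult_indicator) auto
    also have "\<dots> = ennreal (c k * (V * r k ^ ?d))"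
      using r[of k] V by (subst emeasure_cball) (auto simp: V_def ennreal_mult c_def)
    finally show "(\<integral>\<^sup>+z. ennreal (c k) * indicator (cball (0::'a) (r k)) z \<partial>lborel) = ennreal (c k * (V * r k ^ ?d))" .
  qed
  also have "\<dots> = (\<Sum>k. ennreal ((2 powr p * V * R powr (real ?d - p)) * (2 powr (p - real ?d)) ^ k))"
  proof (intro suminf_cong arg_cong[where f=ennreal])
    fix k
    have 1: "r k ^ ?d = r k powr real ?d" using r by (simp add: powr_realpow)
    have half: "r (Suc k) = r k / 2" by (simp add: r_def)
    have "(r k / 2) powr (- p) = r k powr (- p) / 2 powr (- p)"
      by (rule powr_divide)
    also have "\<dots> = 2 powr p * r k powr (- p)"
      by (simp only: powr_minus[of 2 p] divide_inverse inverse_inverse_eq mult.commute)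
    finally have 2: "c k = 2 powr p * r k powr (- p)" unfolding c_def half .
    have "r k = R * 2 powr (- real k)"
      using powr_minus[of 2 "real k"] by (simp add: r_def powr_realpow divide_inverse)
    then have 3: "r k powr (real ?d - p) = R powr (real ?d - p) * 2 powr (- real k * (real ?d - p))"
      using R by (simp add: powr_mult powr_powr)
    have "2 powr (- real k * (real ?d - p)) = 2 powr ((p - real ?d) * real k)" by (simp add: algebra_simps)
    also have "\<dots> = (2 powr (p - real ?d)) ^ k" by (simp add: powr_powr[symmetric] powr_realpow)
    finally have 4: "2 powr (- real k * (real ?d - p)) = (2 powr (p - real ?d)) ^ k" .
    have "c k * (V * r k ^ ?d) = 2 powr p * V * (r k powr (- p) * r k powr real ?d)"
      unfolding 1 2 by (simp only: mult_ac)
    also have "r k powr (- p) * r k powr real ?d = r k powr (real ?d - p)" by (simp add: powr_add[symmetric])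
    finally show "c k * (V * r k ^ ?d) = 2 powr p * V * R powr (real ?d - p) * (2 powr (p - real ?d)) ^ k"
      unfolding 3 4 by (simp only: mult.assoc)
  qed
  also have "\<dots> < \<infinity>"
  proof -
    have sm: "summable (\<lambda>k. (2 powr p * V * R powr (real ?d - p)) * (2 powr (p - real ?d)) ^ k)"
    proof (intro summable_mult summable_geometric)
      show "norm (2 powr (p - real ?d)) < 1" using powr_less_one[of 2 "p - real ?d"] p(2) by simp
    qed
    have nn: "0 \<le> (2 powr p * V * R powr (real ?d - p)) * (2 powr (p - real ?d)) ^ k" for k
      by (intro mult_nonneg_nonneg V powr_ge_zero zero_le_power)
    show ?thesis unfolding suminf_ennreal2[OF nn sm] infinity_ennreal_def by (rule ennreal_less_top)
  qed
  finally show ?thesis .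
qed

lemma gagliardo_lborel:
  fixes S :: "'a::euclidean_space set"
  assumes "open S"
  shows "gagliardo \<sigma> S f = (\<integral>\<^sup>+x. (\<integral>\<^sup>+y. ennreal ((f x - f y)\<^sup>2 / norm (x - y) powr (real DIM('a) + 2 * \<sigma>))
    * indicator S y \<partial>lborel) * indicator S x \<partial>lborel)"
  unfolding gagliardo_def nn_integral_restrict_space[OF open_sets_lebesgue[OF assms]] nn_integral_completion ..

lemma gagliardo_cong_AE:
  assumes "AE x in lebesgue_on S. f x = g x"
  shows "gagliardo \<sigma> S f = gagliardo \<sigma> S g"
  unfolding gagliardo_def
proof (rule nn_integral_cong_AE)
  show "AE x in lebesgue_on S. (\<integral>\<^sup>+y. ennreal ((f x - f y)\<^sup>2 / norm (x - y) powr (real DIM('a) + 2 * \<sigma>)) \<partial>lebesgue_on S) =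
     (\<integral>\<^sup>+y. ennreal ((g x - g y)\<^sup>2 / norm (x - y) powr (real DIM('a) + 2 * \<sigma>)) \<partial>lebesgue_on S)"
    using assms
  proof eventually_elim
    case (elim x)
    show ?case
    proof (rule nn_integral_cong_AE)
      show "AE y in lebesgue_on S. ennreal ((f x - f y)\<^sup>2 / norm (x - y) powr (real DIM('a) + 2 * \<sigma>)) =
          ennreal ((g x - g y)\<^sup>2 / norm (x - y) powr (real DIM('a) + 2 * \<sigma>))"
        using assms by eventually_elim (simp add: elim)
    qed
  qed
qed

text \<open>Borel measurability on the whole space makes the inner integral measurable in the outer
  variable, so both integrals are additive. Lebesgue measurable functions are fed in through Borel
  representatives.\<close>

lemma gagliardo_diff_le:
  fixes S :: "'a::euclidean_space set"
  assumes S: "open S" and [measurable]: "f \<in> borel_measurable borel" "g \<in> borel_measurable borel"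
  shows "gagliardo \<sigma> S (\<lambda>x. f x - g x) \<le> 2 * gagliardo \<sigma> S f + 2 * gagliardo \<sigma> S g"
proof -
  have [measurable]: "S \<in> sets borel" using S by simp
  let ?k = "\<lambda>x y. norm (x - y) powr (real DIM('a) + 2 * \<sigma>)"
  let ?q = "\<lambda>h x y. ennreal ((h x - h y)\<^sup>2 / ?k x y)"
  have pw: "?q (\<lambda>x. f x - g x) x y \<le> 2 * ?q f x y + 2 * ?q g x y" for x y
  proof -
    have "((f x - g x) - (f y - g y))\<^sup>2 \<le> 2 * (f x - f y)\<^sup>2 + 2 * (g x - g y)\<^sup>2"
      using zero_le_power2[of "(f x - f y) + (g x - g y)"] by (simp add: power2_eq_square algebra_simps)
    then have "((f x - g x) - (f y - g y))\<^sup>2 / ?k x y \<le> (2 * (f x - f y)\<^sup>2 + 2 * (g x - g y)\<^sup>2) / ?k x y"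
      by (rule divide_right_mono) simp
    then show ?thesis
      by (simp add: two_ennreal ennreal_plus[symmetric] ennreal_leI add_divide_distrib del: ennreal_plus)
  qed
  have "gagliardo \<sigma> S (\<lambda>x. f x - g x) \<le> (\<integral>\<^sup>+x. (\<integral>\<^sup>+y. (2 * ?q f x y + 2 * ?q g x y) * indicator S y \<partial>lborel) * indicator S x \<partial>lborel)"
    unfolding gagliardo_lborel[OF S] by (intro nn_integral_mono mult_right_mono pw) auto
  also have "\<dots> = (\<integral>\<^sup>+x. 2 * ((\<integral>\<^sup>+y. ?q f x y * indicator S y \<partial>lborel) * indicator S x) +
     2 * ((\<integral>\<^sup>+y. ?q g x y * indicator S y \<partial>lborel) * indicator S x) \<partial>lborel)"
  proof (rule nn_integral_cong)
    fix x
    have "(\<integral>\<^sup>+y. (2 * ?q f x y + 2 * ?q g x y) * indicator S y \<partial>lborel) =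
       (\<integral>\<^sup>+y. 2 * (?q f x y * indicator S y) + 2 * (?q g x y * indicator S y) \<partial>lborel)"
      by (intro nn_integral_cong) (simp add: distrib_right mult.assoc)
    also have "\<dots> = 2 * (\<integral>\<^sup>+y. ?q f x y * indicator S y \<partial>lborel) + 2 * (\<integral>\<^sup>+y. ?q g x y * indicator S y \<partial>lborel)"
      by (subst nn_integral_add) (simp_all add: nn_integral_cmult)
    finally show "(\<integral>\<^sup>+y. (2 * ?q f x y + 2 * ?q g x y) * indicator S y \<partial>lborel) * indicator S x =
        2 * ((\<integral>\<^sup>+y. ?q f x y * indicator S y \<partial>lborel) * indicator S x) +
        2 * ((\<integral>\<^sup>+y. ?q g x y * indicator S y \<partial>lborel) * indicator S x)"
      by (simp add: distrib_right mult.assoc)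
  qed
  also have "\<dots> = 2 * gagliardo \<sigma> S f + 2 * gagliardo \<sigma> S g"
    unfolding gagliardo_lborel[OF S] by (subst nn_integral_add) (simp_all add: nn_integral_cmult)
  finally show ?thesis .
qed

text \<open>With d the dimension, the Lipschitz bound cancels two powers of the distance and leaves
  the kernel |x - y|^(-p) with p = d + 2\<sigma> - 2. It is integrable on bounded sets because
  \<sigma> < 1, and p is nonnegative because the dimension is at least 2.\<close>

lemma gagliardo_test_finite:
  fixes S :: "'a::euclidean_space set"
  assumes S: "open S" "bounded S" and \<sigma>: "0 < \<sigma>" "\<sigma> < 1" and d: "DIM('a) \<ge> 2" and \<phi>: "\<phi> \<in> test_functions T"
  shows "gagliardo \<sigma> S \<phi> < \<infinity>"
proof -
  obtain L where L: "L \<ge> 0" "\<And>x y. \<bar>\<phi> x - \<phi> y\<bar> \<le> L * norm (x - y)"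
    using test_functions_lipschitz[OF \<phi>] by blast
  obtain R where R: "R > 0" "\<And>x. x \<in> S \<Longrightarrow> norm x \<le> R" using S(2) by (auto simp: bounded_pos)
  define p where "p = real DIM('a) + 2 * \<sigma> - 2"
  have p: "0 \<le> p" "p < real DIM('a)" using \<sigma> d by (auto simp: p_def)
  define I where "I = (\<integral>\<^sup>+z. ennreal (norm (z::'a) powr (- p)) * indicator (cball 0 (2 * R)) z \<partial>lborel)"
  have Km: "(\<lambda>z::'a. ennreal (norm z powr (- p)) * indicator (cball 0 (2 * R)) z) \<in> borel_measurable borel"
  proof (rule borel_measurable_times_ennreal)
    show "(\<lambda>z::'a. ennreal (norm z powr (- p))) \<in> borel_measurable borel" by measurable
    show "(indicator (cball 0 (2 * R)) :: 'a \<Rightarrow> ennreal) \<in> borel_measurable borel"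
      by (rule borel_measurable_indicator) simp
  qed
  have I: "I < \<infinity>" unfolding I_def using p R(1) by (intro nn_integral_norm_powr_cball) auto
  have pw: "ennreal ((\<phi> x - \<phi> y)\<^sup>2 / norm (x - y) powr (real DIM('a) + 2 * \<sigma>)) * indicator S y \<le>
      ennreal (L\<^sup>2) * (ennreal (norm (x - y) powr (- p)) * indicator (cball 0 (2 * R)) (x - y))" if x: "x \<in> S" for x y
  \<comment> \<open>On the diagonal the quotient is 0/0, which is 0.\<close>
  proof (cases "y \<in> S \<and> x \<noteq> y")
    case True
    then have n: "norm (x - y) > 0" "norm (x - y) \<le> 2 * R"
      using R(2)[OF x] R(2)[of y] norm_triangle_ineq4[of x y] by auto
    have "\<bar>\<phi> x - \<phi> y\<bar>\<^sup>2 \<le> (L * norm (x - y))\<^sup>2" by (intro power_mono L) auto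
    then have "(\<phi> x - \<phi> y)\<^sup>2 / norm (x - y) powr (real DIM('a) + 2 * \<sigma>) \<le>
        (L * norm (x - y))\<^sup>2 / norm (x - y) powr (real DIM('a) + 2 * \<sigma>)"
      by (intro divide_right_mono) auto
    also have "\<dots> = L\<^sup>2 * (norm (x - y) powr 2 / norm (x - y) powr (real DIM('a) + 2 * \<sigma>))"
      using n by (simp add: power_mult_distrib powr_numeral)
    also have "\<dots> = L\<^sup>2 * norm (x - y) powr (- p)"
    proof -
      have "- p = 2 - (real DIM('a) + 2 * \<sigma>)" by (simp add: p_def)
      then show ?thesis by (simp only: powr_diff)
    qed
    finally have "ennreal ((\<phi> x - \<phi> y)\<^sup>2 / norm (x - y) powr (real DIM('a) + 2 * \<sigma>)) \<le> ennreal (L\<^sup>2) * ennreal (norm (x - y) powr (- p))"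
      by (simp add: ennreal_mult[symmetric] ennreal_leI)
    then show ?thesis using True n by simp
  qed auto
  have "gagliardo \<sigma> S \<phi> \<le> (\<integral>\<^sup>+x. (ennreal (L\<^sup>2) * I) * indicator S (x::'a) \<partial>lborel)"
    unfolding gagliardo_lborel[OF S(1)]
  proof (rule nn_integral_mono)
    fix x :: 'a
    show "(\<integral>\<^sup>+y. ennreal ((\<phi> x - \<phi> y)\<^sup>2 / norm (x - y) powr (real DIM('a) + 2 * \<sigma>)) * indicator S y \<partial>lborel) * indicator S x
        \<le> ennreal (L\<^sup>2) * I * indicator S x"
    proof (cases "x \<in> S")
      case True
      have "(\<integral>\<^sup>+y. ennreal ((\<phi> x - \<phi> y)\<^sup>2 / norm (x - y) powr (real DIM('a) + 2 * \<sigma>)) * indicator S y \<partial>lborel) \<le>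
          (\<integral>\<^sup>+y. ennreal (L\<^sup>2) * (ennreal (norm (x - y) powr (- p)) * indicator (cball 0 (2 * R)) (x - y)) \<partial>lborel)"
        using pw[OF True] by (rule nn_integral_mono)
      also have "\<dots> = (\<integral>\<^sup>+z. ennreal (L\<^sup>2) * (ennreal (norm (z::'a) powr (- p)) * indicator (cball 0 (2 * R)) z) \<partial>lborel)"
        by (rule nn_integral_reflect[of "\<lambda>z. ennreal (L\<^sup>2) * (ennreal (norm z powr (- p)) * indicator (cball 0 (2 * R)) z)" x])
          (intro borel_measurable_times_ennreal[OF borel_measurable_const Km])
      also have "\<dots> = ennreal (L\<^sup>2) * I" unfolding I_def by (rule nn_integral_cmult) (simp add: Km)
      finally show ?thesis using True by simp
    qed simp
  qed
  also have "\<dots> = (ennreal (L\<^sup>2) * I) * emeasure lborel S"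
    using S(1) by (intro nn_integral_cmult_indicator) auto
  also have "\<dots> < \<infinity>"
    using I emeasure_bounded_finite[OF S(2)] by (simp add: ennreal_mult_less_top)
  finally show ?thesis .
qed

section \<open>Norms of order between one and two\<close>

lemma finite_dirs: "finite (dirs m :: 'a::euclidean_space list set)"
  unfolding dirs_def by (rule finite_lists_length_eq[OF finite_Basis])

lemma Hs_norm_sq_unfold:
  assumes "1 \<le> s" "s < 2"
  shows "Hs_norm_sq s S v = (\<integral>\<^sup>+x. ennreal ((weak_deriv S [] v x)\<^sup>2) \<partial>lebesgue_on S) +
    (\<Sum>b\<in>Basis. \<integral>\<^sup>+x. ennreal ((weak_deriv S [b] v x)\<^sup>2) \<partial>lebesgue_on S) +
    (if frac s = 0 then 0 else \<Sum>b\<in>Basis. gagliardo (frac s) S (weak_deriv S [b] v))"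
proof -
  have "\<lfloor>s\<rfloor> = 1" using assms by linarith
  then have n: "nat \<lfloor>s\<rfloor> = Suc 0" by simp
  have r: "(\<Sum>\<alpha>\<in>dirs (Suc 0). h \<alpha>) = (\<Sum>b\<in>Basis. h [b])" for h :: "'a list \<Rightarrow> ennreal"
    unfolding dirs_1 by (subst sum.reindex) (auto simp: inj_on_def)
  show ?thesis unfolding Hs_norm_sq_def n r by (simp add: atMost_Suc dirs_0 r add.commute)
qed

text \<open>Membership bounds only the chosen weak derivatives, and even the one of order zero is a
  choice; the last conclusion identifies it with \<open>v\<close> and thereby brings
  \<open>v\<close> itself into L^2.\<close>

lemma Hs_L2:
  assumes S: "open S" and s: "1 \<le> s" and v: "v \<in> Hs s S"
  shows "v \<in> L2 (lebesgue_on S)"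
    "b \<in> Basis \<Longrightarrow> has_weak_deriv S [b] v (weak_deriv S [b] v)"
    "b \<in> Basis \<Longrightarrow> weak_deriv S [b] v \<in> L2 (lebesgue_on S)"
    "AE x in lebesgue_on S. weak_deriv S [] v x = v x"
proof -
  have n: "Suc 0 \<le> nat \<lfloor>s\<rfloor>" using s by linarith
  have wd: "has_weak_deriv S \<alpha> v (weak_deriv S \<alpha> v)" and
    L2: "weak_deriv S \<alpha> v \<in> L2 (lebesgue_on S)" if \<alpha>: "\<alpha> \<in> dirs m" and m: "m \<le> nat \<lfloor>s\<rfloor>" for \<alpha> m
  proof -
    obtain w where "has_weak_deriv S \<alpha> v w" using v \<alpha> m unfolding Hs_def by blast
    then show wd: "has_weak_deriv S \<alpha> v (weak_deriv S \<alpha> v)" by (rule has_weak_deriv_weak_deriv)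
    let ?f = "\<lambda>\<alpha>. \<integral>\<^sup>+x. ennreal ((weak_deriv S \<alpha> v x)\<^sup>2) \<partial>lebesgue_on S"
    have "?f \<alpha> \<le> (\<Sum>\<alpha>\<in>dirs m. ?f \<alpha>)" by (rule member_le_sum[OF \<alpha>]) (auto simp: finite_dirs)
    also have "\<dots> \<le> (\<Sum>m\<le>nat \<lfloor>s\<rfloor>. \<Sum>\<alpha>\<in>dirs m. ?f \<alpha>)" by (rule member_le_sum) (use m in auto)
    also have "\<dots> \<le> Hs_norm_sq s S v" unfolding Hs_norm_sq_def by simp
    also have "\<dots> < \<infinity>" using v by (simp add: Hs_def)
    finally have "?f \<alpha> < \<infinity>" .
    then show "weak_deriv S \<alpha> v \<in> L2 (lebesgue_on S)"
      using wd by (intro L2I_nn_integral locally_integrable_measurable[OF S]) (simp_all add: has_weak_deriv_def)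
  qed
  have d0: "[] \<in> dirs 0" by (simp add: dirs_0)
  have d1: "[b] \<in> dirs (Suc 0)" if "b \<in> Basis" for b using that by (simp add: dirs_1)
  show "b \<in> Basis \<Longrightarrow> has_weak_deriv S [b] v (weak_deriv S [b] v)" using wd[OF d1 n] .
  show "b \<in> Basis \<Longrightarrow> weak_deriv S [b] v \<in> L2 (lebesgue_on S)" using L2[OF d1 n] .
  have li: "locally_integrable S v" using wd[OF d0] by (simp add: has_weak_deriv_def)
  show ae: "AE x in lebesgue_on S. weak_deriv S [] v x = v x"
    by (rule weak_deriv_AE_eq[OF S has_weak_deriv_Nil[OF li]])
  have vm: "v \<in> borel_measurable (lebesgue_on S)" by (rule locally_integrable_measurable[OF S li])
  show "v \<in> L2 (lebesgue_on S)"
  proof (rule L2_bounded[OF L2[OF d0] vm])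
    show "AE x in lebesgue_on S. \<bar>v x\<bar> \<le> 1 * \<bar>weak_deriv S [] v x\<bar>" using ae by eventually_elim simp
  qed simp
qed

text \<open>Replaces all the choices in the norm by explicit representatives; neither the integrals
  nor the Gagliardo seminorms see null sets.\<close>

lemma Hs_norm_sq_H1:
  assumes s: "1 \<le> s" "s < 2" and v: "v \<in> L2 (lebesgue_on S)" "\<And>b. b \<in> Basis \<Longrightarrow> d b \<in> L2 (lebesgue_on S)"
    and ae: "AE x in lebesgue_on S. weak_deriv S [] v x = v x"
      "\<And>b. b \<in> Basis \<Longrightarrow> AE x in lebesgue_on S. weak_deriv S [b] v x = d b x"
  shows "Hs_norm_sq s S v = ennreal (H1_sq S v d) + (if frac s = 0 then 0 else \<Sum>b\<in>Basis. gagliardo (frac s) S (d b))"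
proof -
  have 0: "(\<integral>\<^sup>+x. ennreal ((weak_deriv S [] v x)\<^sup>2) \<partial>lebesgue_on S) = ennreal ((L2_norm (lebesgue_on S) v)\<^sup>2)"
    unfolding L2_nn_integral[OF v(1), symmetric]
    by (rule nn_integral_cong_AE) (use ae(1) in \<open>eventually_elim, simp\<close>)
  have 1: "(\<integral>\<^sup>+x. ennreal ((weak_deriv S [b] v x)\<^sup>2) \<partial>lebesgue_on S) = ennreal ((L2_norm (lebesgue_on S) (d b))\<^sup>2)" if "b \<in> Basis" for b
    unfolding L2_nn_integral[OF v(2)[OF that], symmetric]
    by (rule nn_integral_cong_AE) (use ae(2)[OF that] in \<open>eventually_elim, simp\<close>)
  have 2: "gagliardo (frac s) S (weak_deriv S [b] v) = gagliardo (frac s) S (d b)" if "b \<in> Basis" for b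
    by (rule gagliardo_cong_AE[OF ae(2)[OF that]])
  show ?thesis unfolding Hs_norm_sq_unfold[OF s] by (simp add: 0 1 2 H1_sq_def sum_nonneg)
qed

section \<open>The stability estimate\<close>

lemma L2_norm_sq_diff_le:
  assumes f: "f \<in> L2 M" and g: "g \<in> L2 M"
  shows "(L2_norm M g)\<^sup>2 \<le> 2 * (L2_norm M f)\<^sup>2 + 2 * (L2_norm M (\<lambda>x. f x - g x))\<^sup>2"
proof -
  have i: "integrable M (\<lambda>x. (f x)\<^sup>2)" "integrable M (\<lambda>x. (g x)\<^sup>2)" "integrable M (\<lambda>x. (f x - g x)\<^sup>2)"
    using f g L2_diff[OF f g] by (auto simp: L2_def)
  have "(\<integral>x. (g x)\<^sup>2 \<partial>M) \<le> (\<integral>x. 2 * (f x)\<^sup>2 + 2 * (f x - g x)\<^sup>2 \<partial>M)"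
  proof (rule integral_mono)
    fix x show "(g x)\<^sup>2 \<le> 2 * (f x)\<^sup>2 + 2 * (f x - g x)\<^sup>2"
      using zero_le_power2[of "f x + (f x - g x)"] by (simp add: power2_eq_square algebra_simps)
  qed (use i in auto)
  then show ?thesis using i by (simp add: L2_norm_def)
qed

text \<open>
  Finiteness matters: \<open>Hs_norm\<close> is the junk value \<open>0\<close> when \<open>Hs_norm_sq\<close> is infinite, so convergence
  of \<open>Hs_norm\<close> to \<open>0\<close> says nothing by itself.
\<close>

lemma Hs_diff_test:
  fixes S :: "'a::euclidean_space set"
  assumes S: "open S" "bounded S" and s: "1 < s" "s < 2" and dim: "DIM('a) \<ge> 2"
    and v: "v \<in> Hs s S" and \<phi>: "\<phi> \<in> test_functions S"
  shows "Hs_norm_sq s S (\<lambda>x. v x - \<phi> x) < \<infinity>"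
    "H1_sq S (\<lambda>x. v x - \<phi> x) (\<lambda>b x. weak_deriv S [b] v x - partials [b] \<phi> x) \<le> (Hs_norm s S (\<lambda>x. v x - \<phi> x))\<^sup>2"
proof -
  let ?M = "lebesgue_on S" and ?e = "\<lambda>x. v x - \<phi> x" and ?d = "\<lambda>b x. weak_deriv S [b] v x - partials [b] \<phi> x"
  have s1: "1 \<le> s" using s by simp
  have "\<lfloor>s\<rfloor> = 1" using s by linarith
  then have fr: "frac s = s - 1" "frac s \<noteq> 0" using s by (auto simp: frac_def)
  have \<sigma>: "0 < frac s" "frac s < 1" using fr s by auto
  note vH = Hs_L2[OF S(1) s1 v]
  have \<phi>d: "partials [b] \<phi> \<in> test_functions S" if "b \<in> Basis" for b
    by (rule test_functions_partial[OF \<phi> that])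
  have eL2: "?e \<in> L2 ?M" by (rule L2_diff[OF vH(1) L2_test_functions[OF \<phi> S(1)]])
  have dL2: "?d b \<in> L2 ?M" if "b \<in> Basis" for b
    by (rule L2_diff[OF vH(3)[OF that] L2_test_functions[OF \<phi>d[OF that] S(1)]])
  have wd: "has_weak_deriv S [b] ?e (?d b)" if "b \<in> Basis" for b
    by (rule has_weak_deriv_diff[OF S(1) _ vH(2)[OF that] has_weak_deriv_smooth[OF S(1) test_functionsD(1)[OF \<phi>] that]])
      (use that in auto)
  obtain b0 :: 'a where "b0 \<in> Basis" using nonempty_Basis by blast
  then have li: "locally_integrable S ?e" using wd by (simp add: has_weak_deriv_def)
  have H1: "Hs_norm_sq s S ?e = ennreal (H1_sq S ?e ?d) + (if frac s = 0 then 0 else \<Sum>b\<in>Basis. gagliardo (frac s) S (?d b))"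
    using weak_deriv_AE_eq[OF S(1) has_weak_deriv_Nil[OF li]] weak_deriv_AE_eq[OF S(1) wd]
    by (intro Hs_norm_sq_H1[OF s1 s(2) eL2 dL2])
  \<comment> \<open>The seminorm of the weak derivative of \<open>v\<close> is finite as part of a
    finite norm, that of the test function by its Lipschitz bound. The Borel version
    \<open>h\<close> is what the inequality for differences accepts.\<close>
  have gag: "gagliardo (frac s) S (?d b) < \<infinity>" if b: "b \<in> Basis" for b
  proof -
    obtain h where h: "h \<in> borel_measurable borel" "\<And>x. x \<notin> S \<Longrightarrow> h x = 0" "AE x in ?M. h x = weak_deriv S [b] v x"
      by (rule borel_representative[OF S(1) L2_measurable[OF vH(3)[OF b]]]) (rule that)
    have "gagliardo (frac s) S (weak_deriv S [b] v) \<le> (\<Sum>b\<in>Basis. gagliardo (frac s) S (weak_deriv S [b] v))"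
      by (rule member_le_sum[OF b]) auto
    also have "\<dots> \<le> Hs_norm_sq s S v" unfolding Hs_norm_sq_unfold[OF s1 s(2)] using fr by simp
    also have "\<dots> < \<infinity>" using v by (simp add: Hs_def)
    finally have gh: "gagliardo (frac s) S h < \<infinity>" using gagliardo_cong_AE[OF h(3)] by simp
    have "AE x in ?M. ?d b x = h x - partials [b] \<phi> x" using h(3) by eventually_elim simp
    then have "gagliardo (frac s) S (?d b) = gagliardo (frac s) S (\<lambda>x. h x - partials [b] \<phi> x)"
      by (rule gagliardo_cong_AE)
    also have "\<dots> \<le> 2 * gagliardo (frac s) S h + 2 * gagliardo (frac s) S (partials [b] \<phi>)"
      by (rule gagliardo_diff_le[OF S(1) h(1) test_functions_measurable[OF \<phi>d[OF b]]])
    also have "\<dots> < \<infinity>"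
      using gh gagliardo_test_finite[OF S \<sigma> dim \<phi>d[OF b]] by (simp add: ennreal_mult_less_top)
    finally show ?thesis .
  qed
  then have "(\<Sum>b\<in>Basis. gagliardo (frac s) S (?d b)) < \<infinity>" by (subst infinity_ennreal_def, subst ennreal_sum_less_top) auto
  then show fin: "Hs_norm_sq s S ?e < \<infinity>" unfolding H1 by (auto simp: less_top)
  have "ennreal (H1_sq S ?e ?d) \<le> Hs_norm_sq s S ?e" unfolding H1 by simp
  then have "H1_sq S ?e ?d \<le> enn2real (Hs_norm_sq s S ?e)"
    using fin by (cases "Hs_norm_sq s S ?e") (auto simp: H1_sq_nonneg)
  then show "H1_sq S ?e ?d \<le> (Hs_norm s S ?e)\<^sup>2" by (simp add: Hs_norm_def)
qed

lemma Hs_norm_H1_le: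
  assumes S: "open S" and s: "1 \<le> s" "s < 2" and v: "v \<in> Hs s S"
  shows "H1_sq S v (\<lambda>b. weak_deriv S [b] v) \<le> (Hs_norm s S v)\<^sup>2"
proof -
  note vH = Hs_L2[OF S s(1) v]
  have "ennreal (H1_sq S v (\<lambda>b. weak_deriv S [b] v)) \<le> Hs_norm_sq s S v"
    by (subst Hs_norm_sq_H1[OF s vH(1,3,4)]) auto
  moreover have "Hs_norm_sq s S v < \<infinity>" using v by (simp add: Hs_def)
  ultimately have "H1_sq S v (\<lambda>b. weak_deriv S [b] v) \<le> enn2real (Hs_norm_sq s S v)"
    by (cases "Hs_norm_sq s S v") (auto simp: H1_sq_nonneg)
  then show ?thesis by (simp add: Hs_norm_def)
qed

text \<open>For \<phi> close to \<open>v\<close> in the unit ball, the squared H^1 norm of \<phi> is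
  at most 2 plus twice the squared error, by the parallelogram-type inequality for squares. Square
  integrability of \<open>r\<close> carries the pairing to the limit.\<close>

lemma H_neg_norm_le:
  fixes S :: "'a::euclidean_space set"
  assumes S: "open S" "bounded S" and s: "1 < s" "s < 2" and dim: "DIM('a) \<ge> 2"
    and r: "r \<in> L2 (lebesgue_on S)" and B: "B \<ge> 0"
    and le: "\<And>\<phi>. \<phi> \<in> test_functions S \<Longrightarrow>
      \<bar>\<integral>x. r x * \<phi> x \<partial>lebesgue_on S\<bar> \<le> B * sqrt (H1_sq S \<phi> (\<lambda>b. partials [b] \<phi>))"
  shows "H_neg_norm s S r \<le> ennreal (2 * B)"
  unfolding H_neg_norm_def dual_norm_def
proof (rule SUP_least)
  fix v assume "v \<in> {v \<in> Hs0 s S. Hs_norm s S v \<le> 1}"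
  then have v0: "v \<in> Hs0 s S" and v1: "Hs_norm s S v \<le> 1" by auto
  then have v: "v \<in> Hs s S" by (simp add: Hs0_def)
  obtain \<phi> :: "nat \<Rightarrow> 'a \<Rightarrow> real" where \<phi>: "\<And>n. \<phi> n \<in> test_functions S"
    and lim: "(\<lambda>n. Hs_norm s S (\<lambda>x. v x - \<phi> n x)) \<longlonglongrightarrow> 0"
    using v0 by (auto simp: Hs0_def)
  let ?M = "lebesgue_on S"
  let ?N = "\<lambda>n. Hs_norm s S (\<lambda>x. v x - \<phi> n x)"
  have s1: "1 \<le> s" using s by simp
  note vH = Hs_L2[OF S(1) s1 v]
  have Nn: "0 \<le> ?N n" for n unfolding Hs_norm_def by simp
  let ?H = "\<lambda>n. H1_sq S (\<lambda>x. v x - \<phi> n x) (\<lambda>b x. weak_deriv S [b] v x - partials [b] (\<phi> n) x)"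
  have H1N: "?H n \<le> (?N n)\<^sup>2" for n by (rule Hs_diff_test(2)[OF S s dim v \<phi>])
  have L2N: "L2_norm ?M (\<lambda>x. v x - \<phi> n x) \<le> ?N n" for n
    by (rule order_trans[OF L2_norm_le_H1(1)]) (rule real_le_lsqrt[OF Nn H1N])
  have Hv: "H1_sq S v (\<lambda>b. weak_deriv S [b] v) \<le> 1"
    using Hs_norm_H1_le[OF S(1) s1 s(2) v] power_mono[OF v1, of 2]
    by (simp add: Hs_norm_def)
  have H\<phi>: "H1_sq S (\<phi> n) (\<lambda>b. partials [b] (\<phi> n)) \<le> 2 + 2 * (?N n)\<^sup>2" for n
  proof -
    have "H1_sq S (\<phi> n) (\<lambda>b. partials [b] (\<phi> n)) \<le>
      (2 * (L2_norm ?M v)\<^sup>2 + 2 * (L2_norm ?M (\<lambda>x. v x - \<phi> n x))\<^sup>2) +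
      (\<Sum>b\<in>Basis. 2 * (L2_norm ?M (weak_deriv S [b] v))\<^sup>2 + 2 * (L2_norm ?M (\<lambda>x. weak_deriv S [b] v x - partials [b] (\<phi> n) x))\<^sup>2)"
      unfolding H1_sq_def
      by (intro add_mono sum_mono L2_norm_sq_diff_le vH(1,3) L2_test_functions[OF \<phi> S(1)]
          L2_test_functions[OF test_functions_partial[OF \<phi>] S(1)])
    also have "\<dots> = 2 * H1_sq S v (\<lambda>b. weak_deriv S [b] v) + 2 * ?H n"
      by (simp add: H1_sq_def sum.distrib sum_distrib_left algebra_simps)
    finally show ?thesis using Hv H1N[of n] by linarith
  qed
  have "(\<lambda>n. L2_norm ?M (\<lambda>x. v x - \<phi> n x)) \<longlonglongrightarrow> 0"
    by (rule tendsto_sandwich[OF _ _ tendsto_const lim]) (auto intro!: always_eventually L2N L2_norm_nonneg)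
  have conv: "(\<lambda>n. \<integral>x. r x * \<phi> n x \<partial>?M) \<longlonglongrightarrow> (\<integral>x. r x * v x \<partial>?M)"
  proof (rule LIM_zero_cancel, rule Lim_null_comparison)
    show "(\<lambda>n. L2_norm ?M r * L2_norm ?M (\<lambda>x. v x - \<phi> n x)) \<longlonglongrightarrow> 0"
      by (rule tendsto_mult_right_zero) fact
    have "norm ((\<integral>x. r x * \<phi> n x \<partial>?M) - (\<integral>x. r x * v x \<partial>?M)) \<le> L2_norm ?M r * L2_norm ?M (\<lambda>x. v x - \<phi> n x)" for n
    proof -
      have \<phi>L2: "\<phi> n \<in> L2 ?M" by (rule L2_test_functions[OF \<phi> S(1)])
      have "(\<integral>x. r x * (v x - \<phi> n x) \<partial>?M) = (\<integral>x. r x * v x \<partial>?M) - (\<integral>x. r x * \<phi> n x \<partial>?M)"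
        using L2_Cauchy_Schwarz(1)[OF r vH(1)] L2_Cauchy_Schwarz(1)[OF r \<phi>L2] by (simp add: right_diff_distrib)
      then show ?thesis
        using L2_Cauchy_Schwarz(3)[OF r L2_diff[OF vH(1) \<phi>L2]] by simp
    qed
    then show "\<forall>\<^sub>F n in sequentially. norm ((\<integral>x. r x * \<phi> n x \<partial>?M) - (\<integral>x. r x * v x \<partial>?M)) \<le>
        L2_norm ?M r * L2_norm ?M (\<lambda>x. v x - \<phi> n x)" by simp
  qed
  have "\<bar>\<integral>x. r x * v x \<partial>?M\<bar> \<le> B * sqrt (2 + 2 * 0\<^sup>2)"
  proof (rule LIMSEQ_le)
    show "(\<lambda>n. \<bar>\<integral>x. r x * \<phi> n x \<partial>?M\<bar>) \<longlonglongrightarrow> \<bar>\<integral>x. r x * v x \<partial>?M\<bar>" by (rule tendsto_rabs[OF conv])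
    show "(\<lambda>n. B * sqrt (2 + 2 * (?N n)\<^sup>2)) \<longlonglongrightarrow> B * sqrt (2 + 2 * 0\<^sup>2)" by (intro tendsto_intros lim)
    have "\<bar>\<integral>x. r x * \<phi> n x \<partial>?M\<bar> \<le> B * sqrt (2 + 2 * (?N n)\<^sup>2)" for n
      by (rule order_trans[OF le[OF \<phi>]]) (intro mult_left_mono B real_sqrt_le_mono H\<phi>)
    then show "\<exists>N. \<forall>n\<ge>N. \<bar>\<integral>x. r x * \<phi> n x \<partial>?M\<bar> \<le> B * sqrt (2 + 2 * (?N n)\<^sup>2)" by blast
  qed
  \<comment> \<open>The limiting factor is the root of 2, rounded up.\<close>
  also have "\<dots> \<le> B * 2"
    using B by (intro mult_left_mono real_le_lsqrt) auto
  finally show "ennreal \<bar>\<integral>x. r x * v x \<partial>?M\<bar> \<le> ennreal (2 * B)" by (intro ennreal_leI) simp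
qed

lemma has_weak_div_diff:
  assumes S: "open S" and F: "\<And>b. b \<in> Basis \<Longrightarrow> (\<lambda>x. F x \<bullet> b) \<in> L2 (lebesgue_on S)"
    and G: "\<And>b. b \<in> Basis \<Longrightarrow> (\<lambda>x. G x \<bullet> b) \<in> L2 (lebesgue_on S)"
    and div: "has_weak_div S F v" "has_weak_div S G w"
  shows "has_weak_div S (\<lambda>x. F x - G x) (\<lambda>x. v x - w x)"
proof -
  have li: "locally_integrable S F" "locally_integrable S G" "locally_integrable S v" "locally_integrable S w"
    using div by (auto simp: has_weak_div_def)
  have "(\<integral>x. (F x - G x) \<bullet> grad \<phi> x \<partial>lebesgue_on S) = - (\<integral>x. (v x - w x) * \<phi> x \<partial>lebesgue_on S)"
    if \<phi>: "\<phi> \<in> test_functions S" for \<phi>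
  proof -
    have i: "integrable (lebesgue_on S) (\<lambda>x. H x \<bullet> grad \<phi> x)"
      if H: "\<And>b. b \<in> Basis \<Longrightarrow> (\<lambda>x. H x \<bullet> b) \<in> L2 (lebesgue_on S)" for H
    proof -
      have "H x \<bullet> grad \<phi> x = (\<Sum>b\<in>Basis. (H x \<bullet> b) * partials [b] \<phi> x)" for x
        by (subst euclidean_inner) (simp add: grad_inner)
      then show ?thesis
        using L2_Cauchy_Schwarz(1)[OF H L2_test_functions[OF test_functions_partial[OF \<phi>] S]]
        by (simp add: Bochner_Integration.integrable_sum)
    qed
    have "(\<integral>x. F x \<bullet> grad \<phi> x \<partial>lebesgue_on S) = - (\<integral>x. v x * \<phi> x \<partial>lebesgue_on S)"
      "(\<integral>x. G x \<bullet> grad \<phi> x \<partial>lebesgue_on S) = - (\<integral>x. w x * \<phi> x \<partial>lebesgue_on S)"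
      using div \<phi> unfolding has_weak_div_def by blast+
    then show ?thesis
      using i[OF F] i[OF G] integrable_locally_integrable_test[OF S li(3) \<phi>] integrable_locally_integrable_test[OF S li(4) \<phi>]
      by (simp add: inner_diff_left left_diff_distrib)
  qed
  then show ?thesis using li by (auto simp: has_weak_div_def locally_integrable_def)
qed

theorem theorem3p2:
  fixes \<Omega> :: "(real ^ 'n) set"
    and a f g q_true :: "real ^ 'n \<Rightarrow> real"
    and u :: "(real ^ 'n \<Rightarrow> real) \<Rightarrow> real ^ 'n \<Rightarrow> real"
    and q_lo q_hi c0 \<epsilon> :: real
  assumes dim: "CARD('n) = 2 \<or> CARD('n) = 3" "CARD('n) = CARD('m) + 1"
    and domain: "open \<Omega>" "bounded \<Omega>" "connected \<Omega>" "\<Omega> \<noteq> {}"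
    and boundary: "C_k_boundary TYPE(real ^ 'm) 2 \<Omega>"
    and a: "a \<in> W_inf 1 \<Omega>" "\<exists>a0>0. AE x in lebesgue_on \<Omega>. a0 \<le> a x"
    and f: "f \<in> L2 (lebesgue_on \<Omega>)"
    and g: "g \<in> Hs_boundary TYPE(real ^ 'm) 2 (3/2) \<Omega>"
    and bounds: "0 < q_lo" "q_lo \<le> q_hi"
    and u: "\<And>q. q \<in> admissible \<Omega> q_lo q_hi \<Longrightarrow> solves_bvp \<Omega> a f g q (u q)"
    and q_true: "q_true \<in> admissible \<Omega> q_lo q_hi"
    and c0: "c0 > 0" "AE x in lebesgue_on \<Omega>. \<bar>u q_true x\<bar> \<ge> c0"
    and \<epsilon>: "\<epsilon> \<in> {0<..<1/2}"
  shows "\<exists>C>0. \<forall>q\<in>admissible \<Omega> q_lo q_hi.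
           H_neg_norm (1 + \<epsilon>) \<Omega> (\<lambda>x. q x - q_true x)
             \<le> ennreal (C * Hs_norm 1 \<Omega> (\<lambda>x. u q x - u q_true x))"
proof -
  let ?M = "lebesgue_on \<Omega>"
  let ?p = "\<lambda>b. weak_deriv \<Omega> [b] (u q_true)"
  have D: "DIM(real ^ 'n) = 2 \<or> DIM(real ^ 'n) = 3" using dim(1) by simp
  then have D2: "DIM(real ^ 'n) \<ge> 2" by auto
  obtain a0 where a0: "a0 > 0" "AE x in ?M. a0 \<le> a x" using a(2) by blast
  \<comment> \<open>\<open>W_inf\<close> bounds a weak derivative \<open>a'\<close> of order zero;
    uniqueness of weak derivatives transfers its bound to \<open>a\<close>.\<close>
  have "[] \<in> dirs 0" by (simp add: dirs_0)
  then obtain a' where a': "a' \<in> Linf ?M" "has_weak_deriv \<Omega> [] a a'" using a(1) unfolding W_inf_def by blast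
  have a_li: "locally_integrable \<Omega> a" using a'(2) by (simp add: has_weak_deriv_def)
  have am: "a \<in> borel_measurable ?M" by (rule locally_integrable_measurable[OF domain(1) a_li])
  obtain B where B: "AE x in ?M. \<bar>a' x\<bar> \<le> B" using a'(1) by (auto simp: Linf_def)
  define A where "A = max B 0"
  have A: "A \<ge> 0" by (simp add: A_def)
  have aA: "AE x in ?M. \<bar>a x\<bar> \<le> A"
    using B has_weak_deriv_unique[OF domain(1) has_weak_deriv_Nil[OF a_li] a'(2)]
    by eventually_elim (auto simp: A_def)
  have a0A: "AE x in ?M. a0 \<le> a x \<and> a x \<le> A" using a0(2) aA by eventually_elim auto
  have adm: "q \<in> L2 ?M" "AE x in ?M. \<bar>q x\<bar> \<le> q_hi" if "q \<in> admissible \<Omega> q_lo q_hi" for q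
  proof -
    show "q \<in> L2 ?M" using that by (simp add: admissible_def)
    have "AE x in ?M. q_lo \<le> q x \<and> q x \<le> q_hi" using that by (simp add: admissible_def)
    then show "AE x in ?M. \<bar>q x\<bar> \<le> q_hi" by eventually_elim (use bounds in auto)
  qed
  have qhi: "q_hi \<ge> 0" using bounds by simp
  have H2: "u q \<in> Hs 2 \<Omega>" if "q \<in> admissible \<Omega> q_lo q_hi" for q
    using u[OF that] by (simp add: solves_bvp_def)
  note uH = Hs_L2[OF domain(1) _ H2, simplified]
  \<comment> \<open>The equation identifies the weak divergence with q u - f, which is square
    integrable because admissible q are bounded.\<close>
  have sol: "\<exists>w. has_weak_div \<Omega> (\<lambda>x. a x *\<^sub>R weak_grad \<Omega> (u q) x) w \<and> w \<in> L2 ?M \<and>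
      (AE x in ?M. w x = q x * u q x - f x)" if q: "q \<in> admissible \<Omega> q_lo q_hi" for q
  proof -
    obtain w where w: "has_weak_div \<Omega> (\<lambda>x. a x *\<^sub>R weak_grad \<Omega> (u q) x) w" "AE x in ?M. - w x + q x * u q x = f x"
      using u[OF q] unfolding solves_bvp_def by blast
    have ae: "AE x in ?M. w x = q x * u q x - f x" using w(2) by eventually_elim simp
    have quL2: "(\<lambda>x. q x * u q x - f x) \<in> L2 ?M"
      by (intro L2_diff f L2_mult_bounded(1)[OF uH(1)[OF q] L2_measurable[OF adm(1)[OF q]] adm(2)[OF q] qhi])
    have "w \<in> L2 ?M"
    proof (rule L2_bounded[OF quL2])
      show "w \<in> borel_measurable ?M"
        using w(1) by (intro locally_integrable_measurable[OF domain(1)]) (simp add: has_weak_div_def)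
      show "AE x in ?M. \<bar>w x\<bar> \<le> 1 * \<bar>q x * u q x - f x\<bar>" using ae by eventually_elim simp
    qed
    then show ?thesis using w(1) ae by blast
  qed
  have comp: "weak_grad \<Omega> v x \<bullet> b = weak_deriv \<Omega> [b] v x" if "b \<in> Basis" for v x and b :: "real ^ 'n"
    using that by (simp add: weak_grad_def inner_sum_left inner_Basis if_distrib cong: if_cong)
  have FL2: "(\<lambda>x. (a x *\<^sub>R weak_grad \<Omega> (u q) x) \<bullet> b) \<in> L2 ?M"
    if q: "q \<in> admissible \<Omega> q_lo q_hi" and b: "b \<in> Basis" for q b
    using L2_mult_bounded(1)[OF uH(3)[OF q b] am aA A] by (simp add: comp[OF b])
  obtain w0 where w0: "has_weak_div \<Omega> (\<lambda>x. a x *\<^sub>R weak_grad \<Omega> (u q_true) x) w0" "w0 \<in> L2 ?M"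
    "AE x in ?M. w0 x = q_true x * u q_true x - f x"
    using sol[OF q_true] by blast
  \<comment> \<open>\<open>K\<close> and \<open>C\<close> are fixed before any q is chosen: they
    involve the true state and the common bounds only.\<close>
  define K where "K = sqrt (2 / a0 * (2 * A + 2 * L2_norm ?M w0 / c0))"
  have K: "K \<ge> 0" unfolding K_def using a0(1) A c0(1) L2_norm_nonneg[of ?M w0]
    by (intro real_sqrt_ge_zero mult_nonneg_nonneg add_nonneg_nonneg divide_nonneg_nonneg) auto
  define C where "C = q_hi / c0 + real DIM(real ^ 'n) * (A / c0 * (1 + K))"
  have C: "C \<ge> 0" unfolding C_def using qhi c0(1) A K by (intro add_nonneg_nonneg mult_nonneg_nonneg) auto
  have log: "(\<lambda>x. \<phi> x * ?p b x / u q_true x) \<in> L2 ?M"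
    "L2_norm ?M (\<lambda>x. \<phi> x * ?p b x / u q_true x) \<le> K * sqrt (H1_sq \<Omega> \<phi> (\<lambda>b. partials [b] \<phi>))"
    if \<phi>: "\<phi> \<in> test_functions \<Omega>" and b: "b \<in> Basis" for \<phi> and b :: "real ^ 'n"
    unfolding K_def
    by (rule log_gradient_estimate[OF domain(1,2) D am a0(1) a0A uH(1,3,2)[OF q_true] c0 w0(2,1) _ A \<phi> b];
        simp add: comp)+
  \<comment> \<open>The factor 2 is the price of the density argument. The added 1 makes the
    constant positive when only \<open>C \<ge> 0\<close> has been recorded.\<close>
  have main: "H_neg_norm (1 + \<epsilon>) \<Omega> (\<lambda>x. q x - q_true x) \<le> ennreal ((2 * C + 1) * Hs_norm 1 \<Omega> (\<lambda>x. u q x - u q_true x))"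
    if q: "q \<in> admissible \<Omega> q_lo q_hi" for q
  proof -
    let ?v = "\<lambda>x. u q x - u q_true x" and ?d = "\<lambda>b x. weak_deriv \<Omega> [b] (u q) x - ?p b x"
    obtain w where w: "has_weak_div \<Omega> (\<lambda>x. a x *\<^sub>R weak_grad \<Omega> (u q) x) w" "w \<in> L2 ?M"
      "AE x in ?M. w x = q x * u q x - f x"
      using sol[OF q] by blast
    have rL2: "(\<lambda>x. q x - q_true x) \<in> L2 ?M" by (rule L2_diff[OF adm(1)[OF q] adm(1)[OF q_true]])
    have vL2: "?v \<in> L2 ?M" by (rule L2_diff[OF uH(1)[OF q] uH(1)[OF q_true]])
    have dL2: "?d b \<in> L2 ?M" if "b \<in> Basis" for b by (rule L2_diff[OF uH(3)[OF q that] uH(3)[OF q_true that]])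
    have vd: "has_weak_deriv \<Omega> [b] ?v (?d b)" if "b \<in> Basis" for b
      by (rule has_weak_deriv_diff[OF domain(1) _ uH(2)[OF q that] uH(2)[OF q_true that]]) (use that in auto)
    obtain b0 :: "real ^ 'n" where "b0 \<in> Basis" using nonempty_Basis by blast
    then have li: "locally_integrable \<Omega> ?v" using vd by (simp add: has_weak_deriv_def)
    \<comment> \<open>The fractional part of 1 is 0, so no Gagliardo term occurs and the right-hand
      norm of the claim is exactly the root of \<open>H1_sq\<close>.\<close>
    have "Hs_norm_sq 1 \<Omega> ?v = ennreal (H1_sq \<Omega> ?v ?d)"
      using weak_deriv_AE_eq[OF domain(1) has_weak_deriv_Nil[OF li]] weak_deriv_AE_eq[OF domain(1) vd]
      by (subst Hs_norm_sq_H1[OF _ _ vL2 dL2]) auto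
    then have N: "Hs_norm 1 \<Omega> ?v = sqrt (H1_sq \<Omega> ?v ?d)" by (simp add: Hs_norm_def H1_sq_nonneg)
    \<comment> \<open>The source term f cancels, and q u -
      \<open>q\<^sup>\<dagger> u\<^sub>0\<close> is regrouped so that the difference of coefficients
      multiplies the true state, the one that is bounded away from 0.\<close>
    have Weq: "AE x in ?M. w x - w0 x = q x * ?v x + (q x - q_true x) * u q_true x"
      using w(3) w0(3) by eventually_elim (simp add: algebra_simps)
    have est: "\<bar>\<integral>x. (q x - q_true x) * \<phi> x \<partial>?M\<bar> \<le> (C * Hs_norm 1 \<Omega> ?v) * sqrt (H1_sq \<Omega> \<phi> (\<lambda>b. partials [b] \<phi>))"
      if \<phi>: "\<phi> \<in> test_functions \<Omega>" for \<phi>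
      unfolding N C_def
      by (rule dual_estimate[OF domain(1,2) am aA A uH(1,3,2)[OF q_true] c0 vL2 dL2 L2_diff[OF w(2) w0(2)]
          has_weak_div_diff[OF domain(1) FL2[OF q] FL2[OF q_true] w(1) w0(1)] _
          L2_measurable[OF adm(1)[OF q]] adm(2)[OF q] qhi rL2 Weq \<phi> log[OF \<phi>] K])
        (simp_all add: comp inner_diff_left right_diff_distrib)
    have N0: "0 \<le> Hs_norm 1 \<Omega> ?v" by (simp add: Hs_norm_def)
    have "H_neg_norm (1 + \<epsilon>) \<Omega> (\<lambda>x. q x - q_true x) \<le> ennreal (2 * (C * Hs_norm 1 \<Omega> ?v))"
      by (rule H_neg_norm_le[OF domain(1,2) _ _ D2 rL2 mult_nonneg_nonneg[OF C N0] est]) (use \<epsilon> in auto)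
    also have "\<dots> \<le> ennreal ((2 * C + 1) * Hs_norm 1 \<Omega> ?v)"
      using N0 by (intro ennreal_leI) (simp add: algebra_simps)
    finally show ?thesis .
  qed
  then show ?thesis using C by (intro exI[of _ "2 * C + 1"]) auto
qed

end
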